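(* Let $k\ge1$ be an integer and $p\in(0,2k]$. If the symbol $\varphi\in\mathfrak{G}_0$ maps the right half-plane $\mathbb{C}_0$ into the angular sector $$\Omega=\left\{s\in\mathbb{C}_{1/2}:\ \left|\arg\left(s-\tfrac12\right)\right|<\frac{p\pi}{4k}\right\},$$ then $C_\varphi$ is bounded on $\mathcal{H}^p$. Furthermore, if $q\in(\max(1,p),2k]$, then $C_\varphi$ is compact on $\mathcal{H}^q$.
   Context: For $\theta\in\mathbb{R}$, $\mathbb{C}_\theta=\{s\in\mathbb{C}:\Re s>\theta\}$. For $0<p<\infty$, the Hardy space $\mathcal{H}^p$ of Dirichlet series is the completion of the Dirichlet polynomials $P(s)=\sum_{n\le N}a_n n^{-s}$ under the norm (quasi-norm if $0<p<1$) $$\|P\|_{\mathcal{H}^p}=\left(\lim_{T\to\infty}\frac{1}{2T}\int_{-T}^{T}|P(it)|^p\,dt\right)^{1/p};$$ its elements are Dirichlet series holomorphic in $\mathbb{C}_{1/2}$. $\mathfrak{G}_0$ is the class of (somewhere convergent) Dirichlet series $\varphi(s)=\sum_{n\ge1}c_n n^{-s}$ that define a holomorphic function on $\mathbb{C}_0$ with $\varphi(\mathbb{C}_0)\subset\mathbb{C}_{1/2}$. The composition operator is $C_\varphi f=f\circ\varphi$. *)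

theory Defs
  imports "HOL-Complex_Analysis.Complex_Analysis"
begin

definition right_half_plane :: "real \<Rightarrow> complex set" where
  "right_half_plane \<theta> = {s. Re s > \<theta>}"

definition dirichlet_polynomial :: "(complex \<Rightarrow> complex) \<Rightarrow> bool" where
  "dirichlet_polynomial P \<longleftrightarrow>
     (\<exists>N a. P = (\<lambda>s. \<Sum>n = 1..N. a n * of_nat n powr (- s)))"

text \<open>The norm (quasi-norm if \<open>p < 1\<close>) of a Dirichlet polynomial. The limit exists because
  \<open>t \<mapsto> \<bar>P(it)\<bar>\<^sup>p\<close> is almost periodic.\<close>

definition polynomial_norm :: "real \<Rightarrow> (complex \<Rightarrow> complex) \<Rightarrow> real" where
  "polynomial_norm p P =
     (Lim at_top (\<lambda>T. 1 / (2 * T) *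
        integral {- T..T} (\<lambda>t. norm (P (\<i> * complex_of_real t)) powr p))) powr (1 / p)"

text \<open>An element of the completion is represented by a Cauchy sequence of Dirichlet polynomials.
  Point evaluations at points of \<open>\<complex>\<^bsub>1/2\<^esub>\<close> are bounded, locally uniformly, so such a sequence
  converges there to a holomorphic function, and the element is identified with that function.
  Only the values on \<open>\<complex>\<^bsub>1/2\<^esub>\<close> matter: total functions that agree on this half-plane
  stand for the same element.\<close>

definition represents :: "real \<Rightarrow> (nat \<Rightarrow> complex \<Rightarrow> complex) \<Rightarrow> (complex \<Rightarrow> complex) \<Rightarrow> bool" where
  "represents p P f \<longleftrightarrow>
     (\<forall>j. dirichlet_polynomial (P j)) \<and>
     (\<forall>\<epsilon>>0. \<exists>N. \<forall>i\<ge>N. \<forall>j\<ge>N. polynomial_norm p (\<lambda>s. P i s - P j s) < \<epsilon>) \<and>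
     (\<forall>s\<in>right_half_plane (1 / 2). (\<lambda>j. P j s) \<longlonglongrightarrow> f s)"

definition hardy_space :: "real \<Rightarrow> (complex \<Rightarrow> complex) set" where
  "hardy_space p = {f. \<exists>P. represents p P f}"

text \<open>The norm of the completion is the limit of the norms along a representing sequence.
  An element of the completion is determined by its function, hence for \<open>f\<close> in the space the set
  below is a singleton, and \<open>Inf\<close> merely selects its only member.\<close>

definition hardy_norm :: "real \<Rightarrow> (complex \<Rightarrow> complex) \<Rightarrow> real" where
  "hardy_norm p f =
     Inf {L. \<exists>P. represents p P f \<and> (\<lambda>j. polynomial_norm p (P j)) \<longlonglongrightarrow> L}"

definition bounded_on_hardy ::
    "real \<Rightarrow> ((complex \<Rightarrow> complex) \<Rightarrow> complex \<Rightarrow> complex) \<Rightarrow> bool" where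
  "bounded_on_hardy p T \<longleftrightarrow>
     (\<forall>f\<in>hardy_space p. T f \<in> hardy_space p) \<and>
     (\<exists>C. \<forall>f\<in>hardy_space p. hardy_norm p (T f) \<le> C * hardy_norm p f)"

definition compact_on_hardy ::
    "real \<Rightarrow> ((complex \<Rightarrow> complex) \<Rightarrow> complex \<Rightarrow> complex) \<Rightarrow> bool" where
  "compact_on_hardy p T \<longleftrightarrow>
     (\<forall>f\<in>hardy_space p. T f \<in> hardy_space p) \<and>
     (\<forall>f :: nat \<Rightarrow> complex \<Rightarrow> complex.
        (\<forall>n. f n \<in> hardy_space p) \<and> (\<exists>B. \<forall>n. hardy_norm p (f n) \<le> B) \<longrightarrow>
        (\<exists>r g. strict_mono r \<and> g \<in> hardy_space p \<and>
           (\<lambda>n. hardy_norm p (\<lambda>s. T (f (r n)) s - g s)) \<longlonglongrightarrow> 0))"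

text \<open>A Dirichlet series that converges somewhere converges in a half-plane \<open>\<complex>\<^bsub>\<sigma>\<^esub>\<close>; the symbol is its
  holomorphic extension to \<open>\<complex>\<^bsub>0\<^esub>\<close>. Values of \<open>\<phi>\<close> outside \<open>\<complex>\<^bsub>0\<^esub>\<close> are
  irrelevant, since \<open>\<sigma>\<close> may always be taken nonnegative.\<close>

definition symbol_class_G0 :: "(complex \<Rightarrow> complex) set" where
  "symbol_class_G0 =
     {\<phi>. \<phi> holomorphic_on right_half_plane 0 \<and>
         \<phi> ` right_half_plane 0 \<subseteq> right_half_plane (1 / 2) \<and>
         (\<exists>c \<sigma>. \<forall>s\<in>right_half_plane \<sigma>.
            (\<lambda>n. c (Suc n) * of_nat (Suc n) powr (- s)) sums \<phi> s)}"

definition composition_operator ::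
    "(complex \<Rightarrow> complex) \<Rightarrow> (complex \<Rightarrow> complex) \<Rightarrow> complex \<Rightarrow> complex" where
  "composition_operator \<phi> f = f \<circ> \<phi>"

definition angular_sector :: "real \<Rightarrow> complex set" where
  "angular_sector \<alpha> = {s \<in> right_half_plane (1 / 2). \<bar>Arg (s - 1 / 2)\<bar> < \<alpha>}"

end

theory Submission
  imports Defs "HOL-Probability.Characteristic_Functions"
    "HOL-Computational_Algebra.Fundamental_Theorem_Algebra"
    "HOL-Computational_Algebra.Primes" "HOL-Real_Asymp.Real_Asymp"
begin

text \<open>Composing a Dirichlet polynomial \<open>D\<close> with the symbol gives a bounded Dirichlet series, so the
theorem is a matter of bounding, uniformly in \<open>d > 0\<close>, the mean over \<open>t\<close> of
\<open>\<bar>D (\<phi> (d + it))\<bar>\<^sup>p\<close> by the \<open>p\<close>-th power of the norm of \<open>D\<close>. The tool is a mean value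
principle. If \<open>H\<close> is holomorphic and bounded on the half-plane \<open>Re s > 1/2\<close>, then \<open>H \<circ> \<phi>\<close> is a
bounded Dirichlet series with constant coefficient \<open>H c\<close>, where \<open>c\<close> is the limit of \<open>\<phi>\<close> at
\<open>+\<infinity>\<close>; hence \<open>Re (H \<circ> \<phi>)\<close> has mean \<open>Re (H c)\<close> on every vertical line
(\<open>bounded_dirichlet_compose\<close>, \<open>bounded_dirichlet_mean\<close>). It therefore suffices to dominate
\<open>\<bar>D\<bar>\<^sup>p\<close> on the range of \<open>\<phi>\<close> by the real part of such an \<open>H\<close> with \<open>Re (H c)\<close> under control.

If \<open>p = 2k\<close>, the sector is the whole half-plane. Passing from \<open>D\<close> to its \<open>k\<close>-th power leaves the
case \<open>p = 2\<close>. For \<open>D = \<Sum> a\<^sub>n n powr (- s)\<close> the square \<open>\<bar>D\<bar>\<^sup>2\<close> agrees on the line \<open>Re s = 1/2\<close> with the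
real part of an explicit \<open>H\<close>. Inside the half-plane \<open>Re H - \<bar>D\<bar>\<^sup>2\<close> is a quadratic form whose kernel
is a nonnegative increasing function of \<open>min n m\<close>, hence positive semidefinite, and Schur's test bounds \<open>Re (H c)\<close> by a
multiple of \<open>\<Sum> \<bar>a\<^sub>n\<bar>\<^sup>2\<close> (\<open>analytic_majorant_ge_square\<close>, \<open>Re_analytic_majorant_le\<close>).

If \<open>p < 2k\<close>, the half-opening \<open>\<alpha>\<close> of the sector is less than \<open>\<pi>/2\<close>. For every exponent \<open>q > 0\<close> there
is the point estimate \<open>\<bar>D s\<bar>\<^sup>q \<le> (1 + 1 / (2 Re s - 1)) \<parallel>D\<parallel>\<^sup>q\<close>
(\<open>dirichlet_polynomial_point_estimate\<close>), and in the sector its right-hand side has size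
\<open>1 / \<bar>w\<bar>\<close> for small \<open>w = s - 1/2\<close>. Choose \<open>\<beta> > 1\<close> with \<open>\<beta>\<alpha> < \<pi>/2\<close>. Then \<open>\<bar>w\<bar> powr (- \<beta>)\<close> is comparable to the
real part of the corresponding power of \<open>w\<close>, so its mean along \<open>\<phi>\<close> is finite; since it dwarfs
\<open>1 / \<bar>w\<bar>\<close> near \<open>w = 0\<close>, the part of the mean coming from small \<open>w\<close> is an arbitrarily small
multiple of \<open>\<parallel>D\<parallel>\<^sup>q\<close>. The same holds for large \<open>w\<close>, because the mean of \<open>\<bar>w\<bar>\<close> is finite too. What remains
is a compact subset of the half-plane (\<open>sector_mean_estimate\<close>). The point estimate on this set
gives boundedness. For compactness, Montel's theorem yields a subsequence of a bounded sequence that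
converges uniformly on the set, and its image under the operator is then a Cauchy sequence.

Two classical results carry these arguments. The point estimate for all exponents comes from the
polydisc: a Dirichlet polynomial is a polynomial in the variables \<open>q powr (- s)\<close>, \<open>q\<close> prime, its mean is
invariant under rotating each variable, and the sharp estimate on the disc evaluates one variable
at the cost of a factor \<open>1 - q powr (- 2 Re s)\<close> (\<open>freq_sum_eval_prime\<close>); the product of these factors is bounded
below by sieving. Bohr's theorem, that a bounded Dirichlet series is a uniform limit of Dirichlet
polynomials on smaller half-planes (\<open>bounded_dirichlet_uniform_approx\<close>), follows from Gaussian averaging along
vertical lines, which multiplies the coefficients by a factor that decays faster than every power
of \<open>n\<close>. With it the estimates pass from Dirichlet polynomials to the completion
(\<open>compose_represents\<close>).\<close>

text \<open>The function \<open>n powr (- s)\<close>, written with the exponential so that products and conjugates are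
governed by the laws of \<open>exp\<close>.\<close>

abbreviation npow :: "nat \<Rightarrow> complex \<Rightarrow> complex" where
  "npow n s \<equiv> exp (- (s * of_real (ln (real n))))"

abbreviation vline :: "real \<Rightarrow> real \<Rightarrow> complex" where
  "vline d t \<equiv> of_real d + \<i> * of_real t"

section \<open>Means over the real line\<close>

definition avg :: "real \<Rightarrow> (real \<Rightarrow> 'a::banach) \<Rightarrow> 'a" where
  "avg T u = (1 / (2 * T)) *\<^sub>R integral {-T..T} u"

definition has_mean :: "(real \<Rightarrow> 'a::banach) \<Rightarrow> 'a \<Rightarrow> bool" where
  "has_mean u m \<longleftrightarrow> ((\<lambda>T. avg T u) \<longlongrightarrow> m) at_top"

text \<open>An upper bound for the limit superior of the averages. It makes sense for functions such as
\<open>\<bar>F (d + it)\<bar>\<^sup>p\<close> before the mean is known to exist, and it is closed under sums and limits.\<close>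

definition mean_le :: "(real \<Rightarrow> real) \<Rightarrow> real \<Rightarrow> bool" where
  "mean_le u c \<longleftrightarrow> (\<forall>e>0. eventually (\<lambda>T. avg T u \<le> c + e) at_top)"

lemma one_over_Suc_less: "e > 0 \<Longrightarrow> \<exists>N. \<forall>k\<ge>N. 1 / real (Suc k) < e"
proof -
  assume "e > 0"
  then obtain N where N: "inverse (real (Suc N)) < e"
    using reals_Archimedean by blast
  show ?thesis
  proof (intro exI[of _ N] allI impI)
    fix k assume "N \<le> k"
    then have "1 / real (Suc k) \<le> 1 / real (Suc N)"
      by (intro divide_left_mono) auto
    then show "1 / real (Suc k) < e"
      using N by (simp add: inverse_eq_divide)
  qed
qed

lemma continuous_imp_integrable_symmetric:
  fixes u :: "real \<Rightarrow> 'a::banach"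
  assumes "continuous_on UNIV u"
  shows "u integrable_on {-T..T}"
  by (rule integrable_continuous_real) (rule continuous_on_subset[OF assms], simp)

lemma avg_add:
  fixes u :: "real \<Rightarrow> 'a::banach"
  assumes "continuous_on UNIV u" "continuous_on UNIV v"
  shows "avg T (\<lambda>t. u t + v t) = avg T u + avg T v"
  unfolding avg_def
  by (simp add: integral_add continuous_imp_integrable_symmetric assms scaleR_right_distrib)

lemma avg_diff:
  fixes u :: "real \<Rightarrow> 'a::banach"
  assumes "continuous_on UNIV u" "continuous_on UNIV v"
  shows "avg T (\<lambda>t. u t - v t) = avg T u - avg T v"
  unfolding avg_def
  by (simp add: integral_diff continuous_imp_integrable_symmetric assms scaleR_right_diff_distrib)

lemma avg_cmult:
  fixes u :: "real \<Rightarrow> 'a::{real_normed_field, banach}"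
  shows "avg T (\<lambda>t. c * u t) = c * avg T u"
  unfolding avg_def by simp

lemma avg_const: "T > 0 \<Longrightarrow> avg T (\<lambda>t. c) = c"
  unfolding avg_def by simp

lemma avg_mono:
  fixes u :: "real \<Rightarrow> real"
  assumes "continuous_on UNIV u" "continuous_on UNIV v" "\<And>t. u t \<le> v t" "T > 0"
  shows "avg T u \<le> avg T v"
  unfolding avg_def
  using assms by (auto intro!: divide_right_mono integral_le continuous_imp_integrable_symmetric)

lemma norm_avg_le:
  fixes u :: "real \<Rightarrow> 'a::banach"
  assumes "continuous_on UNIV u" "\<And>t. norm (u t) \<le> B" "T > 0"
  shows "norm (avg T u) \<le> B"
proof -
  have "norm (integral {-T..T} u) \<le> B * (T - (-T))"
    by (rule integral_bound) (use assms in \<open>auto intro: continuous_on_subset\<close>)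
  then show ?thesis
    unfolding avg_def using assms(3) by (simp add: field_simps)
qed

lemma has_mean_add:
  fixes u :: "real \<Rightarrow> 'a::banach"
  assumes "continuous_on UNIV u" "continuous_on UNIV v" "has_mean u m" "has_mean v n"
  shows "has_mean (\<lambda>t. u t + v t) (m + n)"
  using assms(3,4) unfolding has_mean_def avg_add[OF assms(1,2)] by (rule tendsto_add)

lemma has_mean_diff:
  fixes u :: "real \<Rightarrow> 'a::banach"
  assumes "continuous_on UNIV u" "continuous_on UNIV v" "has_mean u m" "has_mean v n"
  shows "has_mean (\<lambda>t. u t - v t) (m - n)"
  using assms(3,4) unfolding has_mean_def avg_diff[OF assms(1,2)] by (rule tendsto_diff)

lemma has_mean_cmult:
  fixes u :: "real \<Rightarrow> 'a::{real_normed_field, banach}"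
  assumes "has_mean u m"
  shows "has_mean (\<lambda>t. c * u t) (c * m)"
  using assms unfolding has_mean_def avg_cmult by (intro tendsto_intros)

lemma has_mean_const: "has_mean (\<lambda>t. c) c"
  unfolding has_mean_def
  by (rule tendsto_eventually) (use eventually_gt_at_top[of "0::real"] in eventually_elim, simp add: avg_const)

lemma has_mean_Re:
  fixes u :: "real \<Rightarrow> complex"
  assumes "continuous_on UNIV u" "has_mean u m"
  shows "has_mean (\<lambda>t. Re (u t)) (Re m)"
proof -
  have "avg T (\<lambda>t. Re (u t)) = Re (avg T u)" for T
    using integral_linear[OF continuous_imp_integrable_symmetric[OF assms(1), of T] bounded_linear_Re]
    unfolding avg_def o_def by simp
  then show ?thesis
    using assms(2) unfolding has_mean_def by (simp add: tendsto_Re)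
qed

lemma has_mean_unique: "has_mean u m \<Longrightarrow> has_mean u n \<Longrightarrow> m = n"
  unfolding has_mean_def by (rule tendsto_unique) auto

text \<open>The mean is a contraction for the supremum norm.\<close>

lemma has_mean_dist:
  fixes u :: "real \<Rightarrow> 'a::banach"
  assumes "continuous_on UNIV u" "continuous_on UNIV v" "has_mean u m" "has_mean v n"
    and "\<And>t. norm (u t - v t) \<le> e"
  shows "norm (m - n) \<le> e"
proof -
  have "has_mean (\<lambda>t. u t - v t) (m - n)"
    by (rule has_mean_diff[OF assms(1-4)])
  then have "((\<lambda>T. norm (avg T (\<lambda>t. u t - v t))) \<longlongrightarrow> norm (m - n)) at_top"
    unfolding has_mean_def by (rule tendsto_norm)
  moreover have "eventually (\<lambda>T. norm (avg T (\<lambda>t. u t - v t)) \<le> e) at_top"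
    using eventually_gt_at_top[of "0::real"]
    by eventually_elim (use assms in \<open>auto intro!: norm_avg_le continuous_intros\<close>)
  ultimately show ?thesis
    by (rule tendsto_upperbound) auto
qed

lemma has_mean_uniform_approx:
  fixes u :: "real \<Rightarrow> 'a::banach"
  assumes u: "continuous_on UNIV u"
    and approx: "\<And>e. e > 0 \<Longrightarrow>
      \<exists>v n. continuous_on UNIV v \<and> has_mean v n \<and> (\<forall>t. norm (u t - v t) \<le> e) \<and> norm (n - m) \<le> e"
  shows "has_mean u m"
  unfolding has_mean_def
proof (rule tendstoI)
  fix e :: real assume "e > 0"
  then obtain v n where v: "continuous_on UNIV v" "has_mean v n" "\<And>t. norm (u t - v t) \<le> e/4" "norm (n - m) \<le> e/4"
    using approx[of "e/4"] by auto
  have "eventually (\<lambda>T. dist (avg T v) n < e/4) at_top"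
    using v(2) \<open>e > 0\<close> unfolding has_mean_def by (intro tendstoD) auto
  then show "eventually (\<lambda>T. dist (avg T u) m < e) at_top"
    using eventually_gt_at_top[of "0::real"]
  proof eventually_elim
    case (elim T)
    have "norm (avg T u - avg T v) \<le> e/4"
      unfolding avg_diff[OF u v(1), symmetric]
      by (rule norm_avg_le) (use u v elim in \<open>auto intro!: continuous_intros\<close>)
    then have "dist (avg T u) (avg T v) \<le> e/4" "dist n m \<le> e/4"
      using v(4) by (auto simp: dist_norm)
    then show ?case
      using elim \<open>e > 0\<close> dist_triangle[of "avg T u" m "avg T v"] dist_triangle[of "avg T v" m n] by linarith
  qed
qed

text \<open>The means of the approximants form a Cauchy sequence because the mean is a contraction; their
limit is the mean of the uniform limit.\<close>

lemma has_mean_uniform_limit: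
  fixes u :: "real \<Rightarrow> 'a::banach"
  assumes u: "continuous_on UNIV u"
    and approx: "\<And>e. e > 0 \<Longrightarrow>
      \<exists>v n. continuous_on UNIV v \<and> has_mean v n \<and> (\<forall>t. norm (u t - v t) \<le> e)"
  shows "\<exists>m. has_mean u m"
proof -
  have "\<exists>v n. continuous_on UNIV v \<and> has_mean v n \<and> (\<forall>t. norm (u t - v t) \<le> 1 / real (Suc k))" for k
    by (rule approx) simp
  then obtain v n where v: "\<And>k. continuous_on UNIV (v k)" "\<And>k. has_mean (v k) (n k)"
      "\<And>k t. norm (u t - v k t) \<le> 1 / real (Suc k)"
    by metis
  have nd: "norm (n k - n l) \<le> 1 / real (Suc k) + 1 / real (Suc l)" for k l
  proof (rule has_mean_dist[OF v(1) v(1) v(2) v(2)])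
    fix t
    show "norm (v k t - v l t) \<le> 1 / real (Suc k) + 1 / real (Suc l)"
      using norm_triangle_ineq4[of "u t - v l t" "u t - v k t"] v(3)[of t k] v(3)[of t l] by simp
  qed
  have "Cauchy n"
  proof (rule CauchyI)
    fix e :: real assume "e > 0"
    then obtain N where "\<And>k. k \<ge> N \<Longrightarrow> 1 / real (Suc k) < e/2"
      using one_over_Suc_less[of "e/2"] by auto
    then show "\<exists>M. \<forall>i\<ge>M. \<forall>j\<ge>M. norm (n i - n j) < e"
      using nd by (smt (verit) field_sum_of_halves)
  qed
  then obtain m where m: "n \<longlonglongrightarrow> m"
    using Cauchy_convergent_iff convergent_def by blast
  have "has_mean u m"
  proof (rule has_mean_uniform_approx[OF u])
    fix e :: real assume "e > 0"
    obtain N where N: "\<And>k. k \<ge> N \<Longrightarrow> 1 / real (Suc k) < e"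
      using one_over_Suc_less[OF \<open>e > 0\<close>] by auto
    obtain N' where N': "\<And>k. k \<ge> N' \<Longrightarrow> norm (n k - m) < e"
      using LIMSEQ_D[OF m \<open>e > 0\<close>] by auto
    have "continuous_on UNIV (v (max N N')) \<and> has_mean (v (max N N')) (n (max N N')) \<and>
       (\<forall>t. norm (u t - v (max N N') t) \<le> e) \<and> norm (n (max N N') - m) \<le> e"
    proof (intro conjI allI)
      show "norm (u t - v (max N N') t) \<le> e" for t
        using v(3)[of t "max N N'"] N[of "max N N'"] by linarith
      show "norm (n (max N N') - m) \<le> e"
        using N'[of "max N N'"] by simp
    qed (rule v)+
    then show "\<exists>v n. continuous_on UNIV v \<and> has_mean v n \<and> (\<forall>t. norm (u t - v t) \<le> e) \<and> norm (n - m) \<le> e"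
      by blast
  qed
  then show ?thesis ..
qed

lemma has_mean_imp_mean_le: "has_mean u m \<Longrightarrow> m \<le> c \<Longrightarrow> mean_le u c"
  unfolding has_mean_def mean_le_def
proof (intro allI impI)
  fix e :: real
  assume "((\<lambda>T. avg T u) \<longlongrightarrow> m) at_top" "m \<le> c" "0 < e"
  then have "eventually (\<lambda>T. avg T u < c + e) at_top"
    by (intro order_tendstoD) auto
  then show "eventually (\<lambda>T. avg T u \<le> c + e) at_top"
    by eventually_elim simp
qed

lemma mean_le_has_mean: "mean_le u c \<Longrightarrow> has_mean u m \<Longrightarrow> m \<le> c"
  unfolding has_mean_def mean_le_def
  by (rule field_le_epsilon) (rule tendsto_upperbound, auto)

lemma mean_le_mono:
  assumes "mean_le v c" "continuous_on UNIV u" "continuous_on UNIV v" "\<And>t. u t \<le> v t" "c \<le> d"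
  shows "mean_le u d"
  unfolding mean_le_def
proof (intro allI impI)
  fix e :: real assume "e > 0"
  then have "eventually (\<lambda>T. avg T v \<le> c + e) at_top"
    using assms(1) by (auto simp: mean_le_def)
  then show "eventually (\<lambda>T. avg T u \<le> d + e) at_top"
    using eventually_gt_at_top[of "0::real"]
    by eventually_elim (use assms avg_mono[of u v] in force)
qed

lemma mean_le_add:
  assumes "mean_le u c" "mean_le v d" "continuous_on UNIV u" "continuous_on UNIV v"
  shows "mean_le (\<lambda>t. u t + v t) (c + d)"
  unfolding mean_le_def
proof (intro allI impI)
  fix e :: real assume "e > 0"
  then have "eventually (\<lambda>T. avg T u \<le> c + e/2) at_top" "eventually (\<lambda>T. avg T v \<le> d + e/2) at_top"
    using assms(1,2) by (auto simp: mean_le_def)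
  then show "eventually (\<lambda>T. avg T (\<lambda>t. u t + v t) \<le> c + d + e) at_top"
    by eventually_elim (simp add: avg_add assms)
qed

lemma mean_le_cmult:
  assumes "mean_le u c" "a \<ge> 0"
  shows "mean_le (\<lambda>t. a * u t) (a * c)"
  unfolding mean_le_def
proof (intro allI impI)
  fix e :: real assume "e > 0"
  then have "eventually (\<lambda>T. avg T u \<le> c + e/(a+1)) at_top"
    using assms by (auto simp: mean_le_def)
  then show "eventually (\<lambda>T. avg T (\<lambda>t. a * u t) \<le> a * c + e) at_top"
  proof eventually_elim
    case (elim T)
    have "a * avg T u \<le> a * (c + e/(a+1))"
      using elim assms(2) by (rule mult_left_mono)
    also have "\<dots> \<le> a * c + e"
      using assms(2) \<open>e > 0\<close> by (simp add: field_simps)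
    finally show ?case by (simp add: avg_cmult)
  qed
qed

lemma mean_le_const: "c \<le> d \<Longrightarrow> mean_le (\<lambda>t. c) d"
  by (rule has_mean_imp_mean_le[OF has_mean_const])

lemma mean_le_closed: "(\<And>e. e > 0 \<Longrightarrow> mean_le u (c + e)) \<Longrightarrow> mean_le u c"
  unfolding mean_le_def
proof (intro allI impI)
  fix e :: real
  assume "\<And>e. 0 < e \<Longrightarrow> \<forall>ea>0. eventually (\<lambda>T. avg T u \<le> c + e + ea) at_top" "0 < e"
  then have "eventually (\<lambda>T. avg T u \<le> c + e/2 + e/2) at_top"
    using half_gt_zero by blast
  then show "eventually (\<lambda>T. avg T u \<le> c + e) at_top"
    by eventually_elim simp
qed

lemma mean_le_nonneg:
  assumes "mean_le u c" "continuous_on UNIV u" "\<And>t. u t \<ge> 0"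
  shows "c \<ge> 0"
proof (rule mean_le_has_mean)
  show "mean_le (\<lambda>t. 0) c"
    by (rule mean_le_mono[OF assms(1) _ assms(2)]) (use assms(3) in auto)
qed (rule has_mean_const)

text \<open>The primitive of a nonconstant exponential is bounded, so its averages tend to \<open>0\<close>.\<close>

lemma has_mean_exp:
  "has_mean (\<lambda>t. exp (\<i> * of_real (l * t))) (if l = 0 then 1 else 0)"
proof (cases "l = 0")
  case True
  then show ?thesis by (simp add: has_mean_const)
next
  case False
  have I: "norm (integral {-T..T} (\<lambda>t. exp (\<i> * of_real (l * t)))) \<le> 2 / \<bar>l\<bar>" if "T > 0" for T
  proof -
    have "((\<lambda>t. exp (\<i> * of_real (l * t))) has_integral
        exp (\<i> * of_real (l * T)) / (\<i> * of_real l) - exp (\<i> * of_real (l * (-T))) / (\<i> * of_real l)) {-T..T}"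
    proof (rule fundamental_theorem_of_calculus)
      fix t assume "t \<in> {-T..T}"
      have "((\<lambda>z. exp (\<i> * of_real l * z) / (\<i> * of_real l)) has_field_derivative exp (\<i> * of_real l * of_real t))
          (at (of_real t))"
        using False by (auto intro!: derivative_eq_intros)
      from has_vector_derivative_real_field[OF this]
      show "((\<lambda>t. exp (\<i> * of_real (l * t)) / (\<i> * of_real l)) has_vector_derivative exp (\<i> * of_real (l * t)))
          (at t within {-T..T})"
        by (simp add: mult_ac)
    qed (use that in simp)
    then have eq: "integral {-T..T} (\<lambda>t. exp (\<i> * of_real (l * t))) =
      exp (\<i> * of_real (l * T)) / (\<i> * of_real l) - exp (\<i> * of_real (l * (-T))) / (\<i> * of_real l)"
      by (rule integral_unique)
    have n: "norm (exp (\<i> * of_real x) / (\<i> * of_real l)) = 1 / \<bar>l\<bar>" for x :: real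
      by (simp add: norm_divide norm_mult)
    show ?thesis
      unfolding eq by (rule order_trans[OF norm_triangle_ineq4]) (use n[of "l * T"] n[of "l * (-T)"] in linarith)
  qed
  have "((\<lambda>T. avg T (\<lambda>t. exp (\<i> * of_real (l * t)))) \<longlongrightarrow> 0) at_top"
  proof (rule Lim_null_comparison)
    show "eventually (\<lambda>T. norm (avg T (\<lambda>t. exp (\<i> * of_real (l * t)))) \<le> (1/\<bar>l\<bar>) / T) at_top"
      using eventually_gt_at_top[of "0::real"]
    proof eventually_elim
      case (elim T)
      then show ?case
        using I[OF elim] False unfolding avg_def by (simp add: field_simps)
    qed
    show "((\<lambda>T::real. (1/\<bar>l\<bar>) / T) \<longlongrightarrow> 0) at_top"
      by real_asymp
  qed
  then show ?thesis
    using False by (simp add: has_mean_def)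
qed

lemma has_mean_exp_sum:
  "has_mean (\<lambda>t. \<Sum>i\<in>I. c i * exp (\<i> * of_real (l i * t))) (\<Sum>i\<in>I. c i * (if l i = 0 then 1 else 0))"
proof (induction I rule: infinite_finite_induct)
  case (insert x F)
  then show ?case
    by (simp only: sum.insert[OF insert.hyps]) (intro has_mean_add continuous_intros has_mean_cmult has_mean_exp)
qed (simp_all add: has_mean_const)

section \<open>Rotation invariant means\<close>

text \<open>Trigonometric polynomials in \<open>t\<close> with frequencies \<open>ln (m/n)\<close> that carry a second variable
\<open>\<theta>\<close>. With \<open>v\<close> the multiplicity of a prime, \<open>\<theta>\<close> rotates the variable of the polydisc that
belongs to this prime. The frequencies of \<open>t\<close> and of \<open>\<theta>\<close> are tied to the same pair \<open>(n, m)\<close>: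
frequency \<open>0\<close> in \<open>t\<close> forces frequency \<open>0\<close> in \<open>\<theta>\<close>.\<close>

inductive twisted_trig :: "(nat \<Rightarrow> nat) \<Rightarrow> (real \<Rightarrow> real \<Rightarrow> complex) \<Rightarrow> bool" for v where
  monomial: "n \<ge> 1 \<Longrightarrow> m \<ge> 1 \<Longrightarrow>
    twisted_trig v (\<lambda>\<theta> t. c * exp (\<i> * of_real ((real (v n) - real (v m)) * \<theta> + (ln (real m) - ln (real n)) * t)))"
| add: "twisted_trig v f \<Longrightarrow> twisted_trig v g \<Longrightarrow> twisted_trig v (\<lambda>\<theta> t. f \<theta> t + g \<theta> t)"

lemma twisted_trig_continuous: "twisted_trig v f \<Longrightarrow> continuous_on UNIV (f \<theta>)"
  by (induction rule: twisted_trig.induct) (intro continuous_intros; assumption?)+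

lemma twisted_trig_const: "twisted_trig v (\<lambda>\<theta> t. c)"
  using twisted_trig.monomial[of 1 1 v c] by simp

lemma twisted_trig_sum:
  "(\<And>i. i \<in> I \<Longrightarrow> twisted_trig v (f i)) \<Longrightarrow> twisted_trig v (\<lambda>\<theta> t. \<Sum>i\<in>I. f i \<theta> t)"
  by (induction I rule: infinite_finite_induct) (auto intro: twisted_trig_const twisted_trig.add)

lemma twisted_trig_cnj: "twisted_trig v f \<Longrightarrow> twisted_trig v (\<lambda>\<theta> t. cnj (f \<theta> t))"
proof (induction rule: twisted_trig.induct)
  case (monomial n m c)
  have "twisted_trig v (\<lambda>\<theta> t. cnj c * exp (\<i> * of_real ((real (v m) - real (v n)) * \<theta> + (ln (real n) - ln (real m)) * t)))"
    by (rule twisted_trig.monomial) fact+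
  then show ?case
    by (simp add: exp_cnj algebra_simps)
next
  case (add f g)
  then show ?case by (simp add: twisted_trig.add)
qed

lemma twisted_trig_mult:
  assumes v: "\<And>n m. n \<ge> 1 \<Longrightarrow> m \<ge> 1 \<Longrightarrow> v (n * m) = v n + v m"
    and "twisted_trig v f" "twisted_trig v g"
  shows "twisted_trig v (\<lambda>\<theta> t. f \<theta> t * g \<theta> t)"
  using assms(2)
proof (induction rule: twisted_trig.induct)
  case (monomial n m c)
  note nm = this
  show ?case
    using assms(3)
  proof (induction rule: twisted_trig.induct)
    case (monomial n' m' c')
    have "twisted_trig v (\<lambda>\<theta> t. (c * c') * exp (\<i> * of_real ((real (v (n * n')) - real (v (m * m'))) * \<theta> + (ln (real (m * m')) - ln (real (n * n'))) * t)))"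
      by (rule twisted_trig.monomial) (use nm monomial in auto)
    then show ?case
      using nm monomial by (simp add: v ln_mult exp_add[symmetric] algebra_simps)
  next
    case (add f g)
    then show ?case by (simp only: distrib_left) (rule twisted_trig.add)
  qed
next
  case (add f g)
  then show ?case by (simp only: distrib_right) (rule twisted_trig.add)
qed

lemma twisted_trig_power:
  assumes "\<And>n m. n \<ge> 1 \<Longrightarrow> m \<ge> 1 \<Longrightarrow> v (n * m) = v n + v m" "twisted_trig v f"
  shows "twisted_trig v (\<lambda>\<theta> t. f \<theta> t ^ k)"
  by (induction k) (auto intro: twisted_trig_const twisted_trig_mult assms)

text \<open>Only the monomials with \<open>n = m\<close> survive the mean over \<open>t\<close>, and these do not involve \<open>\<theta>\<close>.\<close>

lemma twisted_trig_has_mean: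
  assumes "twisted_trig v f"
  shows "\<exists>m. \<forall>\<theta>. has_mean (f \<theta>) m"
  using assms
proof (induction rule: twisted_trig.induct)
  case (monomial n m c)
  show ?case
  proof (cases "n = m")
    case True
    then show ?thesis using has_mean_const by auto
  next
    case False
    have *: "has_mean (\<lambda>t. exp (\<i> * of_real ((ln (real m) - ln (real n)) * t))) 0"
      using has_mean_exp[of "ln (real m) - ln (real n)"] False monomial by simp
    have "has_mean (\<lambda>t. c * exp (\<i> * of_real ((real (v n) - real (v m)) * \<theta> + (ln (real m) - ln (real n)) * t))) 0" for \<theta>
      using has_mean_cmult[OF *, of "c * exp (\<i> * of_real ((real (v n) - real (v m)) * \<theta>))"]
      by (simp add: exp_add distrib_left mult.assoc)
    then show ?thesis by blast
  qed
next
  case (add f g)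
  then obtain m n where "\<And>\<theta>. has_mean (f \<theta>) m" "\<And>\<theta>. has_mean (g \<theta>) n"
    by blast
  then have "has_mean (\<lambda>t. f \<theta> t + g \<theta> t) (m + n)" for \<theta>
    by (intro has_mean_add twisted_trig_continuous[OF add.hyps(1)] twisted_trig_continuous[OF add.hyps(2)]) auto
  then show ?case by blast
qed

lemma continuous_on_norm_powr:
  fixes f :: "'a::topological_space \<Rightarrow> 'b::real_normed_vector"
  assumes "p > 0" "continuous_on S f"
  shows "continuous_on S (\<lambda>t. norm (f t) powr p)"
  by (rule continuous_on_powr') (use assms in \<open>auto intro!: continuous_intros\<close>)

lemma power2_powr_half:
  fixes x :: real
  assumes "x \<ge> 0"
  shows "(x\<^sup>2) powr (p/2) = x powr p"
proof (cases "x = 0")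
  case False
  then have "x\<^sup>2 = x powr 2"
    using assms by simp
  then show ?thesis
    by (simp only: powr_powr) simp
qed simp

text \<open>By Weierstrass approximation \<open>\<bar>f\<bar>\<^sup>p\<close> is a uniform limit of polynomials in
\<open>\<bar>f\<bar>\<^sup>2 = f * cnj f\<close>, which are again twisted trigonometric polynomials. This replaces the ergodic theorem
of Kronecker and Weyl for the flow on the polytorus.\<close>

lemma twisted_trig_mean_norm_powr:
  assumes v: "\<And>n m. n \<ge> 1 \<Longrightarrow> m \<ge> 1 \<Longrightarrow> v (n * m) = v n + v m"
    and f: "twisted_trig v f" and p: "p > 0"
    and B: "\<And>\<theta> t. norm (f \<theta> t) \<le> B"
  shows "\<exists>m. \<forall>\<theta>. has_mean (\<lambda>t. norm (f \<theta> t) powr p) m"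
proof -
  note cont = continuous_on_norm_powr[OF p twisted_trig_continuous[OF f]]
  have approx: "\<exists>w n. \<forall>\<theta>. continuous_on UNIV (w \<theta>) \<and> has_mean (w \<theta>) n \<and>
      (\<forall>t. norm (norm (f \<theta> t) powr p - w \<theta> t) \<le> e)" if "e > 0" for e
  proof -
    have "continuous_on {0..B\<^sup>2} (\<lambda>x::real. x powr (p/2))"
      by (rule continuous_on_powr') (use p in \<open>auto intro!: continuous_intros\<close>)
    then obtain g where g: "real_polynomial_function g" "\<And>x. x \<in> {0..B\<^sup>2} \<Longrightarrow> \<bar>x powr (p/2) - g x\<bar> < e"
      using Stone_Weierstrass_real_polynomial_function[of "{0..B\<^sup>2}"] \<open>e > 0\<close> by blast
    from g(1) obtain a n where gs: "g = (\<lambda>x. \<Sum>i\<le>n. a i * x ^ i)"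
      by (auto simp: real_polynomial_function_iff_sum)
    have "twisted_trig v (\<lambda>\<theta> t. \<Sum>i\<le>n. of_real (a i) * (f \<theta> t * cnj (f \<theta> t)) ^ i)"
      by (intro twisted_trig_sum twisted_trig_mult twisted_trig_power twisted_trig_cnj twisted_trig_const v f) auto
    also have "(\<lambda>\<theta> t. \<Sum>i\<le>n. of_real (a i) * (f \<theta> t * cnj (f \<theta> t)) ^ i) =
        (\<lambda>\<theta> t. of_real (g ((norm (f \<theta> t))\<^sup>2)))"
      by (simp add: gs complex_norm_square[symmetric])
    finally have tg: "twisted_trig v (\<lambda>\<theta> t. of_real (g ((norm (f \<theta> t))\<^sup>2)))" .
    obtain m where m: "\<And>\<theta>. has_mean (\<lambda>t. of_real (g ((norm (f \<theta> t))\<^sup>2)) :: complex) m"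
      using twisted_trig_has_mean[OF tg] by blast
    have c: "continuous_on UNIV (\<lambda>t. g ((norm (f \<theta> t))\<^sup>2))" for \<theta>
      using continuous_on_Re[OF twisted_trig_continuous[OF tg]] by simp
    have mm: "has_mean (\<lambda>t. g ((norm (f \<theta> t))\<^sup>2)) (Re m)" for \<theta>
      using has_mean_Re[OF twisted_trig_continuous[OF tg] m, of \<theta>] by simp
    have "norm (norm (f \<theta> t) powr p - g ((norm (f \<theta> t))\<^sup>2)) \<le> e" for \<theta> t
    proof -
      have "(norm (f \<theta> t))\<^sup>2 \<in> {0..B\<^sup>2}"
        using B by (auto intro: power_mono)
      from g(2)[OF this] show ?thesis
        by (simp add: power2_powr_half)
    qed
    then show ?thesis
      using c mm by (intro exI[of _ "\<lambda>\<theta> t. g ((norm (f \<theta> t))\<^sup>2)"] exI[of _ "Re m"]) blast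
  qed
  have "\<exists>m. has_mean (\<lambda>t. norm (f \<theta> t) powr p) m" for \<theta>
    by (rule has_mean_uniform_limit[OF cont]) (use approx in blast)
  then obtain m where m: "\<And>\<theta>. has_mean (\<lambda>t. norm (f \<theta> t) powr p) (m \<theta>)"
    by metis
  have "m \<theta> = m 0" for \<theta>
  proof -
    have "norm (m \<theta> - m 0) \<le> e" if "e > 0" for e
    proof -
      from that have "e/2 > 0" by simp
      from approx[OF this] obtain w n where w: "\<And>\<theta>. continuous_on UNIV (w \<theta>)" "\<And>\<theta>. has_mean (w \<theta>) n"
        "\<And>\<theta> t. norm (norm (f \<theta> t) powr p - w \<theta> t) \<le> e/2" by blast
      have "norm (m \<theta> - n) \<le> e/2" "norm (m 0 - n) \<le> e/2"
        using has_mean_dist[OF cont w(1) m w(2) w(3)] by blast+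
      then show ?thesis unfolding real_norm_def by linarith
    qed
    then have "norm (m \<theta> - m 0) \<le> 0"
      by (rule field_le_epsilon) simp
    then show ?thesis by simp
  qed
  note m_eq = this
  have "has_mean (\<lambda>t. norm (f \<theta> t) powr p) (m 0)" for \<theta>
    using m[of \<theta>] unfolding m_eq[of \<theta>] .
  then show ?thesis by blast
qed

text \<open>Distinct indices may carry the same frequency \<open>g i\<close>. This happens when a prime has been removed
from the integers \<open>g i\<close> by evaluating its variable.\<close>

definition freq_sum :: "'i set \<Rightarrow> ('i \<Rightarrow> complex) \<Rightarrow> ('i \<Rightarrow> nat) \<Rightarrow> real \<Rightarrow> complex" where
  "freq_sum I a g t = (\<Sum>i\<in>I. a i * exp (- (\<i> * of_real (ln (real (g i)) * t))))"

lemma freq_sum_continuous: "continuous_on UNIV (freq_sum I a g)"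
  unfolding freq_sum_def by (intro continuous_intros)

lemma freq_sum_twisted_mean:
  assumes v: "\<And>n m. n \<ge> 1 \<Longrightarrow> m \<ge> 1 \<Longrightarrow> v (n * m) = v n + v m"
    and g: "\<And>i. i \<in> I \<Longrightarrow> g i \<ge> 1" and p: "p > 0"
  shows "\<exists>m. \<forall>\<theta>. has_mean (\<lambda>t. norm (freq_sum I (\<lambda>i. a i * exp (\<i> * of_real (real (v (g i)) * \<theta>))) g t) powr p) m"
proof -
  have v1: "v 1 = 0"
    using v[of 1 1] by simp
  have "twisted_trig v (\<lambda>\<theta> t. \<Sum>i\<in>I. a i * exp (\<i> * of_real ((real (v (g i)) - real (v 1)) * \<theta> + (ln (real 1) - ln (real (g i))) * t)))"
    by (intro twisted_trig_sum twisted_trig.monomial) (use g in auto)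
  also have "(\<lambda>\<theta> t. \<Sum>i\<in>I. a i * exp (\<i> * of_real ((real (v (g i)) - real (v 1)) * \<theta> + (ln (real 1) - ln (real (g i))) * t))) =
     (\<lambda>\<theta>. freq_sum I (\<lambda>i. a i * exp (\<i> * of_real (real (v (g i)) * \<theta>))) g)"
    unfolding freq_sum_def v1 by (intro ext sum.cong) (auto simp: exp_add[symmetric] algebra_simps)
  finally have tt: "twisted_trig v (\<lambda>\<theta>. freq_sum I (\<lambda>i. a i * exp (\<i> * of_real (real (v (g i)) * \<theta>))) g)" .
  show ?thesis
  proof (rule twisted_trig_mean_norm_powr[OF v tt p])
    show "norm (freq_sum I (\<lambda>i. a i * exp (\<i> * of_real (real (v (g i)) * \<theta>))) g t) \<le> (\<Sum>i\<in>I. norm (a i))" for \<theta> t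
      unfolding freq_sum_def by (rule sum_norm_le) (simp add: norm_mult norm_exp_eq_Re)
  qed auto
qed

lemma freq_sum_has_mean:
  assumes "\<And>i. i \<in> I \<Longrightarrow> g i \<ge> 1" "p > 0"
  shows "\<exists>m. has_mean (\<lambda>t. norm (freq_sum I a g t) powr p) m"
  using freq_sum_twisted_mean[of "\<lambda>_. 0" I g p a] assms by simp

section \<open>The sharp point estimate on the disc\<close>

text \<open>A zero in the closed disc is reflected at the unit circle, which leaves the modulus on the circle
unchanged and increases it inside. In each case the new factor is a multiple of \<open>1 - b z\<close> with
\<open>\<bar>b\<bar> \<le> 1\<close>. On the closed disc this has nonnegative real part, so its principal \<open>p\<close>-th power is
continuous up to the boundary, even if the zero lies on the circle.\<close>

lemma linear_factor_majorant:
  fixes x :: complex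
  assumes p: "p > 0"
  obtains k where "continuous_on (cball 0 1) k" "k holomorphic_on ball 0 1"
    "\<And>z. norm z \<le> 1 \<Longrightarrow> norm (z - x) powr p \<le> norm (k z)"
    "\<And>z. norm z = 1 \<Longrightarrow> norm (z - x) powr p = norm (k z)"
proof -
  have Re_pos: "Re (1 - b * z) \<ge> 0" if "norm b \<le> 1" "norm z \<le> 1" for b z :: complex
    using complex_Re_le_cmod[of "b * z"] mult_mono[OF that] by (simp add: norm_mult)
  have Re_pos': "1 - b * z \<notin> \<real>\<^sub>\<le>\<^sub>0" if "norm b \<le> 1" "norm z < 1" for b z :: complex
  proof -
    have "norm (b * z) < 1"
      using that by (simp add: norm_mult) (metis mult_left_le_one_le norm_ge_zero order.strict_trans1)
    then have "Re (1 - b * z) > 0"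
      using complex_Re_le_cmod[of "b * z"] by simp
    then show ?thesis
      by (auto simp: complex_nonpos_Reals_iff)
  qed
  have cont: "continuous_on (cball 0 1) (\<lambda>z. (1 - b * z) powr of_real p)"
    and hol: "(\<lambda>z. (1 - b * z) powr of_real p) holomorphic_on ball 0 1" if "norm b \<le> 1" for b :: complex
  proof -
    show "continuous_on (cball 0 1) (\<lambda>z. (1 - b * z) powr of_real p)"
      by (rule continuous_on_powr_complex) (use Re_pos[OF that] p in \<open>auto intro!: continuous_intros\<close>)
    show "(\<lambda>z. (1 - b * z) powr of_real p) holomorphic_on ball 0 1"
      by (intro holomorphic_intros) (use Re_pos'[OF that] in auto)
  qed
  have nk: "norm ((1 - b * z) powr of_real p) = norm (1 - b * z) powr p" for b z :: complex
    by (subst norm_powr_real_powr') auto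
  show thesis
  proof (cases "norm x \<le> 1")
    case True
    have sq: "(norm (1 - cnj x * z))\<^sup>2 - (norm (z - x))\<^sup>2 = (1 - (norm x)\<^sup>2) * (1 - (norm z)\<^sup>2)" for z
      unfolding cmod_power2 by (simp add: power2_eq_square algebra_simps)
    show thesis
    proof (rule that[OF cont[of "cnj x"] hol[of "cnj x"]])
      fix z :: complex assume z: "norm z \<le> 1"
      have "(norm (z - x))\<^sup>2 \<le> (norm (1 - cnj x * z))\<^sup>2"
      proof -
        have "0 \<le> (1 - (norm x)\<^sup>2) * (1 - (norm z)\<^sup>2)"
          using True z by (intro mult_nonneg_nonneg) (auto simp: power_le_one)
        then show ?thesis
          using sq[of z] by linarith
      qed
      then show "norm (z - x) powr p \<le> norm ((1 - cnj x * z) powr of_real p)"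
        unfolding nk using p by (intro powr_mono2) (auto intro: power2_le_imp_le)
    next
      fix z :: complex assume z: "norm z = 1"
      have "norm (1 - cnj x * z) = norm (z - x)"
        by (rule power2_eq_imp_eq) (use sq[of z] z in auto)
      then show "norm (z - x) powr p = norm ((1 - cnj x * z) powr of_real p)"
        by (simp only: nk)
    qed (use True in auto)
  next
    case False
    then have x: "norm (1 / x) \<le> 1" "x \<noteq> 0"
      by (auto simp: norm_divide divide_le_eq_1)
    have eq: "norm (z - x) powr p = norm (of_real (norm x powr p) * (1 - 1/x * z) powr of_real p)" for z
    proof -
      have "z - x = - x * (1 - 1/x * z)"
        using x by (simp add: field_simps)
      then have "norm (z - x) = norm x * norm (1 - 1/x * z)"
        by (simp only: norm_mult norm_minus_cancel)
      then show ?thesis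
        using nk[of "1/x" z] by (simp add: norm_mult powr_mult)
    qed
    show thesis
      by (rule that[of "\<lambda>z. of_real (norm x powr p) * (1 - 1/x * z) powr of_real p"])
        (intro continuous_intros holomorphic_intros cont hol x | simp only: eq order_refl)+
  qed
qed

lemma poly_majorant:
  fixes F :: "complex poly"
  assumes p: "p > 0"
  obtains K where "continuous_on (cball 0 1) K" "K holomorphic_on ball 0 1"
    "\<And>z. norm z \<le> 1 \<Longrightarrow> norm (poly F z) powr p \<le> norm (K z)"
    "\<And>z. norm z = 1 \<Longrightarrow> norm (poly F z) powr p = norm (K z)"
proof -
  obtain r where r: "smult (lead_coeff F) (\<Prod>i<degree F. [:- r i, 1:]) = F"
    using complex_poly_decompose' .
  have "poly F z = lead_coeff F * (\<Prod>i<degree F. z - r i)" for z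
    by (subst r[symmetric]) (simp add: poly_prod del: r)
  then have F: "norm (poly F z) powr p = norm (lead_coeff F) powr p * (\<Prod>i<degree F. norm (z - r i) powr p)" for z
    by (simp add: norm_mult powr_mult prod_norm[symmetric] prod_powr_distrib prod_nonneg)
  have "\<exists>k. continuous_on (cball 0 1) k \<and> k holomorphic_on ball 0 1 \<and>
    (\<forall>z. norm z \<le> 1 \<longrightarrow> norm (z - r i) powr p \<le> norm (k z)) \<and>
    (\<forall>z. norm z = 1 \<longrightarrow> norm (z - r i) powr p = norm (k z))" for i
    by (rule linear_factor_majorant[OF p, of "r i"]) blast
  then obtain k where k: "\<And>i. continuous_on (cball 0 1) (k i)" "\<And>i. k i holomorphic_on ball 0 1"
    "\<And>i z. norm z \<le> 1 \<Longrightarrow> norm (z - r i) powr p \<le> norm (k i z)"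
    "\<And>i z. norm z = 1 \<Longrightarrow> norm (z - r i) powr p = norm (k i z)"
    by metis
  show thesis
  proof (rule that[of "\<lambda>z. of_real (norm (lead_coeff F) powr p) * (\<Prod>i<degree F. k i z)"])
    fix z :: complex assume "norm z \<le> 1"
    then show "norm (poly F z) powr p \<le> norm (of_real (norm (lead_coeff F) powr p) * (\<Prod>i<degree F. k i z))"
      unfolding F norm_mult prod_norm[symmetric]
      by (auto intro!: mult_left_mono prod_mono k)
  next
    fix z :: complex assume "norm z = 1"
    then show "norm (poly F z) powr p = norm (of_real (norm (lead_coeff F) powr p) * (\<Prod>i<degree F. k i z))"
      unfolding F norm_mult prod_norm[symmetric] using k(4) by simp
  qed (intro continuous_intros holomorphic_intros k)+
qed

text \<open>With \<open>K\<close> a zero-free majorant of the \<open>p\<close>-th power, this is Cauchy's formula at \<open>z\<^sub>0\<close> for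
\<open>K z * (1 - cnj z\<^sub>0 * z)\<close>: on the circle the additional factor has the modulus of the Cauchy
denominator. The Poisson kernel alone would give the factor \<open>(1 - \<bar>z\<^sub>0\<bar>) / (1 + \<bar>z\<^sub>0\<bar>)\<close>, and the
product of these over all \<open>z\<^sub>0 = q powr (- s)\<close>, \<open>q\<close> prime, is \<open>0\<close> for \<open>1/2 < s \<le> 1\<close>.\<close>

lemma disc_point_estimate:
  fixes F :: "complex poly"
  assumes p: "p > 0" and z0: "norm z0 < 1"
  shows "(1 - (norm z0)\<^sup>2) * norm (poly F z0) powr p \<le> 1 / (2 * pi) * integral {0..2*pi} (\<lambda>\<theta>. norm (poly F (cis \<theta>)) powr p)"
proof -
  obtain K where K: "continuous_on (cball 0 1) K" "K holomorphic_on ball 0 1"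
    "\<And>z. norm z \<le> 1 \<Longrightarrow> norm (poly F z) powr p \<le> norm (K z)"
    "\<And>z. norm z = 1 \<Longrightarrow> norm (poly F z) powr p = norm (K z)"
    using poly_majorant[OF p, of F] by metis
  define G where "G z = K z * (1 - cnj z0 * z)" for z
  have "((\<lambda>u. G u / (u - z0)) has_contour_integral (2 * of_real pi * \<i> * G z0)) (circlepath 0 1)"
    by (rule Cauchy_integral_circlepath)
      (use z0 in \<open>auto simp: G_def intro!: continuous_intros holomorphic_intros K\<close>)
  then have I: "((\<lambda>t. G (cis t) / (cis t - z0) * \<i> * cis t) has_integral (2 * of_real pi * \<i> * G z0)) {0..2*pi}"
    unfolding circlepath_def by (subst (asm) has_contour_integral_part_circlepath_iff) auto
  have contF: "continuous_on {0..2*pi} (\<lambda>\<theta>. norm (poly F (cis \<theta>)) powr p)"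
    by (rule continuous_on_norm_powr[OF p]) (intro continuous_intros)
  have "norm (integral {0..2*pi} (\<lambda>t. G (cis t) / (cis t - z0) * \<i> * cis t)) \<le>
      integral {0..2*pi} (\<lambda>\<theta>. norm (poly F (cis \<theta>)) powr p)"
  proof (rule integral_norm_bound_integral)
    show "(\<lambda>t. G (cis t) / (cis t - z0) * \<i> * cis t) integrable_on {0..2 * pi}"
      using I by blast
    show "(\<lambda>\<theta>. norm (poly F (cis \<theta>)) powr p) integrable_on {0..2 * pi}"
      by (rule integrable_continuous_real[OF contF])
    fix t :: real
    have "cis t \<noteq> z0" using z0 by auto
    have "norm (1 - cnj z0 * cis t) = norm (cis t * cnj (cis t - z0))"
      by (simp add: algebra_simps cis_cnj cis_mult)
    also have "\<dots> = norm (cis t - z0)"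
      by (simp only: norm_mult norm_cis complex_mod_cnj)
    finally have "norm (G (cis t) / (cis t - z0) * \<i> * cis t) = norm (K (cis t))"
      using \<open>cis t \<noteq> z0\<close> by (simp add: G_def norm_mult norm_divide)
    then show "norm (G (cis t) / (cis t - z0) * \<i> * cis t) \<le> norm (poly F (cis t)) powr p"
      using K(4)[of "cis t"] by simp
  qed
  moreover have "norm (integral {0..2*pi} (\<lambda>t. G (cis t) / (cis t - z0) * \<i> * cis t)) = 2 * pi * norm (G z0)"
    unfolding integral_unique[OF I] by (simp add: norm_mult)
  moreover have "norm (G z0) = norm (K z0) * (1 - (norm z0)\<^sup>2)"
  proof -
    have "1 - cnj z0 * z0 = of_real (1 - (norm z0)\<^sup>2)"
      by (simp only: of_real_diff complex_norm_square of_real_1 mult.commute)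
    then show ?thesis
      unfolding G_def norm_mult using z0 by (simp add: power_le_one del: of_real_diff)
  qed
  moreover have "(1 - (norm z0)\<^sup>2) * norm (poly F z0) powr p \<le> (1 - (norm z0)\<^sup>2) * norm (K z0)"
    using z0 by (intro mult_left_mono K) (auto simp: power_le_one)
  ultimately have "(1 - (norm z0)\<^sup>2) * norm (poly F z0) powr p \<le> norm (G z0)"
    "2 * pi * norm (G z0) \<le> integral {0..2*pi} (\<lambda>\<theta>. norm (poly F (cis \<theta>)) powr p)"
    by (simp_all only: mult.commute[of "norm (K z0)"])
  then have "2 * pi * ((1 - (norm z0)\<^sup>2) * norm (poly F z0) powr p) \<le>
      integral {0..2*pi} (\<lambda>\<theta>. norm (poly F (cis \<theta>)) powr p)"
    by (meson mult_left_mono order_trans pi_ge_zero mult_nonneg_nonneg zero_le_numeral)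
  then show ?thesis
    using pi_gt_zero by (simp add: field_simps)
qed

section \<open>Evaluating one prime at a time\<close>

lemma multiplicity_mult_nat:
  fixes q :: nat
  assumes "prime q" "n \<ge> 1" "m \<ge> 1"
  shows "multiplicity q (n * m) = multiplicity q n + multiplicity q m"
  using assms by (intro prime_elem_multiplicity_mult_distrib) auto

text \<open>The mean is the same for all rotations of the variable of \<open>q\<close>, hence equals its own average over
\<open>\<theta>\<close>. After exchanging this average with the mean over \<open>t\<close>, the disc estimate applies for
each fixed \<open>t\<close>.\<close>

lemma freq_sum_eval_prime:
  fixes q :: nat and s0 :: complex and a :: "'i \<Rightarrow> complex" and g :: "'i \<Rightarrow> nat"
  assumes q: "prime q" and s0: "Re s0 > 0" and I: "finite I" and g: "\<And>i. i \<in> I \<Longrightarrow> g i \<ge> 1" and p: "p > 0"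
  defines "k \<equiv> (\<lambda>i. multiplicity q (g i))"
  defines "a' \<equiv> (\<lambda>i. a i * exp (- (s0 * of_real (real (k i) * ln (real q)))))"
  defines "g' \<equiv> (\<lambda>i. g i div q ^ k i)"
  assumes m: "has_mean (\<lambda>t. norm (freq_sum I a g t) powr p) m"
    and m': "has_mean (\<lambda>t. norm (freq_sum I a' g' t) powr p) m'"
  shows "(1 - exp (- (2 * Re s0 * ln (real q)))) * m' \<le> m"
proof -
  have q1: "ln (real q) > 0"
    using prime_gt_1_nat[OF q] by simp
  define b where "b \<theta> i = a i * exp (\<i> * of_real (real (k i) * \<theta>))" for \<theta> i
  define Z where "Z = 1 - exp (- (2 * Re s0 * ln (real q)))"
  have Z: "Z \<ge> 0"
    unfolding Z_def using s0 q1 by simp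
  have "\<exists>m. \<forall>\<theta>. has_mean (\<lambda>t. norm (freq_sum I (b \<theta>) g t) powr p) m"
    unfolding b_def k_def
    by (rule freq_sum_twisted_mean[where v = "multiplicity q"]) (use multiplicity_mult_nat[OF q] g p in auto)
  then obtain m1 where m1: "\<And>\<theta>. has_mean (\<lambda>t. norm (freq_sum I (b \<theta>) g t) powr p) m1"
    by auto
  have "b 0 = a"
    by (simp add: b_def fun_eq_iff)
  then have "m1 = m"
    using has_mean_unique[OF m1[of 0]] m by simp
  with m1 have mean_b: "\<And>\<theta>. has_mean (\<lambda>t. norm (freq_sum I (b \<theta>) g t) powr p) m"
    by simp
  define h where "h \<theta> t = norm (freq_sum I (b \<theta>) g t) powr p" for \<theta> t
  define B where "B = (\<Sum>i\<in>I. norm (a i)) powr p"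
  have hB: "norm (h \<theta> t) \<le> B" for \<theta> t
  proof -
    have "norm (freq_sum I (b \<theta>) g t) \<le> (\<Sum>i\<in>I. norm (a i))"
      unfolding freq_sum_def b_def by (rule sum_norm_le) (simp add: norm_mult norm_exp_eq_Re)
    then show ?thesis
      unfolding h_def B_def using p by (auto intro: powr_mono2)
  qed
  have h2: "continuous_on X (\<lambda>(\<theta>, t). h \<theta> t)" for X
    unfolding h_def case_prod_beta freq_sum_def b_def
    by (intro continuous_on_norm_powr[OF p] continuous_intros)
  have h2': "continuous_on X (\<lambda>(t, \<theta>). h \<theta> t)" for X
    unfolding h_def case_prod_beta freq_sum_def b_def
    by (intro continuous_on_norm_powr[OF p] continuous_intros)
  have h1: "continuous_on X (h \<theta>)" for X \<theta>
    unfolding h_def freq_sum_def b_def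
    by (intro continuous_on_norm_powr[OF p] continuous_intros)
  \<comment> \<open>At fixed \<open>t\<close> the sum is a polynomial in \<open>z = cis \<theta>\<close>. Its evaluation at \<open>z0\<close> absorbs the factor \<open>q powr (it)\<close>, so that
the powers of \<open>q\<close> in the frequencies disappear.\<close>
  have disc: "Z * norm (freq_sum I a' g' t) powr p \<le> 1 / (2 * pi) * integral {0..2*pi} (\<lambda>\<theta>. h \<theta> t)" for t
  proof -
    define F where "F = (\<Sum>i\<in>I. monom (a i * exp (- (\<i> * of_real (ln (real (g i)) * t)))) (k i))"
    define z0 where "z0 = exp ((\<i> * of_real t - s0) * of_real (ln (real q)))"
    have nz0: "norm z0 = exp (- (Re s0 * ln (real q)))"
      by (simp add: z0_def norm_exp_eq_Re)
    then have "norm z0 < 1"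
      using s0 q1 by simp
    from disc_point_estimate[OF p this, of F]
    have D: "(1 - (norm z0)\<^sup>2) * norm (poly F z0) powr p \<le> 1 / (2 * pi) * integral {0..2*pi} (\<lambda>\<theta>. norm (poly F (cis \<theta>)) powr p)" .
    have e1: "1 - (norm z0)\<^sup>2 = Z"
      unfolding nz0 Z_def by (simp add: exp_double[symmetric] algebra_simps flip: exp_of_nat_mult)
    have e2: "poly F (cis \<theta>) = freq_sum I (b \<theta>) g t" for \<theta>
      unfolding F_def freq_sum_def b_def
      by (auto simp: poly_sum poly_monom cis_conv_exp exp_of_nat_mult[symmetric] mult_ac intro!: sum.cong)
    have e3: "poly F z0 = freq_sum I a' g' t"
      unfolding F_def freq_sum_def poly_sum poly_monom
    proof (intro sum.cong refl)
      fix i assume i: "i \<in> I"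
      have dvd: "q ^ k i dvd g i"
        unfolding k_def by (rule multiplicity_dvd)
      then have gi: "g i = q ^ k i * g' i"
        by (simp add: g'_def)
      then have g'0: "g' i \<noteq> 0"
        using g[OF i] by (metis mult_0_right not_one_le_zero)
      have "ln (real (g i)) = real (k i) * ln (real q) + ln (real (g' i))"
        unfolding gi using g'0 prime_gt_0_nat[OF q] by (simp add: ln_mult ln_realpow)
      then show "a i * exp (- (\<i> * of_real (ln (real (g i)) * t))) * z0 ^ k i = a' i * exp (- (\<i> * of_real (ln (real (g' i)) * t)))"
        unfolding a'_def z0_def
        by (simp add: exp_of_nat_mult[symmetric] exp_add[symmetric] mult.assoc) (simp add: algebra_simps minus_diff_commute)
    qed
    show ?thesis
      using D unfolding e1 e2 e3 h_def .
  qed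
  define T where "T n = real (Suc n)" for n
  have Tpos: "T n > 0" for n by (simp add: T_def)
  have Tlim: "filterlim T at_top sequentially"
    unfolding T_def by (rule filterlim_compose[OF filterlim_real_sequentially filterlim_Suc])
  have lim1: "(\<lambda>n. integral {0..2*pi} (\<lambda>\<theta>. avg (T n) (h \<theta>))) \<longlonglongrightarrow> integral {0..2*pi} (\<lambda>\<theta>. m)"
  proof (rule dominated_convergence(2)[where h = "\<lambda>_. B"])
    fix n
    have "continuous_on {0..2*pi} (\<lambda>\<theta>. integral (cbox (-T n) (T n)) (h \<theta>))"
      by (rule integral_continuous_on_param[OF h2])
    then show "(\<lambda>\<theta>. avg (T n) (h \<theta>)) integrable_on {0..2*pi}"
      unfolding avg_def by (intro integrable_continuous_real continuous_intros) simp
    show "norm (avg (T n) (h \<theta>)) \<le> B" for \<theta>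
      by (rule norm_avg_le[OF h1 hB Tpos])
    show "(\<lambda>n. avg (T n) (h \<theta>)) \<longlonglongrightarrow> m" for \<theta>
      using filterlim_compose[OF mean_b[of \<theta>, unfolded has_mean_def] Tlim] unfolding h_def .
  qed auto
  have lim2: "(\<lambda>n. Z * avg (T n) (\<lambda>t. norm (freq_sum I a' g' t) powr p)) \<longlonglongrightarrow> Z * m'"
    using filterlim_compose[OF m'[unfolded has_mean_def] Tlim] by (intro tendsto_intros)
  have le: "Z * avg (T n) (\<lambda>t. norm (freq_sum I a' g' t) powr p) \<le> 1 / (2*pi) * integral {0..2*pi} (\<lambda>\<theta>. avg (T n) (h \<theta>))" for n
  proof -
    have swap: "integral {0..2*pi} (\<lambda>\<theta>. integral {-T n..T n} (h \<theta>)) = integral {-T n..T n} (\<lambda>t. integral {0..2*pi} (\<lambda>\<theta>. h \<theta> t))"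
      using integral_swap_continuous[OF h2, of 0 "2*pi" "-T n" "T n"] by simp
    have c: "continuous_on UNIV (\<lambda>t. integral {0..2*pi} (\<lambda>\<theta>. h \<theta> t))"
      using integral_continuous_on_param[OF h2', of UNIV 0 "2*pi"] by simp
    have "Z * avg (T n) (\<lambda>t. norm (freq_sum I a' g' t) powr p) = avg (T n) (\<lambda>t. Z * norm (freq_sum I a' g' t) powr p)"
      by (simp add: avg_cmult)
    also have "\<dots> \<le> avg (T n) (\<lambda>t. 1 / (2*pi) * integral {0..2*pi} (\<lambda>\<theta>. h \<theta> t))"
      by (rule avg_mono[OF _ _ disc Tpos])
        (intro continuous_intros continuous_on_norm_powr[OF p] freq_sum_continuous c)+
    also have "\<dots> = 1 / (2*pi) * avg (T n) (\<lambda>t. integral {0..2*pi} (\<lambda>\<theta>. h \<theta> t))"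
      by (rule avg_cmult)
    also have "avg (T n) (\<lambda>t. integral {0..2*pi} (\<lambda>\<theta>. h \<theta> t)) = integral {0..2*pi} (\<lambda>\<theta>. avg (T n) (h \<theta>))"
      unfolding avg_def swap[symmetric] by simp
    finally show ?thesis .
  qed
  have "(\<lambda>n. 1 / (2*pi) * integral {0..2*pi} (\<lambda>\<theta>. avg (T n) (h \<theta>))) \<longlonglongrightarrow> 1 / (2*pi) * integral {0..2*pi} (\<lambda>\<theta>. m)"
    by (rule tendsto_mult_left[OF lim1])
  also have "1 / (2*pi) * integral {0..2*pi} (\<lambda>\<theta>. m) = m"
    by simp
  finally have "Z * m' \<le> m"
    using lim2 le by (intro LIMSEQ_le[OF lim2]) auto
  then show ?thesis
    by (simp add: Z_def)
qed

text \<open>Induction over the primes: evaluating the variable of \<open>q\<close> removes \<open>q\<close> from the frequencies and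
does not change the value at \<open>s\<^sub>0\<close>. When no prime is left, the sum is constant.\<close>

lemma freq_sum_point_estimate:
  fixes s0 :: complex
  assumes A: "finite A" "\<And>q. q \<in> A \<Longrightarrow> prime q" and s0: "Re s0 > 0" and p: "p > 0" and I: "finite I"
    and g: "\<And>i. i \<in> I \<Longrightarrow> g i \<ge> 1" "\<And>i. i \<in> I \<Longrightarrow> prime_factors (g i) \<subseteq> A"
    and m: "has_mean (\<lambda>t. norm (freq_sum I a g t) powr p) m"
  shows "(\<Prod>q\<in>A. 1 - exp (- (2 * Re s0 * ln (real q)))) *
    norm (\<Sum>i\<in>I. a i * npow (g i) s0) powr p \<le> m"
  using A g m
proof (induction A arbitrary: a g m rule: finite_induct)
  case empty
  have g1: "g i = 1" if "i \<in> I" for i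
    using empty.prems(2,3)[OF that] by (auto simp: prime_factorization_empty_iff)
  have "freq_sum I a g t = (\<Sum>i\<in>I. a i)" for t
    unfolding freq_sum_def by (rule sum.cong) (auto simp: g1)
  then have "m = norm (\<Sum>i\<in>I. a i) powr p"
    using has_mean_unique[OF empty.prems(4)] has_mean_const by auto
  then show ?case
    by (simp add: g1)
next
  case (insert q A)
  note q = insert.prems(1)[of q, simplified]
  define k where "k = (\<lambda>i. multiplicity q (g i))"
  define a' where "a' = (\<lambda>i. a i * exp (- (s0 * of_real (real (k i) * ln (real q)))))"
  define g' where "g' = (\<lambda>i. g i div q ^ k i)"
  have gi: "g i = q ^ k i * g' i" for i
    unfolding k_def g'_def by (simp add: multiplicity_dvd)
  have g'1: "g' i \<ge> 1" if "i \<in> I" for i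
    using insert.prems(2)[OF that] gi[of i] by (cases "g' i") auto
  have g'A: "prime_factors (g' i) \<subseteq> A" if "i \<in> I" for i
  proof
    fix r assume r: "r \<in> prime_factors (g' i)"
    then have "prime r" "r dvd g' i" by auto
    moreover from this have "r dvd g i" using gi by simp
    ultimately have "r \<in> insert q A"
      using insert.prems(2,3)[OF that] by (auto simp: prime_factors_dvd)
    moreover have "\<not> q dvd g' i"
      unfolding g'_def k_def using insert.prems(2)[OF that] q
      by (intro multiplicity_decompose) auto
    ultimately show "r \<in> A"
      using \<open>r dvd g' i\<close> by auto
  qed
  have "\<exists>m. has_mean (\<lambda>t. norm (freq_sum I a' g' t) powr p) m"
    by (rule freq_sum_has_mean) (use g'1 p in auto)
  then obtain m' where m': "has_mean (\<lambda>t. norm (freq_sum I a' g' t) powr p) m'" ..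
  have "(\<Prod>q\<in>A. 1 - exp (- (2 * Re s0 * ln (real q)))) *
    norm (\<Sum>i\<in>I. a' i * npow (g' i) s0) powr p \<le> m'"
    by (rule insert.IH[OF _ g'1 g'A m']) (use insert.prems(1) in auto)
  also have "(\<Sum>i\<in>I. a' i * npow (g' i) s0) = (\<Sum>i\<in>I. a i * npow (g i) s0)"
  proof (rule sum.cong[OF refl])
    fix i assume i: "i \<in> I"
    have "ln (real (g i)) = real (k i) * ln (real q) + ln (real (g' i))"
      unfolding gi[of i] using g'1[OF i] prime_gt_0_nat[OF q] by (simp add: ln_mult ln_realpow)
    then show "a' i * npow (g' i) s0 = a i * npow (g i) s0"
      unfolding a'_def by (simp add: exp_add[symmetric] algebra_simps)
  qed
  finally have 1: "(\<Prod>q\<in>A. 1 - exp (- (2 * Re s0 * ln (real q)))) *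
    norm (\<Sum>i\<in>I. a i * npow (g i) s0) powr p \<le> m'" .
  have 2: "(1 - exp (- (2 * Re s0 * ln (real q)))) * m' \<le> m"
    by (rule freq_sum_eval_prime[OF q s0 I insert.prems(2) p insert.prems(4)])
      (use m' in \<open>auto simp: a'_def g'_def k_def\<close>)
  have "0 \<le> 1 - exp (- (2 * Re s0 * ln (real q)))"
    using s0 prime_gt_1_nat[OF q] by simp
  from mult_left_mono[OF 1 this] 2 show ?case
    using insert.hyps by (simp add: mult.assoc)
qed

section \<open>Dirichlet polynomials and their norms\<close>

lemma of_nat_powr_exp:
  fixes s :: complex
  assumes "n \<ge> 1"
  shows "of_nat n powr (- s) = npow n s"
  using assms by (simp add: powr_def Ln_of_nat)

lemma dirichlet_polynomial_exp_form:
  assumes "dirichlet_polynomial P"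
  obtains a N where "\<And>s. P s = (\<Sum>n = 1..N. a n * npow n s)"
proof -
  from assms obtain a N where "P = (\<lambda>s. \<Sum>n = 1..N. a n * of_nat n powr (- s))"
    unfolding dirichlet_polynomial_def by blast
  then have "P s = (\<Sum>n = 1..N. a n * npow n s)" for s
    by (auto intro!: sum.cong simp: of_nat_powr_exp)
  then show thesis by (rule that)
qed

lemma dirichlet_polynomial_exp_formI:
  assumes "\<And>s. P s = (\<Sum>n = 1..N. a n * npow n s)"
  shows "dirichlet_polynomial P"
proof -
  have "P = (\<lambda>s. \<Sum>n = 1..N. a n * of_nat n powr (- s))"
    unfolding assms by (auto intro!: sum.cong simp: of_nat_powr_exp)
  then show ?thesis
    unfolding dirichlet_polynomial_def by blast
qed

lemma dirichlet_polynomial_freq_sum: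
  assumes "dirichlet_polynomial P"
  obtains a N where "\<And>s. P s = (\<Sum>n = 1..N. a n * npow n s)"
    "\<And>t. P (\<i> * of_real t) = freq_sum {1..N} a id t"
proof -
  obtain a N where Na: "\<And>s. P s = (\<Sum>n = 1..N. a n * npow n s)"
    by (rule dirichlet_polynomial_exp_form[OF assms]) (rule that)
  have "P (\<i> * of_real t) = freq_sum {1..N} a id t" for t
    unfolding Na freq_sum_def by (simp add: mult_ac)
  with Na show thesis using that by blast
qed

lemma dirichlet_polynomial_holomorphic: "dirichlet_polynomial P \<Longrightarrow> P holomorphic_on S"
proof (erule dirichlet_polynomial_exp_form)
  fix N a assume "\<And>s. P s = (\<Sum>n = 1..N. a n * npow n s)"
  then have "P = (\<lambda>s. \<Sum>n = 1..N. a n * npow n s)"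
    by blast
  then show "P holomorphic_on S"
    by (simp only:) (intro holomorphic_intros)
qed

lemma dirichlet_polynomial_bounded:
  assumes "dirichlet_polynomial P"
  obtains B where "B \<ge> 0" "\<And>s. Re s \<ge> 0 \<Longrightarrow> norm (P s) \<le> B"
proof -
  obtain a N where Na: "\<And>s. P s = (\<Sum>n = 1..N. a n * npow n s)"
    by (rule dirichlet_polynomial_exp_form[OF assms]) (rule that)
  show thesis
  proof (rule that[of "\<Sum>n=1..N. norm (a n)"])
    fix s :: complex assume s: "Re s \<ge> 0"
    show "norm (P s) \<le> (\<Sum>n=1..N. norm (a n))"
      unfolding Na
    proof (rule sum_norm_le)
      fix n assume n: "n \<in> {1..N}"
      have "norm (npow n s) \<le> 1"
        using s n by (auto simp: norm_exp_eq_Re)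
      then show "norm (a n * npow n s) \<le> norm (a n)"
        by (simp add: norm_mult mult_left_le)
    qed
  qed (auto intro: sum_nonneg)
qed

lemma dirichlet_polynomial_monomial:
  assumes "n \<ge> 1"
  shows "dirichlet_polynomial (\<lambda>s. c * npow n s)"
proof (rule dirichlet_polynomial_exp_formI)
  fix s :: complex
  have "(\<Sum>k = 1..n. (if k = n then c else 0) * npow k s) =
      (\<Sum>k = 1..n. if k = n then c * npow k s else 0)"
    by (intro sum.cong) auto
  also have "\<dots> = c * npow n s"
    using assms by simp
  finally show "c * npow n s = (\<Sum>k = 1..n. (if k = n then c else 0) * npow k s)"
    by simp
qed

lemma dirichlet_polynomial_add:
  assumes "dirichlet_polynomial P" "dirichlet_polynomial Q"
  shows "dirichlet_polynomial (\<lambda>s. P s + Q s)"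
proof -
  obtain a N where P: "\<And>s. P s = (\<Sum>n = 1..N. a n * npow n s)"
    by (rule dirichlet_polynomial_exp_form[OF assms(1)]) (rule that)
  obtain b M where Q: "\<And>s. Q s = (\<Sum>n = 1..M. b n * npow n s)"
    by (rule dirichlet_polynomial_exp_form[OF assms(2)]) (rule that)
  have extend: "(\<Sum>n = 1..K. c n * npow n s) =
      (\<Sum>n = 1..L. (if n \<le> K then c n else 0) * npow n s)" if "K \<le> L"
    for K L and c :: "nat \<Rightarrow> complex" and s
    using that by (intro sum.mono_neutral_cong_left) auto
  show ?thesis
  proof (rule dirichlet_polynomial_exp_formI)
    fix s
    show "P s + Q s = (\<Sum>n = 1..max N M. ((if n \<le> N then a n else 0) + (if n \<le> M then b n else 0)) * npow n s)"
      unfolding P Q by (subst (1 2) extend[of _ "max N M"]) (simp_all add: sum.distrib[symmetric] distrib_right)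
  qed
qed

lemma dirichlet_polynomial_const: "dirichlet_polynomial (\<lambda>s. c)"
  using dirichlet_polynomial_monomial[of 1 c] by simp

lemma dirichlet_polynomial_sum:
  "(\<And>i. i \<in> I \<Longrightarrow> dirichlet_polynomial (P i)) \<Longrightarrow> dirichlet_polynomial (\<lambda>s. \<Sum>i\<in>I. P i s)"
  by (induction I rule: infinite_finite_induct) (auto intro: dirichlet_polynomial_const dirichlet_polynomial_add)

lemma dirichlet_polynomial_mult:
  assumes "dirichlet_polynomial P" "dirichlet_polynomial Q"
  shows "dirichlet_polynomial (\<lambda>s. P s * Q s)"
proof -
  obtain a N where P: "\<And>s. P s = (\<Sum>n = 1..N. a n * npow n s)"
    by (rule dirichlet_polynomial_exp_form[OF assms(1)]) (rule that)
  obtain b M where Q: "\<And>s. Q s = (\<Sum>n = 1..M. b n * npow n s)"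
    by (rule dirichlet_polynomial_exp_form[OF assms(2)]) (rule that)
  have "dirichlet_polynomial (\<lambda>s. \<Sum>n=1..N. \<Sum>m=1..M. (a n * b m) * exp (- (s * of_real (ln (real (n * m))))))"
    by (intro dirichlet_polynomial_sum dirichlet_polynomial_monomial) auto
  also have "(\<lambda>s. \<Sum>n=1..N. \<Sum>m=1..M. (a n * b m) * exp (- (s * of_real (ln (real (n * m)))))) = (\<lambda>s. P s * Q s)"
    unfolding P Q sum_product
    by (intro ext sum.cong refl) (simp add: ln_mult exp_add[symmetric] algebra_simps)
  finally show ?thesis .
qed

lemma dirichlet_polynomial_cmult: "dirichlet_polynomial P \<Longrightarrow> dirichlet_polynomial (\<lambda>s. c * P s)"
  by (intro dirichlet_polynomial_mult dirichlet_polynomial_const)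

lemma dirichlet_polynomial_diff:
  assumes "dirichlet_polynomial P" "dirichlet_polynomial Q"
  shows "dirichlet_polynomial (\<lambda>s. P s - Q s)"
  using dirichlet_polynomial_add[OF assms(1) dirichlet_polynomial_cmult[OF assms(2), of "-1"]] by simp

lemma dirichlet_polynomial_power: "dirichlet_polynomial P \<Longrightarrow> dirichlet_polynomial (\<lambda>s. P s ^ k)"
  by (induction k) (auto intro: dirichlet_polynomial_const dirichlet_polynomial_mult)

lemma dirichlet_polynomial_shift:
  assumes "dirichlet_polynomial P"
  shows "dirichlet_polynomial (\<lambda>s. P (s + w))"
proof -
  obtain a N where P: "\<And>s. P s = (\<Sum>n = 1..N. a n * npow n s)"
    by (rule dirichlet_polynomial_exp_form[OF assms]) (rule that)
  show ?thesis
    by (rule dirichlet_polynomial_exp_formI[where a = "\<lambda>n. a n * npow n w"])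
      (simp add: P algebra_simps flip: exp_add)
qed

lemma continuous_on_vertical:
  fixes f :: "complex \<Rightarrow> complex"
  assumes "continuous_on S f" "\<And>t. w + \<i> * of_real t \<in> S"
  shows "continuous_on UNIV (\<lambda>t. f (w + \<i> * of_real t))"
  by (rule continuous_on_compose2[OF assms(1)]) (use assms(2) in \<open>auto intro!: continuous_intros\<close>)

lemma dirichlet_polynomial_continuous:
  "dirichlet_polynomial P \<Longrightarrow> continuous_on UNIV (\<lambda>t. P (\<i> * of_real t))"
  using continuous_on_vertical[of UNIV P 0] by (simp add: dirichlet_polynomial_holomorphic holomorphic_on_imp_continuous_on)

text \<open>The limit in the definition of the norm exists, so the norm is the \<open>p\<close>-th root of a mean.\<close>

lemma dirichlet_polynomial_has_mean:
  assumes P: "dirichlet_polynomial P" and p: "p > 0"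
  shows "has_mean (\<lambda>t. norm (P (\<i> * of_real t)) powr p) (polynomial_norm p P powr p)"
proof -
  obtain a N where Na: "\<And>t. P (\<i> * of_real t) = freq_sum {1..N} a id t"
    using dirichlet_polynomial_freq_sum[OF P] by metis
  obtain m where m: "has_mean (\<lambda>t. norm (P (\<i> * of_real t)) powr p) m"
    unfolding Na using freq_sum_has_mean[of "{1..N}" id p a] p by auto
  have "m \<ge> 0"
    by (rule mean_le_nonneg[OF has_mean_imp_mean_le[OF m order_refl]])
      (auto intro!: continuous_on_norm_powr p dirichlet_polynomial_continuous P)
  moreover have "Lim at_top (\<lambda>T. 1 / (2 * T) * integral {- T..T} (\<lambda>t. norm (P (\<i> * complex_of_real t)) powr p)) = m"
    using m unfolding has_mean_def avg_def by (intro tendsto_Lim) auto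
  ultimately have "polynomial_norm p P powr p = m"
    unfolding polynomial_norm_def using p by (simp add: powr_powr)
  with m show ?thesis by simp
qed

section \<open>The point estimate for Dirichlet polynomials\<close>

text \<open>Multiplying the series by \<open>1 - q powr (- x)\<close> deletes the terms divisible by \<open>q\<close>.\<close>

lemma finite_prime_sieve:
  assumes A: "finite A" "\<And>q. q \<in> A \<Longrightarrow> prime (q::nat)" and sum: "(\<lambda>n::nat. real n powr - x) summable_on {1..}"
  shows "(\<Prod>q\<in>A. 1 - real q powr - x) * infsum (\<lambda>n::nat. real n powr - x) {1..} =
     infsum (\<lambda>n::nat. real n powr - x) {n. n \<ge> 1 \<and> (\<forall>q\<in>A. \<not> q dvd n)}"
  using A
proof (induction A rule: finite_induct)
  case empty
  have "{n::nat. n \<ge> 1 \<and> (\<forall>q\<in>{}. \<not> q dvd n)} = {1..}" by auto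
  then show ?case by simp
next
  case (insert q A)
  define S where "S A = {n::nat. n \<ge> 1 \<and> (\<forall>q\<in>A. \<not> q dvd n)}" for A
  have q: "prime q" using insert.prems by simp
  note smb = summable_on_subset_banach[OF sum]
  have split: "S A = S (insert q A) \<union> (\<lambda>m. q * m) ` S A"
  proof (intro equalityI subsetI)
    fix n assume n: "n \<in> S A"
    show "n \<in> S (insert q A) \<union> (\<lambda>m. q * m) ` S A"
    proof (cases "q dvd n")
      case True
      then obtain m where "n = q * m" by blast
      with n have "m \<in> S A" unfolding S_def by auto
      with \<open>n = q * m\<close> show ?thesis by blast
    qed (use n in \<open>auto simp: S_def\<close>)
  next
    fix n assume "n \<in> S (insert q A) \<union> (\<lambda>m. q * m) ` S A"
    moreover have "\<not> r dvd q" if "r \<in> A" for r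
      using that insert.prems insert.hyps q by (metis insertI2 primes_dvd_imp_eq)
    ultimately show "n \<in> S A"
      using insert.prems prime_gt_0_nat[OF q] by (auto simp: S_def prime_dvd_mult_iff)
  qed
  have "infsum (\<lambda>n::nat. real n powr - x) (S A) = infsum (\<lambda>n::nat. real n powr - x) (S (insert q A)) +
      infsum (\<lambda>n::nat. real n powr - x) ((\<lambda>m. q * m) ` S A)"
    by (subst split, rule infsum_Un_disjoint)
      (use prime_gt_0_nat[OF q] in \<open>auto intro!: smb simp: S_def\<close>)
  also have "infsum (\<lambda>n::nat. real n powr - x) ((\<lambda>m. q * m) ` S A) = infsum (\<lambda>n::nat. real q powr - x * real n powr - x) (S A)"
    using prime_gt_0_nat[OF q] by (subst infsum_reindex) (auto simp: inj_on_def o_def powr_mult)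
  also have "\<dots> = real q powr - x * infsum (\<lambda>n::nat. real n powr - x) (S A)"
    by (rule infsum_cmult_right')
  finally show ?case
    using insert unfolding S_def[symmetric] by (simp add: algebra_simps)
qed

text \<open>Comparison with the integral, in the form of a telescoping sum.\<close>

lemma finite_sum_powr_le:
  assumes x: "x > 1"
  shows "(\<Sum>n=1..N. real n powr - x) \<le> 1 + 1 / (x - 1)"
proof -
  have "(\<Sum>n=1..Suc N. real n powr - x) \<le> 1 + (1 - real (Suc N) powr (1 - x)) / (x - 1)" for N
  proof (induction N)
    case 0
    then show ?case by simp
  next
    case (Suc N)
    have "\<exists>z>real (Suc N). z < real (Suc (Suc N)) \<and>
       real (Suc (Suc N)) powr (1 - x) - real (Suc N) powr (1 - x) = (real (Suc (Suc N)) - real (Suc N)) * ((1 - x) * z powr (1 - x - 1))"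
      by (rule MVT2) (auto intro!: derivative_eq_intros)
    then obtain z where z: "z > real (Suc N)" "z < real (Suc (Suc N))"
       "real (Suc (Suc N)) powr (1 - x) - real (Suc N) powr (1 - x) = (1 - x) * z powr - x"
      by auto
    have "real (Suc (Suc N)) powr - x \<le> z powr - x"
      using z x by (intro powr_mono2') auto
    also have "z powr - x = (real (Suc N) powr (1 - x) - real (Suc (Suc N)) powr (1 - x)) / (x - 1)"
      using z(3) x by (simp add: field_simps)
    finally have "real (Suc (Suc N)) powr - x \<le> (real (Suc N) powr (1 - x) - real (Suc (Suc N)) powr (1 - x)) / (x - 1)" .
    with Suc show ?case
      by (simp add: diff_divide_distrib)
  qed
  moreover have "(1 - real (Suc N) powr (1 - x)) / (x - 1) \<le> 1 / (x - 1)" for N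
    using x by (intro divide_right_mono) auto
  ultimately have "(\<Sum>n=1..Suc N. real n powr - x) \<le> 1 + 1 / (x - 1)" for N
    by (meson add_left_mono order_trans)
  from this[of N] show ?thesis
    by (simp add: sum.atLeast_Suc_atMost) (smt (verit) powr_ge_zero)
qed

text \<open>The sieved series still contains the term \<open>n = 1\<close>.\<close>

lemma prime_product_lower_bound:
  assumes A: "finite A" "\<And>q. q \<in> A \<Longrightarrow> prime (q::nat)" and x: "x > 1"
  shows "(\<Prod>q\<in>A. 1 - real q powr - x) * (1 + 1 / (x - 1)) \<ge> 1"
proof -
  let ?f = "\<lambda>n::nat. real n powr - x"
  have fin: "sum ?f F \<le> 1 + 1 / (x - 1)" if "finite F" "F \<subseteq> {1..}" for F
  proof -
    have "sum ?f F \<le> sum ?f {1..Max (insert 0 F)}"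
      using that by (intro sum_mono2) auto
    then show ?thesis
      using finite_sum_powr_le[OF x, of "Max (insert 0 F)"] by linarith
  qed
  have sum: "?f summable_on {1..}"
  proof (rule nonneg_bdd_above_summable_on)
    show "bdd_above (sum ?f ` {F. F \<subseteq> {1..} \<and> finite F})"
      by (rule bdd_aboveI[of _ "1 + 1 / (x - 1)"]) (use fin in auto)
  qed auto
  have le: "infsum ?f {1..} \<le> 1 + 1 / (x - 1)"
    by (rule infsum_le_finite_sums[OF sum fin])
  have "1 = infsum ?f {1}" by simp
  also have "\<dots> \<le> infsum ?f {n. n \<ge> 1 \<and> (\<forall>q\<in>A. \<not> q dvd n)}"
  proof (rule infsum_mono_neutral)
    show "?f summable_on {n. n \<ge> 1 \<and> (\<forall>q\<in>A. \<not> q dvd n)}"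
      by (rule summable_on_subset_banach[OF sum]) auto
    have "1 \<notin> A"
      using A(2) not_prime_1 by blast
    then show "\<And>n. n \<in> {1} - {n. n \<ge> 1 \<and> (\<forall>q\<in>A. \<not> q dvd n)} \<Longrightarrow> ?f n \<le> 0"
      by auto
  qed auto
  also have "\<dots> = (\<Prod>q\<in>A. 1 - ?f q) * infsum ?f {1..}"
    by (rule finite_prime_sieve[OF A sum, symmetric])
  also have "\<dots> \<le> (\<Prod>q\<in>A. 1 - ?f q) * (1 + 1 / (x - 1))"
  proof (rule mult_left_mono[OF le], rule prod_nonneg)
    fix q assume "q \<in> A"
    then have "real q > 1" using A(2) prime_gt_1_nat by force
    then have "real q powr - x \<le> real q powr 0"
      using x by (intro powr_mono) auto
    then show "0 \<le> 1 - real q powr - x"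
      using \<open>real q > 1\<close> by simp
  qed
  finally show ?thesis .
qed

theorem dirichlet_polynomial_point_estimate:
  assumes P: "dirichlet_polynomial P" and p: "p > 0" and s: "Re s > 1/2"
  shows "norm (P s) powr p \<le> (1 + 1 / (2 * Re s - 1)) * polynomial_norm p P powr p"
proof -
  obtain a N where Na: "\<And>s. P s = (\<Sum>n = 1..N. a n * npow n s)"
    "\<And>t. P (\<i> * of_real t) = freq_sum {1..N} a id t"
    by (rule dirichlet_polynomial_freq_sum[OF P]) (rule that)
  define A where "A = {q\<in>{1..N}. prime q}"
  define Z where "Z = (\<Prod>q\<in>A. 1 - exp (- (2 * Re s * ln (real q))))"
  have "Z * norm (\<Sum>n\<in>{1..N}. a n * npow (id n) s) powr p \<le> polynomial_norm p P powr p"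
    unfolding Z_def
  proof (rule freq_sum_point_estimate)
    show "has_mean (\<lambda>t. norm (freq_sum {1..N} a id t) powr p) (polynomial_norm p P powr p)"
      using dirichlet_polynomial_has_mean[OF P p] by (simp add: Na(2))
    show "prime_factors (id n) \<subseteq> A" if "n \<in> {1..N}" for n
      using that by (auto simp: A_def prime_factors_dvd dest: dvd_imp_le prime_ge_1_nat)
  qed (use p s in \<open>auto simp: A_def\<close>)
  then have 1: "Z * norm (P s) powr p \<le> polynomial_norm p P powr p"
    by (simp add: Na(1))
  have Z_eq: "Z = (\<Prod>q\<in>A. 1 - real q powr - (2 * Re s))"
    unfolding Z_def
  proof (intro prod.cong refl)
    fix q assume "q \<in> A"
    then have "real q > 0"
      by (auto simp: A_def)
    then show "1 - exp (- (2 * Re s * ln (real q))) = 1 - real q powr - (2 * Re s)"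
      by (simp add: powr_def)
  qed
  have 2: "Z * (1 + 1 / (2 * Re s - 1)) \<ge> 1"
    unfolding Z_eq by (rule prime_product_lower_bound) (use s in \<open>auto simp: A_def\<close>)
  have "norm (P s) powr p \<le> (Z * (1 + 1 / (2 * Re s - 1))) * norm (P s) powr p"
    using mult_right_mono[OF 2, of "norm (P s) powr p"] by simp
  also have "\<dots> = (1 + 1 / (2 * Re s - 1)) * (Z * norm (P s) powr p)"
    by (simp add: mult_ac)
  also have "\<dots> \<le> (1 + 1 / (2 * Re s - 1)) * polynomial_norm p P powr p"
    using 1 s by (intro mult_left_mono) auto
  finally show ?thesis .
qed

section \<open>Cauchy estimates on half-planes\<close>

lemma open_right_half_plane: "open (right_half_plane \<theta>)"
  unfolding right_half_plane_def by (rule open_halfspace_Re_gt)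

lemma convex_right_half_plane: "convex (right_half_plane \<theta>)"
  unfolding right_half_plane_def by (rule convex_halfspace_Re_gt)

lemma cball_subset_right_half_plane:
  assumes "Re z \<ge> \<theta> + e" "r < e"
  shows "cball z r \<subseteq> right_half_plane \<theta>"
proof
  fix w assume "w \<in> cball z r"
  then have "norm (z - w) \<le> r" by (simp add: dist_norm)
  then have "Re z - Re w \<le> r"
    using complex_Re_le_cmod[of "z - w"] by simp
  then show "w \<in> right_half_plane \<theta>"
    using assms by (simp add: right_half_plane_def)
qed

lemma half_plane_deriv_bound:
  assumes F: "F holomorphic_on right_half_plane \<theta>" and M: "\<And>s. s \<in> right_half_plane \<theta> \<Longrightarrow> norm (F s) \<le> M"
    and e: "e > 0" and z: "Re z \<ge> \<theta> + e"
  shows "norm ((deriv ^^ n) F z) \<le> fact n * M / (e/2) ^ n"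
proof (rule Cauchy_inequality)
  have sub: "cball z (e/2) \<subseteq> right_half_plane \<theta>"
    by (rule cball_subset_right_half_plane[OF z]) (use e in simp)
  show "F holomorphic_on ball z (e/2)"
    by (rule holomorphic_on_subset[OF F]) (use sub ball_subset_cball in blast)
  show "continuous_on (cball z (e/2)) F"
    by (rule continuous_on_subset[OF holomorphic_on_imp_continuous_on[OF F] sub])
  show "norm (F x) \<le> M" if "norm (z - x) = e/2" for x
    using that sub by (intro M) (auto simp: subset_iff dist_norm)
qed (use e in simp)

lemma half_plane_lipschitz:
  assumes F: "F holomorphic_on right_half_plane \<theta>" and M: "\<And>s. s \<in> right_half_plane \<theta> \<Longrightarrow> norm (F s) \<le> M"
    and e: "e > 0" and x: "Re x \<ge> \<theta> + e" and y: "Re y \<ge> \<theta> + e"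
  shows "norm (F x - F y) \<le> 2 * M / e * norm (x - y)"
proof (rule field_differentiable_bound[where S = "{z. Re z \<ge> \<theta> + e}" and f' = "deriv F"])
  show "convex {z. \<theta> + e \<le> Re z}"
    by (rule convex_halfspace_Re_ge)
  fix z assume z: "z \<in> {z. Re z \<ge> \<theta> + e}"
  then have "z \<in> right_half_plane \<theta>"
    using e by (auto simp: right_half_plane_def)
  then show "(F has_field_derivative deriv F z) (at z within {z. \<theta> + e \<le> Re z})"
    by (rule holomorphic_derivI[OF F open_right_half_plane])
  have "norm ((deriv ^^ 1) F z) \<le> fact 1 * M / (e/2) ^ 1"
    by (rule half_plane_deriv_bound[OF F M e]) (use z in simp_all)
  then show "norm (deriv F z) \<le> 2 * M / e"
    by (simp add: mult.commute)
qed (use x y in auto)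

text \<open>The error term is quadratic and uniform on a smaller half-plane, so that it survives averaging and
shows that averages of \<open>F\<close> along vertical lines are differentiable.\<close>

lemma half_plane_taylor:
  assumes F: "F holomorphic_on right_half_plane \<theta>" and M: "\<And>s. s \<in> right_half_plane \<theta> \<Longrightarrow> norm (F s) \<le> M"
    and e: "e > 0" and x: "Re x \<ge> \<theta> + e" and y: "Re y \<ge> \<theta> + e"
  shows "norm (F y - F x - deriv F x * (y - x)) \<le> (8 * M / e\<^sup>2) * (norm (y - x))\<^sup>2"
proof -
  have "norm ((deriv ^^ 0) F y - (\<Sum>i\<le>1. (deriv ^^ i) F x * (y - x) ^ i / fact i)) \<le> (8 * M / e\<^sup>2) * norm (y - x) ^ Suc 1 / fact 1"
  proof (rule complex_Taylor[where S = "{z. Re z \<ge> \<theta> + e}"])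
    show "convex {z. \<theta> + e \<le> Re z}"
      by (rule convex_halfspace_Re_ge)
    fix z assume z: "z \<in> {z. Re z \<ge> \<theta> + e}"
    show "norm ((deriv ^^ Suc 1) F z) \<le> 8 * M / e\<^sup>2"
    proof -
      have "norm ((deriv ^^ Suc 1) F z) \<le> fact (Suc 1) * M / (e/2) ^ Suc 1"
        by (rule half_plane_deriv_bound[OF F M e]) (use z in simp_all)
      also have "\<dots> = 8 * M / e\<^sup>2"
        using e by (simp add: power2_eq_square)
      finally show ?thesis .
    qed
    fix i :: nat
    have "z \<in> right_half_plane \<theta>"
      using z e by (auto simp: right_half_plane_def)
    then show "((deriv ^^ i) F has_field_derivative (deriv ^^ Suc i) F z) (at z within {z. \<theta> + e \<le> Re z})"
      unfolding funpow.simps o_apply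
      by (rule holomorphic_derivI[OF holomorphic_higher_deriv[OF F open_right_half_plane] open_right_half_plane])
  qed (use x y in auto)
  then show ?thesis
    by (simp add: diff_diff_add power2_eq_square)
qed

section \<open>Gaussian smoothing along vertical lines\<close>

abbreviation gaussian :: "real measure" where "gaussian \<equiv> std_normal_distribution"

interpretation gaussian: real_distribution gaussian
  by (rule real_dist_normal_dist)

text \<open>The convolution with a Gaussian density of standard deviation \<open>1/R\<close> along vertical lines.\<close>

definition gauss_smooth :: "real \<Rightarrow> (complex \<Rightarrow> complex) \<Rightarrow> complex \<Rightarrow> complex" where
  "gauss_smooth R F s = (LINT x|gaussian. F (s + \<i> * of_real (x / R)))"

lemma gaussian_integrable:
  fixes G :: "real \<Rightarrow> complex"
  assumes "continuous_on UNIV G" "\<And>x. norm (G x) \<le> B"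
  shows "integrable gaussian G"
  by (rule gaussian.integrable_const_bound[where B = B])
    (use assms in \<open>auto intro!: borel_measurable_continuous_onI\<close>)

lemma gaussian_norm_integral_le:
  fixes G :: "real \<Rightarrow> complex"
  assumes "continuous_on UNIV G" "\<And>x. norm (G x) \<le> B"
  shows "norm (LINT x|gaussian. G x) \<le> B"
proof -
  have "norm (LINT x|gaussian. G x) \<le> (LINT x|gaussian. norm (G x))"
    by (rule integral_norm_bound)
  also have "\<dots> \<le> (LINT x|gaussian. B)"
    using gaussian_integrable[OF assms] assms(2) by (intro integral_mono) auto
  also have "\<dots> = B"
    using gaussian.prob_space by simp
  finally show ?thesis .
qed

lemma vertical_shift_continuous:
  fixes F :: "complex \<Rightarrow> complex"
  assumes "F holomorphic_on right_half_plane \<theta>" "Re s > \<theta>"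
  shows "continuous_on UNIV (\<lambda>x. F (s + \<i> * of_real (x / R)))"
  unfolding divide_inverse
  by (rule continuous_on_compose2[OF holomorphic_on_imp_continuous_on[OF assms(1)]])
    (use assms(2) in \<open>auto intro!: continuous_intros simp: right_half_plane_def\<close>)

lemma gauss_smooth_integrable:
  assumes "F holomorphic_on right_half_plane \<theta>" "\<And>s. s \<in> right_half_plane \<theta> \<Longrightarrow> norm (F s) \<le> M" "Re s > \<theta>"
  shows "integrable gaussian (\<lambda>x. F (s + \<i> * of_real (x / R)))"
  by (rule gaussian_integrable[OF vertical_shift_continuous[OF assms(1,3)]])
    (rule assms(2), use assms(3) in \<open>auto simp: right_half_plane_def\<close>)

lemma gauss_smooth_holomorphic:
  assumes F: "F holomorphic_on right_half_plane \<theta>" and M: "\<And>s. s \<in> right_half_plane \<theta> \<Longrightarrow> norm (F s) \<le> M"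
  shows "gauss_smooth R F holomorphic_on right_half_plane \<theta>"
proof -
  have "\<exists>D. (gauss_smooth R F has_field_derivative D) (at s)" if s: "s \<in> right_half_plane \<theta>" for s
  proof -
    define e where "e = (Re s - \<theta>) / 2"
    have e: "e > 0" and Re_s: "Re s = \<theta> + 2 * e"
        using s by (auto simp: e_def right_half_plane_def field_simps)
    define D where "D = (LINT x|gaussian. deriv F (s + \<i> * of_real (x / R)))"
    define C where "C = 8 * M / e\<^sup>2"
    have F': "deriv F holomorphic_on right_half_plane \<theta>"
      by (rule holomorphic_deriv[OF F open_right_half_plane])
    have intD: "integrable gaussian (\<lambda>x. deriv F (s + \<i> * of_real (x / R)))"
    proof (rule gaussian_integrable[OF vertical_shift_continuous[OF F']])
      show "norm (deriv F (s + \<i> * of_real (x / R))) \<le> M / (e/2)" for x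
      proof -
        have "norm ((deriv ^^ 1) F (s + \<i> * of_real (x / R))) \<le> fact 1 * M / (e/2) ^ 1"
          by (rule half_plane_deriv_bound[OF F M e]) (use Re_s e in simp_all)
        then show ?thesis by simp
      qed
    qed (use Re_s e in simp)
    have bound: "norm (gauss_smooth R F y - gauss_smooth R F s - D * (y - s)) \<le> C * (norm (y - s))\<^sup>2"
      if y: "Re y \<ge> \<theta> + e" for y
    proof -
      let ?G = "\<lambda>x. F (y + \<i> * of_real (x / R)) - F (s + \<i> * of_real (x / R)) - deriv F (s + \<i> * of_real (x / R)) * (y - s)"
      have iy: "integrable gaussian (\<lambda>x. F (y + \<i> * of_real (x / R)))"
        by (rule gauss_smooth_integrable[OF F M]) (use y Re_s e in auto)
      have isx: "integrable gaussian (\<lambda>x. F (s + \<i> * of_real (x / R)))"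
        by (rule gauss_smooth_integrable[OF F M]) (use Re_s e in auto)
      have "(LINT x|gaussian. ?G x) = gauss_smooth R F y - gauss_smooth R F s - D * (y - s)"
        using iy isx intD by (simp add: gauss_smooth_def D_def del: of_real_divide)
      moreover have "norm (LINT x|gaussian. ?G x) \<le> C * (norm (y - s))\<^sup>2"
      proof (rule gaussian_norm_integral_le)
        show "continuous_on UNIV ?G"
          using y Re_s e by (intro continuous_intros vertical_shift_continuous[OF F] vertical_shift_continuous[OF F']) auto
        show "norm (?G x) \<le> C * (norm (y - s))\<^sup>2" for x
          using half_plane_taylor[OF F M e, of "s + \<i> * of_real (x / R)" "y + \<i> * of_real (x / R)"] y Re_s e
          by (simp add: C_def)
      qed
      ultimately show ?thesis by simp
    qed
    have "((\<lambda>y. (gauss_smooth R F y - gauss_smooth R F s) / (y - s)) \<longlongrightarrow> D) (at s)"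
    proof (rule LIM_zero_cancel, rule Lim_null_comparison)
      have "eventually (\<lambda>y. Re y > \<theta> + e) (at s)"
        by (rule order_tendstoD) (use Re_s e in \<open>auto intro!: tendsto_intros\<close>)
      moreover have "eventually (\<lambda>y. y \<noteq> s) (at s)"
        by (simp add: eventually_at_filter)
      ultimately show "eventually (\<lambda>y. norm ((gauss_smooth R F y - gauss_smooth R F s) / (y - s) - D) \<le> C * norm (y - s)) (at s)"
      proof eventually_elim
        case (elim y)
        then have "(gauss_smooth R F y - gauss_smooth R F s) / (y - s) - D = (gauss_smooth R F y - gauss_smooth R F s - D * (y - s)) / (y - s)"
          by (simp add: field_simps)
        also have "norm \<dots> \<le> C * (norm (y - s))\<^sup>2 / norm (y - s)"
          unfolding norm_divide using elim by (intro divide_right_mono bound) auto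
        also have "\<dots> = C * norm (y - s)"
          using elim by (simp add: power2_eq_square)
        finally show ?case .
      qed
      show "((\<lambda>y. C * norm (y - s)) \<longlongrightarrow> 0) (at s)"
        by (auto intro!: tendsto_eq_intros)
    qed
    then show ?thesis
      by (auto simp: has_field_derivative_iff)
  qed
  then show ?thesis
    by (auto simp: holomorphic_on_open[OF open_right_half_plane])
qed

lemma gauss_smooth_close:
  assumes F: "F holomorphic_on right_half_plane \<theta>" and M: "\<And>s. s \<in> right_half_plane \<theta> \<Longrightarrow> norm (F s) \<le> M"
    and e: "e > 0" and s: "Re s \<ge> \<theta> + e" and R: "R > 0"
  shows "norm (gauss_smooth R F s - F s) \<le> 2 * M / e * sqrt (2 / pi) / R"
proof -
  have s': "Re s > \<theta>" using s e by simp
  have m: "integrable gaussian (\<lambda>x. \<bar>x\<bar>)" "(LINT x|gaussian. \<bar>x\<bar>) = sqrt (2 / pi)"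
    using integrable_std_normal_moment_abs[of 1] integral_std_normal_moment_abs_odd[of 0]
    by (auto simp: integrable_density integral_density)
  have "gauss_smooth R F s - F s = (LINT x|gaussian. F (s + \<i> * of_real (x / R)) - F s)"
    unfolding gauss_smooth_def
    by (subst Bochner_Integration.integral_diff) (use gauss_smooth_integrable[OF F M s'] gaussian.prob_space in auto)
  also have "norm \<dots> \<le> (LINT x|gaussian. norm (F (s + \<i> * of_real (x / R)) - F s))"
    by (rule integral_norm_bound)
  also have "\<dots> \<le> (LINT x|gaussian. 2 * M / e / R * \<bar>x\<bar>)"
  proof (rule integral_mono)
    show "integrable gaussian (\<lambda>x. norm (F (s + \<i> * of_real (x / R)) - F s))"
      by (intro integrable_norm Bochner_Integration.integrable_diff gauss_smooth_integrable[OF F M s']) auto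
    show "integrable gaussian (\<lambda>x. 2 * M / e / R * \<bar>x\<bar>)"
      using m by simp
    show "norm (F (s + \<i> * of_real (x / R)) - F s) \<le> 2 * M / e / R * \<bar>x\<bar>" for x
      using half_plane_lipschitz[OF F M e, of "s + \<i> * of_real (x / R)" s] s R
      by (simp add: norm_mult norm_divide)
  qed
  also have "\<dots> = 2 * M / e * sqrt (2 / pi) / R"
    using m by simp
  finally show ?thesis .
qed

text \<open>The Gaussian is its own Fourier transform.\<close>

lemma gauss_smooth_dirichlet:
  assumes P: "\<And>s. P s = (\<Sum>n = 1..N. a n * npow n s)"
  shows "gauss_smooth R P s = (\<Sum>n = 1..N. a n * exp (- ((ln (real n) / R)\<^sup>2 / 2)) * npow n s)"
proof -
  have "gauss_smooth R P s = (LINT x|gaussian. (\<Sum>n = 1..N. a n * npow n s * iexp ((- ln (real n) / R) * x)))"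
    unfolding gauss_smooth_def P
    by (intro Bochner_Integration.integral_cong refl sum.cong)
      (simp add: exp_add[symmetric] algebra_simps exp_diff exp_minus divide_inverse)
  also have "\<dots> = (\<Sum>n = 1..N. a n * npow n s * char gaussian (- ln (real n) / R))"
    unfolding char_def divide_inverse
    by (subst Bochner_Integration.integral_sum)
      (auto intro!: sum.cong gaussian_integrable[where B = "1"] integrable_mult_right continuous_intros simp: norm_exp_eq_Re)
  also have "\<dots> = (\<Sum>n = 1..N. a n * exp (- ((ln (real n) / R)\<^sup>2 / 2)) * npow n s)"
    unfolding char_std_normal_distribution by (simp add: power_divide mult_ac exp_of_real[symmetric])
  finally show ?thesis .
qed

text \<open>A coefficient is the mean of the polynomial against the conjugate exponential.\<close>

lemma dirichlet_coefficient_bound: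
  assumes P: "\<And>s. P s = (\<Sum>n = 1..N. a n * npow n s)"
    and B: "\<And>t. norm (P (vline \<sigma> t)) \<le> B" and k: "k \<in> {1..N}"
  shows "norm (a k) \<le> B * real k powr \<sigma>"
proof -
  let ?f = "\<lambda>n t. a n * exp (- of_real (\<sigma> * ln (real n))) * exp (\<i> * of_real ((ln (real k) - ln (real n)) * t))"
  have eq: "P (vline \<sigma> t) * exp (\<i> * of_real (ln (real k) * t)) = (\<Sum>n=1..N. ?f n t)" for t
    unfolding P sum_distrib_right
    by (intro sum.cong refl) (simp add: exp_add[symmetric] mult.assoc, simp add: algebra_simps)
  have "(\<Sum>n=1..N. a n * exp (- of_real (\<sigma> * ln (real n))) * (if ln (real k) - ln (real n) = 0 then 1 else 0)) =
     (\<Sum>n=1..N. if n = k then a n * exp (- of_real (\<sigma> * ln (real n))) else 0)"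
    using k by (intro sum.cong refl) auto
  also have "\<dots> = a k * exp (- of_real (\<sigma> * ln (real k)))"
    using k by simp
  finally have S: "(\<Sum>n=1..N. a n * exp (- of_real (\<sigma> * ln (real n))) * (if ln (real k) - ln (real n) = 0 then 1 else 0)) =
     a k * exp (- of_real (\<sigma> * ln (real k)))" .
  have mean: "has_mean (\<lambda>t. P (vline \<sigma> t) * exp (\<i> * of_real (ln (real k) * t))) (a k * exp (- of_real (\<sigma> * ln (real k))))"
    unfolding eq S[symmetric] by (rule has_mean_exp_sum)
  have "norm (a k * exp (- of_real (\<sigma> * ln (real k))) - 0) \<le> B"
  proof (rule has_mean_dist[OF _ _ mean has_mean_const])
    show "continuous_on UNIV (\<lambda>t. P (vline \<sigma> t) * exp (\<i> * of_real (ln (real k) * t)))"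
      unfolding P by (intro continuous_intros)
  qed (use B in \<open>auto simp: norm_mult norm_exp_eq_Re\<close>)
  then have "norm (a k) * exp (- (\<sigma> * ln (real k))) \<le> B"
    by (simp add: norm_mult norm_exp_eq_Re)
  then show ?thesis
    using k by (simp add: powr_def exp_minus field_simps)
qed

lemma gauss_weights_summable:
  assumes "R > 0"
  shows "summable (\<lambda>n. real n powr \<sigma> * exp (- ((ln (real n) / R)\<^sup>2 / 2)))"
proof (rule summable_comparison_test_bigo)
  show "summable (\<lambda>n. norm (real n powr - 2))"
    by (simp add: summable_real_powr_iff)
  show "(\<lambda>n. real n powr \<sigma> * exp (- ((ln (real n) / R)\<^sup>2 / 2))) \<in> O(\<lambda>n. real n powr - 2)"
    using assms by real_asymp
qed

text \<open>A bound far to the right controls the smoothed polynomial on the whole right half-plane, since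
the Gaussian factor outweighs the growth \<open>n powr (\<sigma> + 1)\<close> of the coefficients. This is what
transports uniform convergence to the left.\<close>

lemma gauss_smooth_dirichlet_bound:
  assumes P: "dirichlet_polynomial P" and B: "\<And>s. Re s > \<sigma> \<Longrightarrow> norm (P s) \<le> B" and R: "R > 0" and s: "Re s \<ge> 0"
  shows "norm (gauss_smooth R P s) \<le> B * (\<Sum>n. real n powr (\<sigma> + 1) * exp (- ((ln (real n) / R)\<^sup>2 / 2)))"
proof -
  let ?w = "\<lambda>n. real n powr (\<sigma> + 1) * exp (- ((ln (real n) / R)\<^sup>2 / 2))"
  have B0: "B \<ge> 0"
    using B[of "of_real (\<sigma> + 1)"] norm_ge_zero[of "P (of_real (\<sigma> + 1))"] by (simp del: norm_ge_zero)
  obtain a N where Na: "\<And>s. P s = (\<Sum>n = 1..N. a n * npow n s)"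
    by (rule dirichlet_polynomial_exp_form[OF P]) (rule that)
  have a: "norm (a k) \<le> B * real k powr (\<sigma> + 1)" if "k \<in> {1..N}" for k
    by (rule dirichlet_coefficient_bound[OF Na _ that]) (rule B, simp)
  have "norm (gauss_smooth R P s) \<le> (\<Sum>n = 1..N. B * ?w n)"
    unfolding gauss_smooth_dirichlet[OF Na]
  proof (rule sum_norm_le)
    fix n assume n: "n \<in> {1..N}"
    have "norm (a n * of_real (exp (- ((ln (real n) / R)\<^sup>2 / 2))) * npow n s) =
        norm (a n) * exp (- ((ln (real n) / R)\<^sup>2 / 2)) * exp (- (Re s * ln (real n)))"
      by (simp add: norm_mult norm_exp_eq_Re)
    also have "\<dots> \<le> (B * real n powr (\<sigma> + 1)) * exp (- ((ln (real n) / R)\<^sup>2 / 2)) * 1"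
      using a[OF n] n s B0 by (intro mult_mono) auto
    finally show "norm (a n * of_real (exp (- ((ln (real n) / R)\<^sup>2 / 2))) * npow n s) \<le> B * ?w n"
      by (simp add: mult_ac)
  qed
  also have "\<dots> = B * (\<Sum>n = 1..N. ?w n)"
    by (simp add: sum_distrib_left)
  also have "\<dots> \<le> B * suminf ?w"
    using gauss_weights_summable[OF R] B0 by (intro mult_left_mono sum_le_suminf) auto
  finally show ?thesis .
qed

section \<open>Bohr's theorem for bounded Dirichlet series\<close>

text \<open>Far to the right only uniform approximability by Dirichlet polynomials is demanded, not a
convergent series. Up to moving the half-plane to the right the two are equivalent, but this form passes
directly to \<open>H \<circ> \<phi>\<close>, without products or compositions of infinite Dirichlet series.\<close>

definition bounded_dirichlet :: "(complex \<Rightarrow> complex) \<Rightarrow> bool" where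
  "bounded_dirichlet F \<longleftrightarrow> F holomorphic_on right_half_plane 0 \<and>
     (\<exists>M. \<forall>s\<in>right_half_plane 0. norm (F s) \<le> M) \<and>
     (\<exists>\<sigma>. \<forall>e>0. \<exists>P. dirichlet_polynomial P \<and> (\<forall>s. Re s > \<sigma> \<longrightarrow> norm (F s - P s) \<le> e))"

lemma gauss_smooth_diff:
  assumes "F holomorphic_on right_half_plane \<theta>" "\<And>s. s \<in> right_half_plane \<theta> \<Longrightarrow> norm (F s) \<le> M"
    "G holomorphic_on right_half_plane \<theta>" "\<And>s. s \<in> right_half_plane \<theta> \<Longrightarrow> norm (G s) \<le> M'" "Re s > \<theta>"
  shows "gauss_smooth R (\<lambda>s. F s - G s) s = gauss_smooth R F s - gauss_smooth R G s"
  unfolding gauss_smooth_def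
  by (rule Bochner_Integration.integral_diff)
    (rule gauss_smooth_integrable[OF assms(1,2,5)] gauss_smooth_integrable[OF assms(3,4,5)]; assumption)+

text \<open>The approximants of \<open>F\<close> far to the right become, after smoothing, uniformly convergent on the
right half-plane. The limit agrees with the smoothed \<open>F\<close> far to the right, hence everywhere by
the identity theorem.\<close>

lemma gauss_smooth_approx:
  assumes F: "bounded_dirichlet F" and R: "R > 0" and e: "e > 0"
  shows "\<exists>P. dirichlet_polynomial P \<and> (\<forall>s. Re s > 0 \<longrightarrow> norm (gauss_smooth R F s - P s) \<le> e)"
proof -
  from F obtain M \<sigma>0 where hol: "F holomorphic_on right_half_plane 0"
    and M: "\<And>s. s \<in> right_half_plane 0 \<Longrightarrow> norm (F s) \<le> M"
    and \<sigma>0: "\<And>e. e > 0 \<Longrightarrow> \<exists>P. dirichlet_polynomial P \<and> (\<forall>s. Re s > \<sigma>0 \<longrightarrow> norm (F s - P s) \<le> e)"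
    unfolding bounded_dirichlet_def by blast
  define \<sigma> where "\<sigma> = max \<sigma>0 0"
  have \<sigma>: "\<sigma> \<ge> 0" by (simp add: \<sigma>_def)
  have "\<exists>P. dirichlet_polynomial P \<and> (\<forall>s. Re s > \<sigma> \<longrightarrow> norm (F s - P s) \<le> 1 / real (Suc j))" for j
    using \<sigma>0[of "1 / real (Suc j)"] by (force simp: \<sigma>_def)
  then obtain P where P: "\<And>j. dirichlet_polynomial (P j)"
    and FP: "\<And>j s. Re s > \<sigma> \<Longrightarrow> norm (F s - P j s) \<le> 1 / real (Suc j)"
    by metis
  define C where "C = (\<Sum>n. real n powr (\<sigma> + 1) * exp (- ((ln (real n) / R)\<^sup>2 / 2)))"
  have C: "C \<ge> 0"
    unfolding C_def by (rule suminf_nonneg[OF gauss_weights_summable[OF R]]) auto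
  define S where "S j = gauss_smooth R (P j)" for j
  have hP: "P j holomorphic_on X" for j X
    by (rule dirichlet_polynomial_holomorphic[OF P])
  have "\<exists>B. \<forall>s\<in>right_half_plane 0. norm (P j s) \<le> B" for j
    using dirichlet_polynomial_bounded[OF P[of j]] by (metis right_half_plane_def mem_Collect_eq less_imp_le)
  then obtain B where B: "\<And>j s. s \<in> right_half_plane 0 \<Longrightarrow> norm (P j s) \<le> B j"
    by metis
  have Sd: "dirichlet_polynomial (S j)" for j
  proof -
    obtain a N where Na: "\<And>s. P j s = (\<Sum>n = 1..N. a n * npow n s)"
      by (rule dirichlet_polynomial_exp_form[OF P[of j]]) (rule that)
    show ?thesis
      unfolding S_def by (rule dirichlet_polynomial_exp_formI, rule gauss_smooth_dirichlet[OF Na])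
  qed
  have close: "norm (S i s - S j s) \<le> (1 / real (Suc i) + 1 / real (Suc j)) * C" if s: "Re s > 0" for i j s
  proof -
    have "S i s - S j s = gauss_smooth R (\<lambda>s. P i s - P j s) s"
      unfolding S_def by (rule gauss_smooth_diff[OF hP B hP B s, symmetric])
    also have "norm \<dots> \<le> (1 / real (Suc i) + 1 / real (Suc j)) * C"
      unfolding C_def
    proof (rule gauss_smooth_dirichlet_bound[OF dirichlet_polynomial_diff[OF P P] _ R])
      fix z :: complex assume z: "Re z > \<sigma>"
      show "norm (P i z - P j z) \<le> 1 / real (Suc i) + 1 / real (Suc j)"
        using norm_triangle_ineq4[of "F z - P j z" "F z - P i z"] FP[OF z, of i] FP[OF z, of j] by simp
    qed (use s in simp)
    finally show ?thesis .
  qed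
  have "Cauchy (\<lambda>j. S j s)" if s: "Re s > 0" for s
  proof (rule CauchyI)
    fix e :: real assume "e > 0"
    have "e / (2 * (C + 1)) > 0" using C \<open>e > 0\<close> by simp
    from one_over_Suc_less[OF this] obtain N where N: "\<And>k. k \<ge> N \<Longrightarrow> 1 / real (Suc k) < e / (2 * (C + 1))" by blast
    have "norm (S m s - S n s) < e" if "m \<ge> N" "n \<ge> N" for m n
    proof -
      have "norm (S m s - S n s) \<le> (1 / real (Suc m) + 1 / real (Suc n)) * C"
        by (rule close[OF s])
      also have "\<dots> \<le> (1 / real (Suc m) + 1 / real (Suc n)) * (C + 1)"
        by (intro mult_left_mono) auto
      also have "\<dots> < (e / (2 * (C + 1)) + e / (2 * (C + 1))) * (C + 1)"
        using N[OF that(1)] N[OF that(2)] C by (intro mult_strict_right_mono add_strict_mono) auto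
      also have "\<dots> = e"
      proof -
        have "(e / (2 * D) + e / (2 * D)) * D = e" if "D > 0" for D :: real
          using that by (simp add: field_simps)
        from this[of "C + 1"] show ?thesis using C by linarith
      qed
      finally show ?thesis .
    qed
    then show "\<exists>M. \<forall>m\<ge>M. \<forall>n\<ge>M. norm (S m s - S n s) < e" by blast
  qed
  then have "\<exists>g. (\<lambda>j. S j s) \<longlonglongrightarrow> g" if "Re s > 0" for s
    using that Cauchy_convergent convergent_def by blast
  then obtain G where G: "\<And>s. Re s > 0 \<Longrightarrow> (\<lambda>j. S j s) \<longlonglongrightarrow> G s"
    by metis
  have SG: "norm (S i s - G s) \<le> (1 / real (Suc i)) * C" if s: "Re s > 0" for i s
  proof (rule LIMSEQ_le[OF tendsto_norm[OF tendsto_diff[OF tendsto_const G[OF s]]]])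
    show "(\<lambda>j. (1 / real (Suc i) + 1 / real (Suc j)) * C) \<longlonglongrightarrow> (1 / real (Suc i)) * C"
      by real_asymp
  qed (use close[OF s] in auto)
  have ul: "uniform_limit (right_half_plane 0) S G sequentially"
  proof (rule uniform_limitI)
    fix e :: real assume "e > 0"
    have "e / (C + 1) > 0" using C \<open>e > 0\<close> by simp
    from one_over_Suc_less[OF this] obtain N where N: "\<And>k. k \<ge> N \<Longrightarrow> 1 / real (Suc k) < e / (C + 1)" by blast
    have "dist (S n s) (G s) < e" if "n \<ge> N" "s \<in> right_half_plane 0" for n s
    proof -
      have "dist (S n s) (G s) \<le> (1 / real (Suc n)) * C"
        using SG[of s n] that by (simp add: dist_norm right_half_plane_def)
      also have "\<dots> \<le> (1 / real (Suc n)) * (C + 1)"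
        by (intro mult_left_mono) auto
      also have "\<dots> < e / (C + 1) * (C + 1)"
        using N[OF that(1)] C by (intro mult_strict_right_mono) auto
      finally show ?thesis using C by simp
    qed
    then show "eventually (\<lambda>n. \<forall>x\<in>right_half_plane 0. dist (S n x) (G x) < e) sequentially"
      by (auto simp: eventually_sequentially)
  qed
  have Ghol: "G holomorphic_on right_half_plane 0"
  proof (rule holomorphic_uniform_sequence[OF open_right_half_plane])
    show "S n holomorphic_on right_half_plane 0" for n
      by (rule dirichlet_polynomial_holomorphic[OF Sd])
    fix x assume "x \<in> right_half_plane 0"
    then obtain d where "d > 0" "cball x d \<subseteq> right_half_plane 0"
      using open_right_half_plane open_contains_cball by blast
    then show "\<exists>d. 0 < d \<and> cball x d \<subseteq> right_half_plane 0 \<and> uniform_limit (cball x d) S G sequentially"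
      using uniform_limit_on_subset[OF ul] by blast
  qed
  have on_far: "gauss_smooth R F z = G z" if z: "z \<in> right_half_plane \<sigma>" for z
  proof -
    from z have z0: "Re z > 0" and zs: "Re z > \<sigma>" using \<sigma> by (auto simp: right_half_plane_def)
    have "(\<lambda>j. S j z) \<longlonglongrightarrow> gauss_smooth R F z"
    proof (rule LIM_zero_cancel, rule Lim_null_comparison)
      show "eventually (\<lambda>j. norm (S j z - gauss_smooth R F z) \<le> 1 / real (Suc j)) sequentially"
      proof (intro always_eventually allI)
        fix j
        have "S j z - gauss_smooth R F z = gauss_smooth R (\<lambda>s. P j s - F s) z"
          unfolding S_def by (rule gauss_smooth_diff[OF hP B hol M z0, symmetric])
        also have "norm \<dots> \<le> 1 / real (Suc j)"
          unfolding gauss_smooth_def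
        proof (rule gaussian_norm_integral_le)
          show "continuous_on UNIV (\<lambda>x. P j (z + \<i> * complex_of_real (x / R)) - F (z + \<i> * complex_of_real (x / R)))"
            by (intro continuous_intros vertical_shift_continuous[OF hP z0] vertical_shift_continuous[OF hol z0])
          show "norm (P j (z + \<i> * complex_of_real (x / R)) - F (z + \<i> * complex_of_real (x / R))) \<le> 1 / real (Suc j)" for x
            using FP[of "z + \<i> * complex_of_real (x / R)" j] zs by (simp add: norm_minus_commute)
        qed
        finally show "norm (S j z - gauss_smooth R F z) \<le> 1 / real (Suc j)" .
      qed
      show "(\<lambda>j. 1 / real (Suc j)) \<longlonglongrightarrow> 0"
        by real_asymp
    qed
    then show "gauss_smooth R F z = G z"
      using G[OF z0] LIMSEQ_unique by blast
  qed
  have FG: "gauss_smooth R F z = G z" if z: "z \<in> right_half_plane 0" for z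
  proof (rule analytic_continuation_open[of "right_half_plane \<sigma>" "right_half_plane 0" "gauss_smooth R F" G])
    have "of_real (\<sigma> + 1) \<in> right_half_plane \<sigma>"
      by (simp add: right_half_plane_def)
    then show "right_half_plane \<sigma> \<noteq> {}" by blast
    show "right_half_plane \<sigma> \<subseteq> right_half_plane 0"
      using \<sigma> by (auto simp: right_half_plane_def)
    show "connected (right_half_plane 0)"
      by (rule convex_connected[OF convex_right_half_plane])
    show "gauss_smooth R F holomorphic_on right_half_plane 0"
      by (rule gauss_smooth_holomorphic[OF hol M])
  qed (fact open_right_half_plane Ghol on_far z)+
  have "e / (C + 1) > 0" using C e by simp
  from one_over_Suc_less[OF this] obtain N where N: "1 / real (Suc N) < e / (C + 1)" by blast
  show ?thesis
  proof (intro exI[of _ "S N"] conjI allI impI Sd)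
    fix s :: complex assume s: "Re s > 0"
    have "norm (gauss_smooth R F s - S N s) \<le> (1 / real (Suc N)) * C"
      using SG[OF s, of N] FG[of s] s by (simp add: norm_minus_commute right_half_plane_def)
    also have "\<dots> \<le> e / (C + 1) * (C + 1)"
      using N C e by (intro mult_mono) auto
    finally show "norm (gauss_smooth R F s - S N s) \<le> e"
      using C by simp
  qed
qed

text \<open>Bohr's theorem. Smoothing at scale \<open>1/R\<close> moves \<open>F\<close> little, because \<open>F\<close> is Lipschitz away
from the boundary.\<close>

theorem bounded_dirichlet_uniform_approx:
  assumes F: "bounded_dirichlet F" and d: "d > 0" and e: "e > 0"
  obtains P where "dirichlet_polynomial P" "\<And>s. Re s \<ge> d \<Longrightarrow> norm (F s - P s) \<le> e"
proof -
  from F obtain M where hol: "F holomorphic_on right_half_plane 0"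
    and M: "\<And>s. s \<in> right_half_plane 0 \<Longrightarrow> norm (F s) \<le> M"
    unfolding bounded_dirichlet_def by blast
  have M0: "M \<ge> 0"
    using M[of 1] norm_ge_zero[of "F 1"] by (simp add: right_half_plane_def del: norm_ge_zero)
  define K where "K = 2 * M / d * sqrt (2 / pi)"
  have K: "K \<ge> 0"
    using M0 d by (simp add: K_def)
  \<comment> \<open>Smoothing costs at most \<open>K / R\<close>, here less than half of the error.\<close>
  define R where "R = 2 * (K + 1) / e"
  have R: "R > 0"
    using K e by (simp add: R_def)
  obtain P where P: "dirichlet_polynomial P" "\<And>s. Re s > 0 \<Longrightarrow> norm (gauss_smooth R F s - P s) \<le> e / 2"
    using gauss_smooth_approx[OF F R, of "e/2"] e by auto
  show thesis
  proof (rule that[OF P(1)])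
    fix s :: complex assume s: "Re s \<ge> d"
    have "norm (gauss_smooth R F s - F s) \<le> K / R"
      unfolding K_def by (rule gauss_smooth_close[OF hol M d _ R]) (use s in auto)
    also have "K / R \<le> e / 2"
      using K e by (simp add: R_def field_simps)
    finally have "norm (gauss_smooth R F s - F s) \<le> e / 2" .
    moreover have "norm (gauss_smooth R F s - P s) \<le> e / 2"
      using s d by (intro P(2)) simp
    ultimately show "norm (F s - P s) \<le> e"
      using norm_triangle_ineq4[of "gauss_smooth R F s - P s" "gauss_smooth R F s - F s"] by simp
  qed
qed

section \<open>Means of bounded Dirichlet series\<close>

lemma dirichlet_polynomial_mean:
  assumes "dirichlet_polynomial P"
  obtains b where "\<And>d. has_mean (\<lambda>t. P (vline d t)) b" "((\<lambda>x. P (of_real x)) \<longlongrightarrow> b) at_top"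
proof -
  obtain a N where Na: "\<And>s. P s = (\<Sum>n = 1..N. a n * npow n s)"
    by (rule dirichlet_polynomial_exp_form[OF assms]) (rule that)
  define b where "b = (\<Sum>n = 1..N. a n * (if ln (real n) = 0 then 1 else 0))"
  show thesis
  proof (rule that)
    fix d :: real
    let ?f = "\<lambda>n t. a n * exp (- of_real (d * ln (real n))) * exp (\<i> * of_real ((- ln (real n)) * t))"
    have eq: "P (vline d t) = (\<Sum>n=1..N. ?f n t)" for t
      unfolding Na by (intro sum.cong refl) (simp add: mult.assoc exp_add[symmetric], simp add: algebra_simps)
    have "has_mean (\<lambda>t. \<Sum>n=1..N. ?f n t) (\<Sum>n=1..N. a n * exp (- of_real (d * ln (real n))) * (if - ln (real n) = 0 then 1 else 0))"
      by (rule has_mean_exp_sum)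
    moreover have "(\<Sum>n=1..N. a n * exp (- of_real (d * ln (real n))) * (if - ln (real n) = 0 then 1 else 0)) = b"
      unfolding b_def by (intro sum.cong) auto
    ultimately show "has_mean (\<lambda>t. P (vline d t)) b"
      unfolding eq by simp
  next
    have lim: "((\<lambda>x. exp (- (of_real x * complex_of_real (ln (real n))))) \<longlongrightarrow> (if ln (real n) = 0 then 1 else 0)) at_top" if "n \<ge> 1" for n
    proof (cases "ln (real n) = 0")
      case False
      then have l: "ln (real n) > 0" using that by simp
      have "((\<lambda>x. exp (- (x * ln (real n)))) \<longlongrightarrow> 0) at_top"
        using l by real_asymp
      from tendsto_of_real[OF this, where 'a = complex] show ?thesis
        using False by (simp add: exp_of_real[symmetric])
    qed simp
    show "((\<lambda>x. P (of_real x)) \<longlongrightarrow> b) at_top"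
      unfolding Na b_def by (intro tendsto_intros lim) auto
  qed
qed

lemma bounded_dirichletE:
  assumes "bounded_dirichlet F"
  obtains M where "F holomorphic_on right_half_plane 0" "\<And>s. Re s > 0 \<Longrightarrow> norm (F s) \<le> M" "M \<ge> 0"
proof -
  from assms obtain M where hol: "F holomorphic_on right_half_plane 0"
    and M: "\<And>s. s \<in> right_half_plane 0 \<Longrightarrow> norm (F s) \<le> M"
    unfolding bounded_dirichlet_def by blast
  have "M \<ge> 0"
    using M[of 1] norm_ge_zero[of "F 1"] by (simp add: right_half_plane_def del: norm_ge_zero)
  with hol M show thesis
    by (intro that[of M]) (auto simp: right_half_plane_def)
qed

lemma bounded_dirichlet_continuous:
  assumes "bounded_dirichlet F" "d > 0"
  shows "continuous_on UNIV (\<lambda>t. F (vline d t))"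
  by (rule bounded_dirichletE[OF assms(1)], rule continuous_on_vertical[where S = "right_half_plane 0"])
    (use assms(2) in \<open>auto simp: right_half_plane_def holomorphic_on_imp_continuous_on\<close>)

lemma dirichlet_polynomial_continuous_vertical:
  assumes "dirichlet_polynomial P"
  shows "continuous_on UNIV (\<lambda>t. P (w + \<i> * of_real t))"
  by (rule continuous_on_vertical[where S = UNIV])
    (auto intro: dirichlet_polynomial_holomorphic[OF assms] holomorphic_on_imp_continuous_on)

text \<open>Both sides are continuous for uniform convergence on \<open>Re s \<ge> d\<close>, and for a Dirichlet polynomial
both are the coefficient of \<open>n = 1\<close>.\<close>

theorem bounded_dirichlet_mean:
  assumes F: "bounded_dirichlet F" and l: "((\<lambda>x::real. F (of_real x)) \<longlongrightarrow> l) at_top" and d: "d > 0"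
  shows "has_mean (\<lambda>t. F (vline d t)) l"
proof (rule has_mean_uniform_approx[OF bounded_dirichlet_continuous[OF F d]])
  fix e :: real assume e: "e > 0"
  obtain P where P: "dirichlet_polynomial P" "\<And>s. Re s \<ge> d \<Longrightarrow> norm (F s - P s) \<le> e"
    by (rule bounded_dirichlet_uniform_approx[OF F d e]) (rule that)
  obtain b where b: "\<And>d. has_mean (\<lambda>t. P (vline d t)) b" "((\<lambda>x. P (of_real x)) \<longlongrightarrow> b) at_top"
    by (rule dirichlet_polynomial_mean[OF P(1)]) (rule that)
  have "norm (l - b) \<le> e"
  proof (rule tendsto_upperbound[OF tendsto_norm[OF tendsto_diff[OF l b(2)]]])
    show "eventually (\<lambda>x. norm (F (of_real x) - P (of_real x)) \<le> e) at_top"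
      using eventually_ge_at_top[of d] by eventually_elim (auto intro: P(2))
  qed simp
  then show "\<exists>v n. continuous_on UNIV v \<and> has_mean v n \<and> (\<forall>t. norm (F (vline d t) - v t) \<le> e) \<and> norm (n - l) \<le> e"
    using dirichlet_polynomial_continuous_vertical[OF P(1)] b(1) P(2)
    by (intro exI[of _ "\<lambda>t. P (vline d t)"] exI[of _ b]) (auto simp: norm_minus_commute)
qed

text \<open>The polarised Parseval identity: only the diagonal terms survive the mean.\<close>

lemma dirichlet_inner_mean:
  fixes d e :: real
  assumes Na: "\<And>s. P s = (\<Sum>n = 1..N. a n * npow n s)"
  shows "has_mean (\<lambda>t. P (vline d t) * cnj (P (vline e t)))
    (of_real (\<Sum>n=1..N. (norm (a n))\<^sup>2 * exp (- ((d + e) * ln (real n)))))"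
proof -
  let ?f = "\<lambda>z t. a (fst z) * cnj (a (snd z)) * exp (- of_real (d * ln (real (fst z)) + e * ln (real (snd z)))) *
      exp (\<i> * of_real ((ln (real (snd z)) - ln (real (fst z))) * t))"
  have eq: "P (vline d t) * cnj (P (vline e t)) = (\<Sum>z\<in>{1..N}\<times>{1..N}. ?f z t)" for t
    unfolding Na cnj_sum sum_product sum.cartesian_product
  proof (intro sum.cong refl)
    fix z :: "nat \<times> nat" assume "z \<in> {1..N} \<times> {1..N}"
    obtain n m where z: "z = (n, m)" by (cases z)
    let ?X = "ln (real n)" and ?Y = "ln (real m)"
    have "- ((vline d t) * of_real ?X) + cnj (- ((vline e t) * of_real ?Y)) =
        - complex_of_real (d * ?X + e * ?Y) + \<i> * complex_of_real ((?Y - ?X) * t)"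
      by (simp add: algebra_simps)
    then have key: "exp (- ((vline d t) * of_real ?X)) * cnj (exp (- ((vline e t) * of_real ?Y))) =
        exp (- complex_of_real (d * ?X + e * ?Y)) * exp (\<i> * complex_of_real ((?Y - ?X) * t))"
      by (simp only: exp_cnj exp_add[symmetric])
    have "(a n * exp (- ((vline d t) * of_real ?X))) * cnj (a m * exp (- ((vline e t) * of_real ?Y))) =
       a n * cnj (a m) * (exp (- ((vline d t) * of_real ?X)) * cnj (exp (- ((vline e t) * of_real ?Y))))"
      by (simp only: complex_cnj_mult mult_ac)
    also have "\<dots> = ?f z t"
      unfolding key z fst_conv snd_conv by (simp only: mult.assoc)
    finally show "(case z of (n, m) \<Rightarrow> a n * exp (- ((vline d t) * of_real (ln (real n)))) *
        cnj (a m * exp (- ((vline e t) * of_real (ln (real m)))))) = ?f z t"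
      unfolding z prod.case .
  qed
  have hm: "has_mean (\<lambda>t. \<Sum>n\<in>{1..N}\<times>{1..N}. ?f n t) (\<Sum>z\<in>{1..N}\<times>{1..N}. a (fst z) * cnj (a (snd z)) * exp (- of_real (d * ln (real (fst z)) + e * ln (real (snd z)))) *
     (if ln (real (snd z)) - ln (real (fst z)) = 0 then 1 else 0))"
    by (rule has_mean_exp_sum)
  have "(\<Sum>z\<in>{1..N}\<times>{1..N}. a (fst z) * cnj (a (snd z)) * exp (- of_real (d * ln (real (fst z)) + e * ln (real (snd z)))) *
     (if ln (real (snd z)) - ln (real (fst z)) = 0 then 1 else 0)) =
     (\<Sum>n=1..N. \<Sum>m=1..N. if m = n then a n * cnj (a n) * exp (- of_real (d * ln (real n) + e * ln (real n))) else 0)"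
    unfolding sum.cartesian_product
  proof (intro sum.cong refl)
    fix z :: "nat \<times> nat" assume A: "z \<in> {1..N} \<times> {1..N}"
    obtain n m where z: "z = (n, m)" by (cases z)
    have "ln (real m) - ln (real n) = 0 \<longleftrightarrow> m = n"
      using A unfolding z by simp
    then show "a (fst z) * cnj (a (snd z)) * exp (- of_real (d * ln (real (fst z)) + e * ln (real (snd z)))) *
       (if ln (real (snd z)) - ln (real (fst z)) = 0 then 1 else 0) =
       (case z of (n, m) \<Rightarrow> if m = n then a n * cnj (a n) * exp (- of_real (d * ln (real n) + e * ln (real n))) else 0)"
      unfolding z prod.case fst_conv snd_conv by (cases "m = n") simp_all
  qed
  also have "\<dots> = of_real (\<Sum>n=1..N. (norm (a n))\<^sup>2 * exp (- ((d + e) * ln (real n))))"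
    by (simp add: complex_norm_square[symmetric] distrib_right exp_of_real[symmetric])
  finally show "has_mean (\<lambda>t. P (vline d t) * cnj (P (vline e t))) (of_real (\<Sum>n=1..N. (norm (a n))\<^sup>2 * exp (- ((d + e) * ln (real n)))))"
    using hm unfolding eq by simp
qed

lemma dirichlet_polynomial_inner_mean:
  assumes "dirichlet_polynomial P"
  obtains g :: "real \<Rightarrow> real" where
    "\<And>d e. has_mean (\<lambda>t. P (vline d t) * cnj (P (vline e t))) (of_real (g (d + e)))"
    "\<And>x y. x \<le> y \<Longrightarrow> g y \<le> g x"
proof -
  obtain a N where Na: "\<And>s. P s = (\<Sum>n = 1..N. a n * npow n s)"
    by (rule dirichlet_polynomial_exp_form[OF assms]) (rule that)
  define g where "g x = (\<Sum>n=1..N. (norm (a n))\<^sup>2 * exp (- (x * ln (real n))))" for x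
  show thesis
  proof (rule that[of g])
    fix x y :: real assume "x \<le> y"
    then show "g y \<le> g x"
      unfolding g_def by (intro sum_mono mult_left_mono) (auto intro: mult_right_mono)
  next
    fix d e :: real
    show "has_mean (\<lambda>t. P (vline d t) * cnj (P (vline e t))) (of_real (g (d + e)))"
      unfolding g_def by (rule dirichlet_inner_mean[OF Na])
  qed
qed

text \<open>For a Dirichlet polynomial with coefficients \<open>a\<^sub>n\<close> the function \<open>G x\<close> is
\<open>\<Sum> \<bar>a\<^sub>n\<bar>\<^sup>2 n powr (- x)\<close>. That the inner product of two vertical lines depends only on the sum of their
abscissas, monotonically, is all that is kept of this formula in the limit.\<close>

lemma bounded_dirichlet_inner_mean:
  assumes F: "bounded_dirichlet F"
  obtains G :: "real \<Rightarrow> real" where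
    "\<And>d e. d > 0 \<Longrightarrow> e > 0 \<Longrightarrow>
       has_mean (\<lambda>t. F (vline d t) * cnj (F (vline e t))) (of_real (G (d + e)))"
    "\<And>x y. 0 < x \<Longrightarrow> x \<le> y \<Longrightarrow> G y \<le> G x"
proof -
  obtain M where M: "\<And>s. Re s > 0 \<Longrightarrow> norm (F s) \<le> M" "M \<ge> 0"
    by (rule bounded_dirichletE[OF F]) (rule that)
  have "\<exists>P. dirichlet_polynomial P \<and> (\<forall>s. Re s \<ge> 1 / real (Suc j) \<longrightarrow> norm (F s - P s) \<le> 1 / real (Suc j))" for j
    by (rule bounded_dirichlet_uniform_approx[OF F, of "1 / real (Suc j)" "1 / real (Suc j)"]) auto
  then obtain P where P: "\<And>j. dirichlet_polynomial (P j)"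
    and FP: "\<And>j s. Re s \<ge> 1 / real (Suc j) \<Longrightarrow> norm (F s - P j s) \<le> 1 / real (Suc j)"
    by metis
  have "\<exists>g::real \<Rightarrow> real. (\<forall>d e. has_mean (\<lambda>t. P j (vline d t) * cnj (P j (vline e t))) (of_real (g (d + e))))
      \<and> (\<forall>x y. x \<le> y \<longrightarrow> g y \<le> g x)" for j
    by (rule dirichlet_polynomial_inner_mean[OF P[of j]]) blast
  then obtain g :: "nat \<Rightarrow> real \<Rightarrow> real" where
      g: "\<And>j d e. has_mean (\<lambda>t. P j (vline d t) * cnj (P j (vline e t))) (of_real (g j (d + e)))"
    and g_anti: "\<And>j x y. x \<le> y \<Longrightarrow> g j y \<le> g j x"
    by metis
  define u where "u d e t = F (vline d t) * cnj (F (vline e t))" for d e t :: real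
  define v where "v j d e t = P j (vline d t) * cnj (P j (vline e t))" for j and d e t :: real
  have uc: "continuous_on UNIV (u d e)" if "d > 0" "e > 0" for d e
    unfolding u_def by (intro continuous_intros bounded_dirichlet_continuous F that)
  have vc: "continuous_on UNIV (v j d e)" for j d e
    unfolding v_def by (intro continuous_intros dirichlet_polynomial_continuous_vertical P)
  have uv: "norm (u d e t - v j d e t) \<le> (2 * M + 1) * (1 / real (Suc j))"
    if d: "d \<ge> 1 / real (Suc j)" and e: "e \<ge> 1 / real (Suc j)" for d e t j
  proof -
    let ?r = "1 / real (Suc j)"
    let ?a = "F (vline d t)" and ?b = "F (vline e t)"
    let ?a' = "P j (vline d t)" and ?b' = "P j (vline e t)"
    have "?r > 0" by simp
    then have "d > 0" "e > 0" using d e by linarith+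
    then have ab: "norm ?a \<le> M" "norm ?b \<le> M"
      by (auto intro!: M(1))
    have aa: "norm (?a - ?a') \<le> ?r" "norm (?b - ?b') \<le> ?r"
      using FP[of j] d e by auto
    have "norm ?a' \<le> M + 1"
    proof -
      have "?r \<le> 1" by simp
      moreover have "norm ?a' \<le> norm ?a + norm (?a - ?a')"
        using norm_triangle_ineq4[of ?a "?a - ?a'"] by simp
      ultimately show ?thesis
        using ab(1) aa(1) by linarith
    qed
    have "u d e t - v j d e t = (?a - ?a') * cnj ?b + ?a' * cnj (?b - ?b')"
      by (simp add: u_def v_def algebra_simps)
    also have "norm \<dots> \<le> norm (?a - ?a') * norm ?b + norm ?a' * norm (?b - ?b')"
      by (rule order_trans[OF norm_triangle_ineq]) (simp only: norm_mult complex_mod_cnj order_refl)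
    also have "\<dots> \<le> ?r * M + (M + 1) * ?r"
      using aa ab \<open>norm ?a' \<le> M + 1\<close> M(2) by (intro add_mono mult_mono) auto
    also have "\<dots> = (2 * M + 1) * ?r"
      by (simp only: distrib_right distrib_left) simp
    finally show ?thesis .
  qed
  have small: "\<exists>N. \<forall>j\<ge>N. 1 / real (Suc j) \<le> d \<and> 1 / real (Suc j) \<le> e \<and> (2 * M + 1) * (1 / real (Suc j)) \<le> r"
    if "d > 0" "e > 0" "r > 0" for d e r :: real
  proof -
    have pos: "r / (2 * M + 1) > 0" using that M(2) by simp
    obtain N1 N2 N3 where "\<And>j. j \<ge> N1 \<Longrightarrow> 1 / real (Suc j) < d" "\<And>j. j \<ge> N2 \<Longrightarrow> 1 / real (Suc j) < e"
      "\<And>j. j \<ge> N3 \<Longrightarrow> 1 / real (Suc j) < r / (2 * M + 1)"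
      using one_over_Suc_less[OF \<open>d > 0\<close>] one_over_Suc_less[OF \<open>e > 0\<close>] one_over_Suc_less[OF pos] by blast
    then show ?thesis
      using M(2) by (intro exI[of _ "max N1 (max N2 N3)"]) (auto simp: field_simps less_imp_le)
  qed
  have lim: "\<exists>m. has_mean (u d e) m \<and> (\<lambda>j. complex_of_real (g j (d + e))) \<longlonglongrightarrow> m" if d: "d > 0" and e: "e > 0" for d e
  proof -
    have "\<exists>m. has_mean (u d e) m"
    proof (rule has_mean_uniform_limit[OF uc[OF d e]])
      fix r :: real assume "r > 0"
      from small[OF d e this] obtain N where N: "1 / real (Suc N) \<le> d" "1 / real (Suc N) \<le> e" "(2 * M + 1) * (1 / real (Suc N)) \<le> r"
        by blast
      have "norm (u d e t - v N d e t) \<le> r" for t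
        using uv[OF N(1,2)] N(3) by (rule order_trans)
      then show "\<exists>w n. continuous_on UNIV w \<and> has_mean w n \<and> (\<forall>t. norm (u d e t - w t) \<le> r)"
        using vc g[of N d e] unfolding v_def[symmetric] by blast
    qed
    then obtain m where m: "has_mean (u d e) m" ..
    have "(\<lambda>j. complex_of_real (g j (d + e))) \<longlonglongrightarrow> m"
    proof (rule metric_LIMSEQ_I)
      fix r :: real assume "r > 0"
      from small[OF d e half_gt_zero[OF this]] obtain N where N: "\<And>j. j \<ge> N \<Longrightarrow> 1 / real (Suc j) \<le> d" "\<And>j. j \<ge> N \<Longrightarrow> 1 / real (Suc j) \<le> e"
        "\<And>j. j \<ge> N \<Longrightarrow> (2 * M + 1) * (1 / real (Suc j)) \<le> r / 2"
        by blast
      have "dist (complex_of_real (g j (d + e))) m < r" if j: "j \<ge> N" for j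
      proof -
        have "norm (m - complex_of_real (g j (d + e))) \<le> r / 2"
        proof (rule has_mean_dist[OF uc[OF d e] vc m])
          show "has_mean (v j d e) (complex_of_real (g j (d + e)))"
            using g[of j d e] unfolding v_def .
          show "norm (u d e t - v j d e t) \<le> r / 2" for t
            using uv[OF N(1,2)[OF j]] N(3)[OF j] by (rule order_trans)
        qed
        then show ?thesis using \<open>r > 0\<close> by (simp add: dist_norm norm_minus_commute)
      qed
      then show "\<exists>no. \<forall>n\<ge>no. dist (complex_of_real (g n (d + e))) m < r" by blast
    qed
    with m show ?thesis by blast
  qed
  define G where "G x = lim (\<lambda>j. g j x)" for x
  have gG: "(\<lambda>j. g j x) \<longlonglongrightarrow> G x" if "0 < x" for x
  proof -
    have "x / 2 > 0" using that by simp
    from lim[OF this this] obtain m where "(\<lambda>j. complex_of_real (g j x)) \<longlonglongrightarrow> m"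
      by auto
    from tendsto_Re[OF this] have "convergent (\<lambda>j. g j x)"
      by (auto simp: convergent_def)
    then show ?thesis
      unfolding G_def by (simp add: convergent_LIMSEQ_iff)
  qed
  show thesis
  proof (rule that[of G])
    fix d e :: real assume de: "d > 0" "e > 0"
    obtain m where m: "has_mean (u d e) m" "(\<lambda>j. complex_of_real (g j (d + e))) \<longlonglongrightarrow> m"
      using lim[OF de] by blast
    have "m = of_real (G (d + e))"
      using LIMSEQ_unique[OF m(2) tendsto_of_real[OF gG]] de by simp
    with m(1) show "has_mean (\<lambda>t. F (vline d t) * cnj (F (vline e t))) (of_real (G (d + e)))"
      unfolding u_def[symmetric] by simp
  next
    fix x y :: real assume "0 < x" "x \<le> y"
    then show "G y \<le> G x"
      by (intro LIMSEQ_le[OF gG gG]) (auto intro: g_anti)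
  qed
qed

text \<open>The squared distance of two lines is \<open>G (2d) + G (2e) - 2 G (d + e)\<close>, and the monotone bounded
function \<open>G\<close> has a limit at \<open>0\<close>.\<close>

lemma bounded_dirichlet_L2_Cauchy:
  assumes F: "bounded_dirichlet F" and r: "r > 0"
  shows "\<exists>x>0. \<forall>d e. 0 < d \<and> d < x \<and> 0 < e \<and> e < x \<longrightarrow>
    mean_le (\<lambda>t. (norm (F (vline d t) - F (vline e t)))\<^sup>2) r"
proof -
  obtain M where M: "\<And>s. Re s > 0 \<Longrightarrow> norm (F s) \<le> M" "M \<ge> 0"
    by (rule bounded_dirichletE[OF F]) (rule that)
  obtain G :: "real \<Rightarrow> real" where
    G: "\<And>d e. d > 0 \<Longrightarrow> e > 0 \<Longrightarrow>
       has_mean (\<lambda>t. F (vline d t) * cnj (F (vline e t))) (of_real (G (d + e)))"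
    and anti: "\<And>x y. 0 < x \<Longrightarrow> x \<le> y \<Longrightarrow> G y \<le> G x"
    by (rule bounded_dirichlet_inner_mean[OF F]) (rule that)
  have cont: "continuous_on UNIV (\<lambda>t. F (vline d t) * cnj (F (vline e t)))" if "d > 0" "e > 0" for d e
    by (intro continuous_intros bounded_dirichlet_continuous F that)
  have GM: "G x \<le> M\<^sup>2" if "x > 0" for x
  proof -
    have h: "x/2 > 0" using that by simp
    have "norm (complex_of_real (G (x/2 + x/2)) - 0) \<le> M\<^sup>2"
    proof (rule has_mean_dist[OF cont[OF h h] _ G[OF h h] has_mean_const])
      fix t
      have "norm (F (vline (x/2) t)) \<le> M"
        using that by (intro M(1)) simp
      then show "norm (F (vline (x/2) t) * cnj (F (vline (x/2) t)) - 0) \<le> M\<^sup>2"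
        using M(2) by (simp add: norm_mult power2_eq_square mult_mono)
    qed simp
    then show ?thesis by simp
  qed
  have bdd: "bdd_above (G ` {0<..})"
    using GM by (intro bdd_aboveI[of _ "M\<^sup>2"]) auto
  define L where "L = (SUP x\<in>{0<..}. G x)"
  have "L - r / 2 < L" using r by simp
  then obtain x where x: "x > 0" "L - r / 2 < G x"
    unfolding L_def using less_cSUP_iff[OF _ bdd] by auto
  have GL: "G y \<le> L" if "y > 0" for y
    unfolding L_def using bdd that by (intro cSUP_upper) auto
  show ?thesis
  proof (intro exI[of _ "x/2"] conjI allI impI)
    fix d e :: real assume A: "0 < d \<and> d < x/2 \<and> 0 < e \<and> e < x/2"
    then have d: "d > 0" and e: "e > 0" by auto
    let ?u = "\<lambda>d t. F (vline d t)"
    have hm: "has_mean (\<lambda>t. (?u d t * cnj (?u d t) + ?u e t * cnj (?u e t)) - (?u d t * cnj (?u e t) + ?u e t * cnj (?u d t)))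
       ((of_real (G (d + d)) + of_real (G (e + e))) - (of_real (G (d + e)) + of_real (G (e + d))))"
      by (intro has_mean_add has_mean_diff continuous_intros bounded_dirichlet_continuous F G d e)
    have "has_mean (\<lambda>t. Re ((?u d t * cnj (?u d t) + ?u e t * cnj (?u e t)) - (?u d t * cnj (?u e t) + ?u e t * cnj (?u d t))))
       (Re ((of_real (G (d + d)) + of_real (G (e + e))) - (of_real (G (d + e)) + of_real (G (e + d)))))"
      by (rule has_mean_Re[OF _ hm]) (intro continuous_intros bounded_dirichlet_continuous F d e)
    also have "(\<lambda>t. Re ((?u d t * cnj (?u d t) + ?u e t * cnj (?u e t)) - (?u d t * cnj (?u e t) + ?u e t * cnj (?u d t)))) =
       (\<lambda>t. (norm (?u d t - ?u e t))\<^sup>2)"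
      unfolding cmod_power2 by (simp add: power2_eq_square algebra_simps)
    finally have hm2: "has_mean (\<lambda>t. (norm (?u d t - ?u e t))\<^sup>2) (G (d + d) + G (e + e) - 2 * G (d + e))"
      by (simp add: add.commute[of e d])
    have "G x \<le> G (d + e)"
      using A by (intro anti) auto
    moreover have "G (d + d) \<le> L" "G (e + e) \<le> L"
      using d e by (auto intro: GL)
    ultimately have "G (d + d) + G (e + e) - 2 * G (d + e) \<le> r"
      using x(2) by linarith
    with hm2 show "mean_le (\<lambda>t. (norm (?u d t - ?u e t))\<^sup>2) r"
      by (rule has_mean_imp_mean_le)
  qed (use x in simp)
qed

text \<open>On bounded sets, convergence in mean square implies convergence in mean of order \<open>p\<close>, for all
\<open>p > 0\<close> at once.\<close>

lemma powr_le_eps_square: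
  assumes p: "(p::real) > 0" and e: "e > 0"
  obtains C where "C \<ge> 0" "\<And>u. 0 \<le> u \<Longrightarrow> u \<le> M \<Longrightarrow> u powr p \<le> e + C * u\<^sup>2"
proof -
  define d where "d = e powr (1/p)"
  have d: "d > 0" "d powr p = e"
    using e p by (auto simp: d_def powr_powr)
  show thesis
  proof (rule that[of "M powr p / d\<^sup>2"])
    fix u assume u: "0 \<le> u" "u \<le> M"
    show "u powr p \<le> e + M powr p / d\<^sup>2 * u\<^sup>2"
    proof (cases "u \<le> d")
      case True
      then have "u powr p \<le> e"
        using u p d(2) powr_mono2[of p u d] by simp
      also have "e \<le> e + M powr p / d\<^sup>2 * u\<^sup>2" by simp
      finally show ?thesis .
    next
      case False
      then have "1 \<le> u\<^sup>2 / d\<^sup>2"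
        using d(1) by (simp add: power_mono)
      then have "M powr p * 1 \<le> M powr p * (u\<^sup>2 / d\<^sup>2)"
        by (intro mult_left_mono) auto
      moreover have "u powr p \<le> M powr p"
        using u p by (intro powr_mono2) auto
      ultimately show ?thesis using e by simp
    qed
  qed simp
qed

lemma bounded_dirichlet_Lp_Cauchy:
  assumes F: "bounded_dirichlet F" and p: "p > 0" and r: "r > 0"
  obtains x where "x > 0" "\<And>d e. 0 < d \<Longrightarrow> d < x \<Longrightarrow> 0 < e \<Longrightarrow> e < x \<Longrightarrow>
    mean_le (\<lambda>t. norm (F (vline d t) - F (vline e t)) powr p) r"
proof -
  obtain M where M: "\<And>s. Re s > 0 \<Longrightarrow> norm (F s) \<le> M" "M \<ge> 0"
    by (rule bounded_dirichletE[OF F]) (rule that)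
  obtain C where C: "C \<ge> 0" "\<And>u. 0 \<le> u \<Longrightarrow> u \<le> 2 * M \<Longrightarrow> u powr p \<le> r/2 + C * u\<^sup>2"
    by (rule powr_le_eps_square[OF p half_gt_zero[OF r], of "2 * M"]) (rule that)
  have "r / 2 / (C + 1) > 0" using r C(1) by simp
  from bounded_dirichlet_L2_Cauchy[OF F this] obtain x where x: "x > 0"
    "\<And>d e. 0 < d \<Longrightarrow> d < x \<Longrightarrow> 0 < e \<Longrightarrow> e < x \<Longrightarrow>
      mean_le (\<lambda>t. (norm (F (vline d t) - F (vline e t)))\<^sup>2) (r / 2 / (C + 1))"
    by blast
  show thesis
  proof (rule that[OF x(1)])
    fix d e :: real assume A: "0 < d" "d < x" "0 < e" "e < x"
    let ?n = "\<lambda>t. norm (F (vline d t) - F (vline e t))"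
    have cont: "continuous_on UNIV (\<lambda>t. F (vline d t) - F (vline e t))"
      by (intro continuous_intros bounded_dirichlet_continuous F A)
    have "mean_le (\<lambda>t. r/2 + C * (?n t)\<^sup>2) (r/2 + C * (r / 2 / (C + 1)))"
      by (intro mean_le_add mean_le_cmult mean_le_const x(2) A C continuous_intros cont) auto
    then show "mean_le (\<lambda>t. ?n t powr p) r"
    proof (rule mean_le_mono)
      show "continuous_on UNIV (\<lambda>t. ?n t powr p)"
        by (rule continuous_on_norm_powr[OF p cont])
      show "continuous_on UNIV (\<lambda>t. r/2 + C * (?n t)\<^sup>2)"
        by (intro continuous_intros cont)
      show "?n t powr p \<le> r/2 + C * (?n t)\<^sup>2" for t
      proof (rule C(2))
        have "norm (F (vline d t)) \<le> M" "norm (F (vline e t)) \<le> M"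
          using A by (auto intro!: M(1))
        then show "?n t \<le> 2 * M"
          by (intro order_trans[OF norm_triangle_ineq4]) simp
      qed simp
      show "r/2 + C * (r / 2 / (C + 1)) \<le> r"
      proof -
        have "C * (r / 2 / (C + 1)) \<le> (C + 1) * (r / 2 / (C + 1))"
          using C(1) r by (intro mult_right_mono) auto
        also have "\<dots> = r / 2"
        proof -
          have "D * (r / 2 / D) = r / 2" if "D > 0" for D
            using that by simp
          from this[of "C + 1"] show ?thesis using C(1) by linarith
        qed
        finally show ?thesis by linarith
      qed
    qed
  qed
qed

section \<open>Symbols\<close>

lemma symbol_Re_gt:
  assumes "\<phi> \<in> symbol_class_G0" "Re s > 0"
  shows "Re (\<phi> s) > 1/2"
  using assms unfolding symbol_class_G0_def right_half_plane_def by auto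

text \<open>If the series converges at \<open>x\<^sub>1\<close>, its coefficients are \<open>O(n powr x\<^sub>1)\<close>, so it converges absolutely and
uniformly on \<open>Re s \<ge> x\<^sub>1 + 2\<close>. The terms with \<open>n \<ge> 2\<close> decay at least like \<open>2 powr (- Re s)\<close>.\<close>

lemma symbol_expansion:
  assumes phi: "\<phi> \<in> symbol_class_G0"
  obtains c1 \<sigma> where
    "\<And>e. e > 0 \<Longrightarrow> \<exists>P. dirichlet_polynomial P \<and> (\<forall>s. Re s > \<sigma> \<longrightarrow> norm (\<phi> s - P s) \<le> e)"
    "\<And>e. e > 0 \<Longrightarrow> \<exists>x0. \<forall>s. Re s > x0 \<longrightarrow> norm (\<phi> s - c1) \<le> e"
proof -
  from phi obtain c \<sigma>0 where c: "\<And>s. Re s > \<sigma>0 \<Longrightarrow> (\<lambda>n. c (Suc n) * of_nat (Suc n) powr (- s)) sums \<phi> s"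
    unfolding symbol_class_G0_def right_half_plane_def by auto
  \<comment> \<open>The terms of the series at the point \<open>x1\<close> of convergence are bounded, which bounds the coefficients.\<close>
  define x1 where "x1 = \<sigma>0 + 1"
  let ?s1 = "complex_of_real x1"
  have "(\<lambda>n. c (Suc n) * of_nat (Suc n) powr (- ?s1)) sums \<phi> ?s1"
    by (rule c) (simp add: x1_def)
  then have "(\<lambda>n. c (Suc n) * of_nat (Suc n) powr (- ?s1)) \<longlonglongrightarrow> 0"
    by (rule summable_LIMSEQ_zero[OF sums_summable])
  then have "Bseq (\<lambda>n. c (Suc n) * of_nat (Suc n) powr (- ?s1))"
    by (rule convergent_imp_Bseq[OF convergentI])
  then obtain B where B: "B > 0" "\<And>n. norm (c (Suc n) * of_nat (Suc n) powr (- ?s1)) \<le> B"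
    by (auto simp: Bseq_def)
  have nterm: "norm (c (Suc n) * of_nat (Suc n) powr (- s)) = norm (c (Suc n)) * real (Suc n) powr (- Re s)" for n s
    by (simp add: norm_mult norm_powr_real_powr del: of_nat_Suc)
  define x2 where "x2 = x1 + 2"
  define T where "T n = norm (c (Suc n)) * real (Suc n) powr (- x2)" for n
  have T0: "T n \<ge> 0" for n by (simp add: T_def)
  have TB: "T n \<le> B * real (Suc n) powr (- 2)" for n
  proof -
    have "T n = (norm (c (Suc n)) * real (Suc n) powr (- x1)) * real (Suc n) powr (- 2)"
      unfolding T_def x2_def by (simp add: powr_add[symmetric] mult.assoc del: of_nat_Suc)
    also have "\<dots> \<le> B * real (Suc n) powr (- 2)"
      using B(2)[of n] unfolding nterm by (intro mult_right_mono) auto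
    finally show ?thesis .
  qed
  have sumT: "summable T"
  proof (rule summable_comparison_test')
    show "summable (\<lambda>n. B * real (Suc n) powr (- 2))"
      using summable_Suc_iff[of "\<lambda>n. real n powr (-2)"] by (intro summable_mult) (simp add: summable_real_powr_iff del: of_nat_Suc)
    show "norm (T n) \<le> B * real (Suc n) powr (- 2)" if "n \<ge> 0" for n
      using TB[of n] T0[of n] by simp
  qed
  have term_le: "norm (c (Suc n) * of_nat (Suc n) powr (- s)) \<le> T n" if "Re s \<ge> x2" for n s
    unfolding nterm T_def using that by (intro mult_left_mono powr_mono) auto
  have phis: "(\<lambda>n. c (Suc n) * of_nat (Suc n) powr (- s)) sums \<phi> s" if "Re s \<ge> x2" for s
    by (rule c) (use that in \<open>simp add: x2_def x1_def\<close>)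
  define P where "P N s = (\<Sum>n<N. c (Suc n) * of_nat (Suc n) powr (- s))" for N s
  have Pd: "dirichlet_polynomial (P N)" for N
    unfolding P_def
  proof (rule dirichlet_polynomial_sum)
    fix n
    have "(\<lambda>s. c (Suc n) * of_nat (Suc n) powr (- s)) = (\<lambda>s. c (Suc n) * npow (Suc n) s)"
      by (simp add: of_nat_powr_exp del: of_nat_Suc)
    then show "dirichlet_polynomial (\<lambda>s. c (Suc n) * of_nat (Suc n) powr (- s))"
      using dirichlet_polynomial_monomial[of "Suc n" "c (Suc n)"] by simp
  qed
  have tail: "norm (\<phi> s - P N s) \<le> (\<Sum>n. T (n + N))" if s: "Re s \<ge> x2" for s N
  proof -
    have "\<phi> s - P N s = (\<Sum>n. c (Suc (n + N)) * of_nat (Suc (n + N)) powr (- s))"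
      using suminf_minus_initial_segment[OF sums_summable[OF phis[OF s]], of N] sums_unique[OF phis[OF s]]
      by (simp add: P_def)
    also have "norm \<dots> \<le> (\<Sum>n. T (n + N))"
    proof (rule norm_suminf_le)
      show "summable (\<lambda>n. T (n + N))"
        using sumT by (simp add: summable_iff_shift)
    qed (rule term_le[OF s])
    finally show ?thesis .
  qed
  show thesis
  proof (rule that)
    fix e :: real assume "e > 0"
    obtain N where N: "\<And>n. n \<ge> N \<Longrightarrow> norm (\<Sum>i. T (i + n)) < e"
      using suminf_exist_split[OF \<open>e > 0\<close> sumT] by blast
    show "\<exists>P. dirichlet_polynomial P \<and> (\<forall>s. Re s > x2 \<longrightarrow> norm (\<phi> s - P s) \<le> e)"
    proof (intro exI[of _ "P N"] conjI allI impI Pd)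
      fix s :: complex assume "Re s > x2"
      then show "norm (\<phi> s - P N s) \<le> e"
        using tail[of s N] N[of N] by auto
    qed
  next
    fix e :: real assume e: "e > 0"
    let ?K = "suminf T"
    have K: "?K \<ge> 0" by (rule suminf_nonneg[OF sumT T0])
    define x0 where "x0 = max x2 (x2 - ln (e / (?K + 1)) / ln 2)"
    show "\<exists>x0. \<forall>s. Re s > x0 \<longrightarrow> norm (\<phi> s - c 1) \<le> e"
    proof (intro exI[of _ x0] allI impI)
      fix s assume s: "Re s > x0"
      then have s2: "Re s \<ge> x2" by (simp add: x0_def)
      have small: "2 powr (- (Re s - x2)) \<le> e / (?K + 1)"
      proof -
        have "- (Re s - x2) * ln 2 \<le> ln (e / (?K + 1))"
          using s by (simp add: x0_def field_simps)
        then have "exp (- (Re s - x2) * ln 2) \<le> e / (?K + 1)"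
          using e K by (subst ln_ge_iff[symmetric]) auto
        then show ?thesis by (simp add: powr_def)
      qed
      have "\<phi> s - c 1 = (\<Sum>n. c (Suc (n + 1)) * of_nat (Suc (n + 1)) powr (- s))"
        using suminf_minus_initial_segment[OF sums_summable[OF phis[OF s2]], of 1] sums_unique[OF phis[OF s2]]
        by simp
      also have "norm \<dots> \<le> (\<Sum>n. 2 powr (- (Re s - x2)) * T (n + 1))"
      proof (rule norm_suminf_le)
        show "summable (\<lambda>n. 2 powr (- (Re s - x2)) * T (n + 1))"
          by (intro summable_mult) (use sumT in \<open>simp only: summable_iff_shift\<close>)
        fix n
        have "real (Suc (n + 1)) powr (- Re s) = real (Suc (n + 1)) powr (- (Re s - x2)) * real (Suc (n + 1)) powr (- x2)"
          by (simp add: powr_add[symmetric] del: of_nat_Suc)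
        also have "\<dots> \<le> 2 powr (- (Re s - x2)) * real (Suc (n + 1)) powr (- x2)"
          using s2 by (intro mult_right_mono powr_mono2') auto
        finally have "norm (c (Suc (n + 1))) * real (Suc (n + 1)) powr (- Re s) \<le> norm (c (Suc (n + 1))) * (2 powr (- (Re s - x2)) * real (Suc (n + 1)) powr (- x2))"
          by (rule mult_left_mono) simp
        then show "norm (c (Suc (n + 1)) * of_nat (Suc (n + 1)) powr (- s)) \<le> 2 powr (- (Re s - x2)) * T (n + 1)"
          unfolding nterm T_def by (simp only: mult_ac)
      qed
      also have "\<dots> = 2 powr (- (Re s - x2)) * (\<Sum>n. T (n + 1))"
        by (rule suminf_mult) (use sumT in \<open>simp only: summable_iff_shift\<close>)
      also have "\<dots> \<le> e / (?K + 1) * (?K + 1)"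
      proof (rule mult_mono[OF small])
        show "(\<Sum>n. T (n + 1)) \<le> ?K + 1"
          using suminf_minus_initial_segment[OF sumT, of 1] T0[of 0] by simp
        show "(\<Sum>n. T (n + 1)) \<ge> 0"
          by (rule suminf_nonneg) (use sumT T0 in \<open>simp_all only: summable_iff_shift\<close>)
      qed (use e K in auto)
      also have "\<dots> = e" using K by simp
      finally show "norm (\<phi> s - c 1) \<le> e" .
    qed
  qed
qed

text \<open>The coefficient \<open>c\<^sub>1\<close> of the symbol.\<close>

definition symbol_limit :: "(complex \<Rightarrow> complex) \<Rightarrow> complex" where
  "symbol_limit \<phi> = (THE c. ((\<lambda>x::real. \<phi> (of_real x)) \<longlongrightarrow> c) at_top)"

lemma symbol_tends_to_limit:
  assumes phi: "\<phi> \<in> symbol_class_G0"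
  shows "\<And>e. e > 0 \<Longrightarrow> \<exists>x0. \<forall>s. Re s > x0 \<longrightarrow> norm (\<phi> s - symbol_limit \<phi>) \<le> e"
    and "((\<lambda>x::real. \<phi> (of_real x)) \<longlongrightarrow> symbol_limit \<phi>) at_top"
proof -
  obtain c1 \<sigma> where
    c1: "\<And>e. e > 0 \<Longrightarrow> \<exists>x0. \<forall>s. Re s > x0 \<longrightarrow> norm (\<phi> s - c1) \<le> e"
    by (rule symbol_expansion[OF phi]) (rule that)
  have lim: "((\<lambda>x::real. \<phi> (of_real x)) \<longlongrightarrow> c1) at_top"
  proof (rule tendstoI)
    fix e :: real assume "e > 0"
    then obtain x0 where x0: "\<And>s. Re s > x0 \<Longrightarrow> norm (\<phi> s - c1) \<le> e/2"
      using c1[of "e/2"] by auto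
    show "eventually (\<lambda>x. dist (\<phi> (of_real x)) c1 < e) at_top"
      using eventually_gt_at_top[of x0]
    proof eventually_elim
      case (elim x)
      then have "norm (\<phi> (of_real x) - c1) \<le> e/2"
        using x0 by simp
      then show ?case using \<open>e > 0\<close> by (simp add: dist_norm)
    qed
  qed
  then have "symbol_limit \<phi> = c1"
    unfolding symbol_limit_def by (intro the_equality) (auto intro: tendsto_unique[rotated])
  then show "\<And>e. e > 0 \<Longrightarrow> \<exists>x0. \<forall>s. Re s > x0 \<longrightarrow> norm (\<phi> s - symbol_limit \<phi>) \<le> e"
    and "((\<lambda>x::real. \<phi> (of_real x)) \<longlongrightarrow> symbol_limit \<phi>) at_top"
    using c1 lim by auto
qed

lemma holomorphic_polynomial_approx:
  fixes H :: "complex \<Rightarrow> complex"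
  assumes H: "H holomorphic_on ball c r" and r: "r > 0" and e: "e > 0"
  obtains a m where "\<And>w. norm (w - c) \<le> r / 2 \<Longrightarrow> norm (H w - (\<Sum>i<m. a i * (w - c) ^ i)) \<le> e"
proof -
  define a where "a i = (deriv ^^ i) H c / fact i" for i
  have sums: "(\<lambda>i. a i * (w - c) ^ i) sums H w" if "w \<in> ball c r" for w
    unfolding a_def by (rule holomorphic_power_series[OF H that])
  have "c + of_real (3 * r / 4) \<in> ball c r"
    using r by (simp add: dist_norm norm_mult norm_divide)
  from sums_summable[OF sums[OF this]] have "summable (\<lambda>i. a i * (of_real (3 * r / 4)) ^ i)"
    by simp
  from conv_radius_geI[OF this] have cr: "ereal (3 * r / 4) \<le> conv_radius a"
    using r by (simp add: norm_mult norm_divide)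
  have "ereal (r / 2) < ereal (3 * r / 4)" using r by simp
  also note cr
  finally have "r / 2 < conv_radius a" .
  from powser_uniform_limit[OF this, of c]
  have "eventually (\<lambda>m. \<forall>w\<in>cball c (r/2). dist (\<Sum>i<m. a i * (w - c) ^ i) (\<Sum>i. a i * (w - c) ^ i) < e) sequentially"
    using e by (rule uniform_limitD)
  then obtain m where m: "\<And>w. w \<in> cball c (r/2) \<Longrightarrow> dist (\<Sum>i<m. a i * (w - c) ^ i) (\<Sum>i. a i * (w - c) ^ i) < e"
    unfolding eventually_sequentially by blast
  show thesis
  proof (rule that)
    fix w assume w: "norm (w - c) \<le> r / 2"
    then have "w \<in> ball c r"
      using r by (simp add: dist_norm norm_minus_commute)
    then have "(\<Sum>i. a i * (w - c) ^ i) = H w"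
      by (intro sums_unique[symmetric] sums)
    then show "norm (H w - (\<Sum>i<m. a i * (w - c) ^ i)) \<le> e"
      using m[of w] w by (simp add: dist_norm norm_minus_commute)
  qed
qed

text \<open>Far to the right the symbol stays in a small disc about its limit, where \<open>H\<close> is a uniform limit of
polynomials; a polynomial in a Dirichlet polynomial is a Dirichlet polynomial.\<close>

lemma bounded_dirichlet_compose:
  assumes phi: "\<phi> \<in> symbol_class_G0"
    and S: "open S" "right_half_plane (1/2) \<subseteq> S" "symbol_limit \<phi> \<in> S"
    and H: "H holomorphic_on S" and M: "\<And>w. Re w > 1/2 \<Longrightarrow> norm (H w) \<le> M"
  shows "bounded_dirichlet (\<lambda>s. H (\<phi> s))"
    and "((\<lambda>x::real. H (\<phi> (of_real x))) \<longlongrightarrow> H (symbol_limit \<phi>)) at_top"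
proof -
  let ?c = "symbol_limit \<phi>"
  have phi_hol: "\<phi> holomorphic_on right_half_plane 0"
    using phi unfolding symbol_class_G0_def by auto
  note phi_img = symbol_Re_gt[OF phi]
  have isc: "isCont H ?c"
    using holomorphic_on_imp_continuous_on[OF H] S continuous_on_eq_continuous_at by blast
  show "((\<lambda>x::real. H (\<phi> (of_real x))) \<longlongrightarrow> H ?c) at_top"
    by (rule isCont_tendsto_compose[OF isc symbol_tends_to_limit(2)[OF phi]])
  obtain \<sigma> where \<sigma>: "\<And>e. e > 0 \<Longrightarrow> \<exists>P. dirichlet_polynomial P \<and> (\<forall>s. Re s > \<sigma> \<longrightarrow> norm (\<phi> s - P s) \<le> e)"
    by (rule symbol_expansion[OF phi]) (rule that)
  obtain r where r: "r > 0" "ball ?c r \<subseteq> S"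
    using S open_contains_ball by blast
  obtain x0 where x0: "\<And>s. Re s > x0 \<Longrightarrow> norm (\<phi> s - ?c) \<le> r / 4"
    using symbol_tends_to_limit(1)[OF phi, of "r/4"] r(1) by auto
  have approx: "\<exists>P. dirichlet_polynomial P \<and> (\<forall>s. Re s > max \<sigma> x0 \<longrightarrow> norm (H (\<phi> s) - P s) \<le> e)" if e: "e > 0" for e
  proof -
    obtain a m where am: "\<And>w. norm (w - ?c) \<le> r / 2 \<Longrightarrow> norm (H w - (\<Sum>i<m. a i * (w - ?c) ^ i)) \<le> e / 2"
      by (rule holomorphic_polynomial_approx[OF holomorphic_on_subset[OF H r(2)] r(1) half_gt_zero[OF e]]) (rule that)
    let ?T = "\<lambda>w. \<Sum>i<m. a i * (w - ?c) ^ i"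
    have "uniformly_continuous_on (cball ?c (r/2)) ?T"
      by (intro compact_uniformly_continuous continuous_intros compact_cball)
    then obtain \<delta> where \<delta>: "\<delta> > 0" "\<And>w z. w \<in> cball ?c (r/2) \<Longrightarrow> z \<in> cball ?c (r/2) \<Longrightarrow> dist z w < \<delta> \<Longrightarrow> dist (?T z) (?T w) < e / 2"
      using half_gt_zero[OF e] unfolding uniformly_continuous_on_def by metis
    obtain P where P: "dirichlet_polynomial P" "\<And>s. Re s > \<sigma> \<Longrightarrow> norm (\<phi> s - P s) \<le> min (\<delta>/2) (r/4)"
      using \<sigma>[of "min (\<delta>/2) (r/4)"] \<delta>(1) r(1) by auto
    show ?thesis
    proof (intro exI[of _ "\<lambda>s. ?T (P s)"] conjI allI impI)
      show "dirichlet_polynomial (\<lambda>s. ?T (P s))"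
        by (intro dirichlet_polynomial_sum dirichlet_polynomial_cmult dirichlet_polynomial_power
            dirichlet_polynomial_diff dirichlet_polynomial_const P(1))
      fix s assume "Re s > max \<sigma> x0"
      then have s: "Re s > \<sigma>" "Re s > x0" by auto
      have d: "norm (\<phi> s - ?c) \<le> r / 4" "norm (\<phi> s - P s) \<le> r / 4" "norm (\<phi> s - P s) \<le> \<delta> / 2"
        using x0[OF s(2)] P(2)[OF s(1)] by auto
      have Pc: "norm (P s - ?c) \<le> r / 2"
        using norm_triangle_ineq4[of "\<phi> s - ?c" "\<phi> s - P s"] d by simp
      have "dist (?T (\<phi> s)) (?T (P s)) < e / 2"
        using d Pc r(1) \<delta>(1) by (intro \<delta>(2)) (auto simp: dist_norm norm_minus_commute)
      moreover have "norm (H (\<phi> s) - ?T (\<phi> s)) \<le> e / 2"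
        using d r(1) by (intro am) simp
      ultimately show "norm (H (\<phi> s) - ?T (P s)) \<le> e"
        using norm_triangle_ineq[of "H (\<phi> s) - ?T (\<phi> s)" "?T (\<phi> s) - ?T (P s)"] by (simp add: dist_norm)
    qed
  qed
  have hol: "(\<lambda>s. H (\<phi> s)) holomorphic_on right_half_plane 0"
    using holomorphic_on_compose_gen[OF phi_hol holomorphic_on_subset[OF H S(2)]] phi_img
    by (auto simp: o_def right_half_plane_def image_subset_iff)
  show "bounded_dirichlet (\<lambda>s. H (\<phi> s))"
    unfolding bounded_dirichlet_def
  proof (intro conjI)
    show "\<exists>M. \<forall>s\<in>right_half_plane 0. norm (H (\<phi> s)) \<le> M"
      by (intro exI[of _ M] ballI M phi_img) (simp add: right_half_plane_def)
    show "\<exists>\<sigma>. \<forall>e>0. \<exists>P. dirichlet_polynomial P \<and> (\<forall>s. Re s > \<sigma> \<longrightarrow> norm (H (\<phi> s) - P s) \<le> e)"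
      by (intro exI[of _ "max \<sigma> x0"] allI impI approx)
  qed (rule hol)
qed

section \<open>The limit of a symbol at infinity\<close>

text \<open>This crude form of the triangle inequality is valid for all \<open>p > 0\<close>. Its constant affects neither
boundedness nor compactness, so it is used for \<open>p \<ge> 1\<close> as well.\<close>

lemma norm_add_powr_le:
  fixes a b :: "'a::real_normed_vector"
  assumes "p > 0"
  shows "norm (a + b) powr p \<le> 2 powr p * (norm a powr p + norm b powr p)"
proof -
  let ?m = "max (norm a) (norm b)"
  have "norm (a + b) powr p \<le> (2 * ?m) powr p"
    using assms norm_triangle_ineq[of a b] by (intro powr_mono2) auto
  also have "\<dots> = 2 powr p * ?m powr p"
    by (simp add: powr_mult)
  also have "?m powr p \<le> norm a powr p + norm b powr p"
    by (simp add: max_def)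
  finally show ?thesis
    by simp
qed

lemma dirichlet_polynomial_compose:
  assumes "\<phi> \<in> symbol_class_G0" "dirichlet_polynomial D"
  shows "bounded_dirichlet (\<lambda>s. D (\<phi> s))"
proof -
  obtain B where "\<And>s. Re s \<ge> 0 \<Longrightarrow> norm (D s) \<le> B"
    by (rule dirichlet_polynomial_bounded[OF assms(2)]) (rule that)
  then show ?thesis
    by (intro bounded_dirichlet_compose[OF assms(1), of UNIV D B])
      (auto intro: dirichlet_polynomial_holomorphic[OF assms(2)])
qed

lemma polynomial_norm_le:
  assumes "dirichlet_polynomial P" "p > 0" "mean_le (\<lambda>t. norm (P (\<i> * of_real t)) powr p) c"
  shows "polynomial_norm p P powr p \<le> c"
  by (rule mean_le_has_mean[OF assms(3) dirichlet_polynomial_has_mean[OF assms(1,2)]])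

lemma polynomial_norm_nonneg: "polynomial_norm p P \<ge> 0"
  by (simp add: polynomial_norm_def)

lemma mean_le_quasi_triangle:
  fixes u v :: "real \<Rightarrow> complex"
  assumes p: "p > 0" and u: "continuous_on UNIV u" and v: "continuous_on UNIV v"
    and "mean_le (\<lambda>t. norm (u t) powr p) a" "mean_le (\<lambda>t. norm (v t) powr p) b"
  shows "mean_le (\<lambda>t. norm (u t + v t) powr p) (2 powr p * (a + b))"
proof (rule mean_le_mono)
  show "mean_le (\<lambda>t. 2 powr p * (norm (u t) powr p + norm (v t) powr p)) (2 powr p * (a + b))"
    by (intro mean_le_cmult mean_le_add assms continuous_on_norm_powr) auto
qed (auto intro!: continuous_intros continuous_on_norm_powr u v p norm_add_powr_le)

lemma polynomial_norm_add:
  assumes p: "p > 0" and P: "dirichlet_polynomial P" and Q: "dirichlet_polynomial Q"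
  shows "polynomial_norm p (\<lambda>s. P s + Q s) powr p \<le>
    2 powr p * (polynomial_norm p P powr p + polynomial_norm p Q powr p)"
proof (rule polynomial_norm_le[OF dirichlet_polynomial_add[OF P Q] p])
  show "mean_le (\<lambda>t. norm (P (\<i> * of_real t) + Q (\<i> * of_real t)) powr p)
      (2 powr p * (polynomial_norm p P powr p + polynomial_norm p Q powr p))"
    by (rule mean_le_quasi_triangle[OF p dirichlet_polynomial_continuous[OF P] dirichlet_polynomial_continuous[OF Q]
        has_mean_imp_mean_le[OF dirichlet_polynomial_has_mean[OF P p] order_refl]
        has_mean_imp_mean_le[OF dirichlet_polynomial_has_mean[OF Q p] order_refl]])
qed

text \<open>A bounded Dirichlet series with values in the unit disc has mean \<open>l\<close>; if \<open>\<bar>l\<bar> = 1\<close>, the mean of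
\<open>\<bar>F - l\<bar>\<^sup>2\<close> vanishes, and the point estimate then forces \<open>F = l\<close>.\<close>

lemma unimodular_mean_imp_constant:
  assumes F: "bounded_dirichlet F" and l: "((\<lambda>x::real. F (of_real x)) \<longlongrightarrow> l) at_top"
    and F1: "\<And>s. Re s > 0 \<Longrightarrow> norm (F s) \<le> 1" and nl: "norm l = 1"
  shows "F 2 = l"
proof -
  note mean = bounded_dirichlet_mean[OF F l, of 1]
  have cont: "continuous_on UNIV (\<lambda>t. F (vline 1 t))"
    by (rule bounded_dirichlet_continuous[OF F]) simp
  have small: "mean_le (\<lambda>t. (norm (F (vline 1 t) - l))\<^sup>2) 0"
  proof -
    have "has_mean (\<lambda>t. 2 - 2 * Re (cnj l * F (vline 1 t))) (2 - 2 * Re (cnj l * l))"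
    proof (rule has_mean_diff[OF _ _ has_mean_const])
      have "has_mean (\<lambda>t. cnj l * F (vline 1 t)) (cnj l * l)"
        by (rule has_mean_cmult, rule mean) simp
      then have "has_mean (\<lambda>t. Re (cnj l * F (vline 1 t))) (Re (cnj l * l))"
        by (rule has_mean_Re[rotated]) (intro continuous_intros cont)
      then show "has_mean (\<lambda>t. 2 * Re (cnj l * F (vline 1 t))) (2 * Re (cnj l * l))"
        by (rule has_mean_cmult)
    qed (intro continuous_intros cont)+
    then have "mean_le (\<lambda>t. 2 - 2 * Re (cnj l * F (vline 1 t))) 0"
    proof (rule has_mean_imp_mean_le)
      have "cnj l * l = 1"
        using nl by (simp add: complex_norm_square[symmetric] mult.commute)
      then show "2 - 2 * Re (cnj l * l) \<le> 0" by simp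
    qed
    then show ?thesis
    proof (rule mean_le_mono)
      fix t
      let ?z = "F (vline 1 t)"
      have "(norm (?z - l))\<^sup>2 = (norm ?z)\<^sup>2 + (norm l)\<^sup>2 - 2 * Re (cnj l * ?z)"
        unfolding cmod_power2 by (simp add: power2_eq_square algebra_simps)
      moreover have "(norm ?z)\<^sup>2 \<le> 1"
        using F1[of "vline 1 t"] by (simp add: power_le_one)
      ultimately show "(norm (?z - l))\<^sup>2 \<le> 2 - 2 * Re (cnj l * ?z)"
        using nl by simp
    qed (intro continuous_intros cont | simp)+
  qed
  have "norm (F 2 - l) \<le> 5 * e" if e: "e > 0" for e
  proof -
    obtain P where P: "dirichlet_polynomial P" "\<And>s. Re s \<ge> 1 \<Longrightarrow> norm (F s - P s) \<le> e"
      by (rule bounded_dirichlet_uniform_approx[OF F zero_less_one e]) (rule that)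
    define Q where "Q s = P (s + 1) - l" for s
    have Q: "dirichlet_polynomial Q"
      unfolding Q_def by (rule dirichlet_polynomial_diff[OF dirichlet_polynomial_shift[OF P(1)] dirichlet_polynomial_const])
    have "mean_le (\<lambda>t. 2 * e\<^sup>2 + 2 * (norm (F (vline 1 t) - l))\<^sup>2) (2 * e\<^sup>2 + 2 * 0)"
      by (intro mean_le_add mean_le_cmult mean_le_const small continuous_intros cont) auto
    then have "mean_le (\<lambda>t. norm (Q (\<i> * of_real t)) powr 2) (2 * e\<^sup>2 + 2 * 0)"
    proof (rule mean_le_mono)
      show "continuous_on UNIV (\<lambda>t. norm (Q (\<i> * of_real t)) powr 2)"
        by (intro continuous_on_norm_powr dirichlet_polynomial_continuous Q) simp
      fix t
      let ?a = "norm (F (vline 1 t) - P (vline 1 t))"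
      let ?b = "norm (F (vline 1 t) - l)"
      have "norm (Q (\<i> * of_real t)) \<le> ?b + ?a"
        using norm_triangle_ineq4[of "F (vline 1 t) - l" "F (vline 1 t) - P (vline 1 t)"]
        by (simp add: Q_def add.commute)
      also have "\<dots> \<le> ?b + e"
        using P(2)[of "vline 1 t"] by simp
      finally have "(norm (Q (\<i> * of_real t)))\<^sup>2 \<le> (?b + e)\<^sup>2"
        by (intro power_mono) auto
      also have "\<dots> \<le> 2 * e\<^sup>2 + 2 * ?b\<^sup>2"
        using sum_squares_bound[of ?b e] by (simp add: power2_sum)
      finally show "norm (Q (\<i> * of_real t)) powr 2 \<le> 2 * e\<^sup>2 + 2 * ?b\<^sup>2"
        by simp
    qed (intro continuous_intros cont, simp)
    then have Q2: "polynomial_norm 2 Q powr 2 \<le> 2 * e\<^sup>2"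
      using polynomial_norm_le[OF Q, of 2] by simp
    have "norm (Q 1) powr 2 \<le> (1 + 1 / (2 * Re 1 - 1)) * polynomial_norm 2 Q powr 2"
      by (rule dirichlet_polynomial_point_estimate[OF Q]) auto
    also have "\<dots> \<le> (2 * e)\<^sup>2"
      using Q2 by (simp add: power2_eq_square)
    finally have "(norm (Q 1))\<^sup>2 \<le> (2 * e)\<^sup>2" by simp
    then have "norm (Q 1) \<le> 2 * e"
      by (rule power2_le_imp_le) (use e in simp)
    moreover have "norm (F 2 - P 2) \<le> e"
      by (rule P(2)) simp
    moreover have "Q 1 = P 2 - l"
      by (simp add: Q_def)
    ultimately show ?thesis
      using norm_triangle_ineq[of "F 2 - P 2" "P 2 - l"] e by simp
  qed
  then have "norm (F 2 - l) \<le> 0 + e" if "e > 0" for e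
    using that by (metis add_0 divide_pos_pos mult.commute nonzero_eq_divide_eq zero_less_numeral zero_neq_numeral)
  then have "norm (F 2 - l) \<le> 0"
    by (rule field_le_epsilon)
  then show ?thesis by simp
qed

text \<open>If the limit lay on the boundary line, \<open>exp (1/2 - \<phi>)\<close> would have a unimodular limit although its
values lie in the open unit disc.\<close>

theorem symbol_limit_in_half_plane:
  assumes phi: "\<phi> \<in> symbol_class_G0"
  shows "Re (symbol_limit \<phi>) > 1/2"
proof (rule ccontr)
  assume "\<not> ?thesis"
  let ?c = "symbol_limit \<phi>"
  note phi_img = symbol_Re_gt[OF phi]
  have "Re ?c \<ge> 1/2"
  proof (rule tendsto_lowerbound[OF tendsto_Re[OF symbol_tends_to_limit(2)[OF phi]]])
    show "eventually (\<lambda>x. 1/2 \<le> Re (\<phi> (of_real x))) at_top"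
      using eventually_gt_at_top[of 0] by eventually_elim (use phi_img in \<open>auto intro: less_imp_le\<close>)
  qed simp
  with \<open>\<not> ?thesis\<close> have Re_c: "Re ?c = 1/2" by simp
  define H where "H w = exp (1/2 - w)" for w :: complex
  have H1: "norm (H w) \<le> 1" if "Re w > 1/2" for w
    using that by (simp add: H_def norm_exp_eq_Re)
  have hol: "H holomorphic_on UNIV"
    unfolding H_def by (intro holomorphic_intros)
  note comp = bounded_dirichlet_compose[OF phi open_UNIV subset_UNIV UNIV_I hol H1]
  have "H (\<phi> 2) = H ?c"
  proof (rule unimodular_mean_imp_constant[OF comp])
    show "norm (H (\<phi> s)) \<le> 1" if "Re s > 0" for s
      by (rule H1[OF phi_img[OF that]])
    show "norm (H ?c) = 1"
      by (simp add: H_def norm_exp_eq_Re Re_c)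
  qed
  moreover have "norm (H ?c) = 1"
    by (simp add: H_def norm_exp_eq_Re Re_c)
  moreover have "norm (H (\<phi> 2)) < 1"
    using phi_img[of 2] by (simp add: H_def norm_exp_eq_Re)
  ultimately show False by simp
qed

section \<open>From Dirichlet polynomials to the Hardy space\<close>

text \<open>The symbol is defined on the open half-plane only, so the \<open>p\<close>-th mean of \<open>D \<circ> \<phi>\<close> is bounded
along every line \<open>Re s = d\<close> with \<open>d > 0\<close>, by one constant.\<close>

definition compose_mean_le :: "real \<Rightarrow> (complex \<Rightarrow> complex) \<Rightarrow> (complex \<Rightarrow> complex) \<Rightarrow> real \<Rightarrow> bool" where
  "compose_mean_le p \<phi> D c \<longleftrightarrow> (\<forall>d>0. mean_le (\<lambda>t. norm (D (\<phi> (vline d t))) powr p) c)"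

lemma compose_continuous:
  assumes "\<phi> \<in> symbol_class_G0" "dirichlet_polynomial D" "d > 0"
  shows "continuous_on UNIV (\<lambda>t. D (\<phi> (vline d t)))"
  by (rule bounded_dirichlet_continuous[OF dirichlet_polynomial_compose[OF assms(1,2)] assms(3)])

lemma compose_mean_le_mono:
  "compose_mean_le p \<phi> D c \<Longrightarrow> c \<le> c' \<Longrightarrow> compose_mean_le p \<phi> D c'"
  unfolding compose_mean_le_def mean_le_def
  by (smt (verit) eventually_mono)

lemma compose_mean_le_add:
  assumes "\<phi> \<in> symbol_class_G0" "p > 0" "dirichlet_polynomial D" "dirichlet_polynomial E"
    "compose_mean_le p \<phi> D a" "compose_mean_le p \<phi> E b"
  shows "compose_mean_le p \<phi> (\<lambda>s. D s + E s) (2 powr p * (a + b))"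
  unfolding compose_mean_le_def
proof (intro allI impI)
  fix d :: real assume d: "d > 0"
  show "mean_le (\<lambda>t. norm (D (\<phi> (vline d t)) + E (\<phi> (vline d t))) powr p) (2 powr p * (a + b))"
    by (rule mean_le_quasi_triangle[OF assms(2) compose_continuous[OF assms(1,3) d] compose_continuous[OF assms(1,4) d]])
      (use assms(5,6) d in \<open>auto simp: compose_mean_le_def\<close>)
qed

text \<open>The bounded series \<open>F\<close> belongs to the Hardy space: a Dirichlet polynomial close to a translate
\<open>F (\<cdot> + e)\<close> is close to \<open>F\<close> pointwise, and on the imaginary axis close in mean to \<open>F\<close> on all lines
near the axis.\<close>

lemma bounded_dirichlet_Lp_approx:
  assumes F: "bounded_dirichlet F" and p: "p > 0" and r: "r > 0"
  shows "\<exists>Q x. dirichlet_polynomial Q \<and> x > 0 \<and> (\<forall>s. Re s > 1/2 \<longrightarrow> norm (Q s - F s) \<le> r) \<and>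
    (\<forall>d. 0 < d \<and> d < x \<longrightarrow> mean_le (\<lambda>t. norm (Q (\<i> * of_real t) - F (vline d t)) powr p) r)"
proof -
  define r' where "r' = r / (2 * 2 powr p)"
  have r': "r' > 0" using r by (simp add: r'_def)
  have rr: "2 powr p * (r' + r') = r"
    by (simp add: r'_def)
  obtain M where M: "F holomorphic_on right_half_plane 0" "\<And>s. Re s > 0 \<Longrightarrow> norm (F s) \<le> M" "M \<ge> 0"
    by (rule bounded_dirichletE[OF F]) (rule that)
  obtain x where x: "x > 0" "\<And>d e. 0 < d \<Longrightarrow> d < x \<Longrightarrow> 0 < e \<Longrightarrow> e < x \<Longrightarrow>
    mean_le (\<lambda>t. norm (F (vline d t) - F (vline e t)) powr p) r'"
    by (rule bounded_dirichlet_Lp_Cauchy[OF F p r']) (rule that)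
  define e where "e = min (x / 2) (r / 2 / (4 * M + 1))"
  have "r / 2 / (4 * M + 1) > 0"
    using r M(3) by simp
  then have e: "e > 0" "e < x"
    using x(1) by (auto simp: e_def)
  have eM: "4 * M * e \<le> r / 2"
  proof -
    have "4 * M * e \<le> (4 * M + 1) * e" using e by simp
    also have "\<dots> \<le> (4 * M + 1) * (r / 2 / (4 * M + 1))"
      unfolding e_def using M(3) by (intro mult_left_mono) auto
    also have "\<dots> = r / 2"
    proof -
      have "D * (r / 2 / D) = r / 2" if "D > 0" for D
        using that by simp
      from this[of "4 * M + 1"] show ?thesis using M(3) by linarith
    qed
    finally show ?thesis .
  qed
  \<comment> \<open>The error \<open>h\<close> serves the pointwise bound and, raised to the power \<open>p\<close>, the mean.\<close>
  define h where "h = min (r / 2) (r' powr (1 / p))"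
  have h: "h > 0" "h powr p \<le> r'"
  proof -
    show "h > 0" using r r' by (simp add: h_def)
    have "h powr p \<le> (r' powr (1 / p)) powr p"
      using p \<open>h > 0\<close> by (intro powr_mono2) (auto simp: h_def)
    then show "h powr p \<le> r'"
      using p r' by (simp add: powr_powr)
  qed
  obtain P where P: "dirichlet_polynomial P" "\<And>s. Re s \<ge> e \<Longrightarrow> norm (F s - P s) \<le> h"
    by (rule bounded_dirichlet_uniform_approx[OF F e(1) h(1)]) (rule that)
  define Q where "Q s = P (s + of_real e)" for s
  have Q: "dirichlet_polynomial Q"
    unfolding Q_def by (rule dirichlet_polynomial_shift[OF P(1)])
  show ?thesis
  proof (rule exI[of _ Q], rule exI[of _ x], intro conjI allI impI Q x(1))
    fix s :: complex assume s: "Re s > 1/2"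
    have "norm (F s - F (s + of_real e)) \<le> 2 * M / (1/2) * norm (s - (s + of_real e))"
      by (rule half_plane_lipschitz[OF M(1)]) (use s e M(2) in \<open>auto simp: right_half_plane_def\<close>)
    also have "\<dots> = 4 * M * e"
      using e by simp
    finally have "norm (F s - F (s + of_real e)) \<le> r / 2"
      using eM by linarith
    moreover have "norm (F (s + of_real e) - P (s + of_real e)) \<le> r / 2"
      using P(2)[of "s + of_real e"] s e by (simp add: h_def)
    ultimately have "norm (F s - Q s) \<le> r"
      using norm_triangle_ineq[of "F s - F (s + of_real e)" "F (s + of_real e) - P (s + of_real e)"] by (simp add: Q_def)
    then show "norm (Q s - F s) \<le> r"
      by (simp add: norm_minus_commute)
  next
    fix d assume d: "0 < d \<and> d < x"
    have cQ: "continuous_on UNIV (\<lambda>t. Q (\<i> * of_real t) - F (vline e t))"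
      by (intro continuous_intros dirichlet_polynomial_continuous Q bounded_dirichlet_continuous F e)
    have cF: "continuous_on UNIV (\<lambda>t. F (vline e t) - F (vline d t))"
      using d by (intro continuous_intros bounded_dirichlet_continuous F e) auto
    have mQ: "mean_le (\<lambda>t. norm (Q (\<i> * of_real t) - F (vline e t)) powr p) r'"
    proof (rule mean_le_mono[OF mean_le_const[OF h(2)]])
      show "norm (Q (\<i> * of_real t) - F (vline e t)) powr p \<le> h powr p" for t
        using p P(2)[of "vline e t"]
        by (intro powr_mono2) (auto simp: Q_def norm_minus_commute add.commute)
    qed (auto intro!: continuous_on_norm_powr p cQ continuous_intros)
    have "mean_le (\<lambda>t. norm ((Q (\<i> * of_real t) - F (vline e t)) + (F (vline e t) - F (vline d t))) powr p) (2 powr p * (r' + r'))"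
      by (rule mean_le_quasi_triangle[OF p cQ cF mQ x(2)]) (use e d in auto)
    then show "mean_le (\<lambda>t. norm (Q (\<i> * of_real t) - F (vline d t)) powr p) r"
      unfolding rr by simp
  qed
qed

text \<open>A limit of norms along a subsequence already exhibits an element of the set in the definition of
\<open>hardy_norm\<close>. An upper bound for the infimum therefore follows from boundedness of
the norms alone.\<close>

lemma represents_bounded_subsequence:
  assumes Q: "represents p Q f" and b: "eventually (\<lambda>j. polynomial_norm p (Q j) \<le> B) sequentially"
  obtains l P where "0 \<le> l" "l \<le> B" "represents p P f" "(\<lambda>j. polynomial_norm p (P j)) \<longlonglongrightarrow> l"
proof -
  obtain N where N: "\<And>j. j \<ge> N \<Longrightarrow> polynomial_norm p (Q j) \<le> B"
    using b by (auto simp: eventually_sequentially)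
  have "seq_compact {0..B}"
    by (rule compact_imp_seq_compact) (rule compact_Icc)
  moreover have "\<forall>j. polynomial_norm p (Q (j + N)) \<in> {0..B}"
    using N polynomial_norm_nonneg by auto
  ultimately have "\<exists>l\<in>{0..B}. \<exists>r. strict_mono r \<and> ((\<lambda>j. polynomial_norm p (Q (j + N))) \<circ> r) \<longlonglongrightarrow> l"
    by (rule seq_compactE) auto
  then obtain l r where l: "l \<in> {0..B}" "strict_mono r" "((\<lambda>j. polynomial_norm p (Q (j + N))) \<circ> r) \<longlonglongrightarrow> l"
    by blast
  define s where "s j = r j + N" for j
  have s: "s j \<ge> j" for j
    using seq_suble[OF l(2), of j] by (simp add: s_def)
  have s_lim: "filterlim s at_top sequentially"
    unfolding filterlim_at_top eventually_sequentially using s order_trans by blast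
  have "represents p (\<lambda>j. Q (s j)) f"
    unfolding represents_def
  proof (intro conjI allI impI ballI)
    show "dirichlet_polynomial (Q (s j))" for j
      using Q by (simp add: represents_def)
    fix \<epsilon> :: real assume "\<epsilon> > 0"
    then obtain N' where "\<forall>i\<ge>N'. \<forall>j\<ge>N'. polynomial_norm p (\<lambda>z. Q i z - Q j z) < \<epsilon>"
      using Q unfolding represents_def by blast
    then show "\<exists>N. \<forall>i\<ge>N. \<forall>j\<ge>N. polynomial_norm p (\<lambda>z. Q (s i) z - Q (s j) z) < \<epsilon>"
      using s by (meson order_trans)
  next
    fix z assume "z \<in> right_half_plane (1/2)"
    then have "(\<lambda>j. Q j z) \<longlonglongrightarrow> f z"
      using Q unfolding represents_def by blast
    from filterlim_compose[OF this s_lim] show "(\<lambda>j. Q (s j) z) \<longlonglongrightarrow> f z" .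
  qed
  then show thesis
    using l by (intro that[of l "\<lambda>j. Q (s j)"]) (auto simp: s_def o_def)
qed

lemma hardy_norm_bdd_below:
  "bdd_below {L. \<exists>P. represents p P f \<and> (\<lambda>j. polynomial_norm p (P j)) \<longlonglongrightarrow> L}"
  by (auto intro!: bdd_belowI[of _ 0] LIMSEQ_le_const polynomial_norm_nonneg)

lemma hardy_norm_le:
  assumes Q: "represents p Q f" and b: "eventually (\<lambda>j. polynomial_norm p (Q j) \<le> B) sequentially"
  shows "hardy_norm p f \<le> B"
proof -
  obtain l P where l: "0 \<le> l" "l \<le> B" "represents p P f" "(\<lambda>j. polynomial_norm p (P j)) \<longlonglongrightarrow> l"
    by (rule represents_bounded_subsequence[OF Q b]) (rule that)
  then have "hardy_norm p f \<le> l"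
    unfolding hardy_norm_def by (intro cInf_lower hardy_norm_bdd_below) blast
  with l(2) show ?thesis by simp
qed

lemma powr_le_imp_le:
  assumes "(p::real) > 0" "x \<ge> 0" "x powr p \<le> c"
  shows "x \<le> c powr (1/p)"
proof -
  have "(x powr p) powr (1/p) \<le> c powr (1/p)"
    using assms by (intro powr_mono2) auto
  then show ?thesis
    using assms by (simp add: powr_powr)
qed

text \<open>The set in the definition of \<open>hardy_norm\<close> is nonempty, so its infimum is not a default value.\<close>

lemma hardy_norm_attained:
  assumes f: "f \<in> hardy_space p" and p: "p > 0"
  shows "\<exists>L P. represents p P f \<and> (\<lambda>j. polynomial_norm p (P j)) \<longlonglongrightarrow> L"
proof -
  obtain P where P: "represents p P f"
    using f by (auto simp: hardy_space_def)
  have Pd: "dirichlet_polynomial (P j)" for j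
    using P by (simp add: represents_def)
  from P obtain N where N: "\<And>i j. i \<ge> N \<Longrightarrow> j \<ge> N \<Longrightarrow> polynomial_norm p (\<lambda>s. P i s - P j s) < 1"
    unfolding represents_def using zero_less_one by metis
  define B where "B = (2 powr p * (1 + polynomial_norm p (P N) powr p)) powr (1/p)"
  have bound: "polynomial_norm p (P j) \<le> B" if "j \<ge> N" for j
  proof -
    have "polynomial_norm p (\<lambda>s. (P j s - P N s) + P N s) powr p \<le>
        2 powr p * (polynomial_norm p (\<lambda>s. P j s - P N s) powr p + polynomial_norm p (P N) powr p)"
      by (rule polynomial_norm_add[OF p dirichlet_polynomial_diff[OF Pd Pd] Pd])
    also have "\<dots> \<le> 2 powr p * (1 + polynomial_norm p (P N) powr p)"
      using N[OF that order_refl] p polynomial_norm_nonneg[of p "\<lambda>s. P j s - P N s"]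
        powr_mono2[of p "polynomial_norm p (\<lambda>s. P j s - P N s)" 1] by auto
    finally have "polynomial_norm p (P j) powr p \<le> 2 powr p * (1 + polynomial_norm p (P N) powr p)"
      by simp
    then show ?thesis
      unfolding B_def by (rule powr_le_imp_le[OF p polynomial_norm_nonneg])
  qed
  have "eventually (\<lambda>j. polynomial_norm p (P j) \<le> B) sequentially"
    using bound by (auto simp: eventually_sequentially)
  from represents_bounded_subsequence[OF P this] show ?thesis by metis
qed

lemma hardy_norm_nonneg:
  assumes "f \<in> hardy_space p" "p > 0"
  shows "hardy_norm p f \<ge> 0"
  unfolding hardy_norm_def
  by (rule cInf_greatest) (use hardy_norm_attained[OF assms] in \<open>auto intro!: LIMSEQ_le_const polynomial_norm_nonneg\<close>)

text \<open>A diagonal argument. Each \<open>D\<^sub>j \<circ> \<phi>\<close> is replaced by a Dirichlet polynomial \<open>Q\<^sub>j\<close> that is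
close to it pointwise and in mean, with error \<open>1 / (j + 1)\<close>; then \<open>Q\<close> represents \<open>f \<circ> \<phi>\<close>. The bound
in the second part is that of \<open>D\<^sub>j\<close> up to the constants of the triangle inequality.\<close>

theorem compose_represents:
  assumes phi: "\<phi> \<in> symbol_class_G0" and p: "p > 0"
    and D: "\<And>j. dirichlet_polynomial (D j)"
    and lim: "\<And>s. Re s > 1/2 \<Longrightarrow> (\<lambda>j. D j s) \<longlonglongrightarrow> f s"
    and Cauchy: "\<And>e. e > 0 \<Longrightarrow> \<exists>N. \<forall>i\<ge>N. \<forall>j\<ge>N. compose_mean_le p \<phi> (\<lambda>s. D i s - D j s) e"
  shows "(\<lambda>s. f (\<phi> s)) \<in> hardy_space p"
    and "\<And>L. L > 0 \<Longrightarrow> eventually (\<lambda>j. compose_mean_le p \<phi> (D j) L) sequentially \<Longrightarrow>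
      hardy_norm p (\<lambda>s. f (\<phi> s)) \<le> (2 powr p * (2 * L)) powr (1/p)"
proof -
  note phi_img = symbol_Re_gt[OF phi]
  define r where "r j = 1 / real (Suc j)" for j
  have r: "r j > 0" for j by (simp add: r_def)
  define F where "F j s = D j (\<phi> s)" for j s
  have F: "bounded_dirichlet (F j)" for j
    unfolding F_def by (rule dirichlet_polynomial_compose[OF phi D])
  define A where "A j Q x \<longleftrightarrow> dirichlet_polynomial Q \<and> x > 0 \<and> (\<forall>s. Re s > 1/2 \<longrightarrow> norm (Q s - F j s) \<le> r j) \<and>
    (\<forall>d. 0 < d \<and> d < x \<longrightarrow> mean_le (\<lambda>t. norm (Q (\<i> * of_real t) - F j (vline d t)) powr p) (r j))"
    for j Q and x :: real
  have "\<exists>Q x. A j Q x" for j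
    unfolding A_def by (rule bounded_dirichlet_Lp_approx[OF F p r])
  then obtain Q x where Ajx: "\<And>j. A j (Q j) (x j)" by metis
  have Q: "\<And>j. dirichlet_polynomial (Q j)" and x: "\<And>j. x j > (0::real)"
    and QF: "\<And>j s. Re s > 1/2 \<Longrightarrow> norm (Q j s - F j s) \<le> r j"
    and Qm: "\<And>j d. 0 < d \<Longrightarrow> d < x j \<Longrightarrow> mean_le (\<lambda>t. norm (Q j (\<i> * of_real t) - F j (vline d t)) powr p) (r j)"
    using Ajx unfolding A_def by blast+
  have cQ: "continuous_on UNIV (\<lambda>t. Q j (\<i> * of_real t))" for j
    by (rule dirichlet_polynomial_continuous[OF Q])
  have cF: "continuous_on UNIV (\<lambda>t. F j (vline d t))" if "d > 0" for d j
    by (rule bounded_dirichlet_continuous[OF F that])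
  have norm_diff: "polynomial_norm p (\<lambda>s. Q i s - Q j s) powr p \<le> 2 powr p * (r i + 2 powr p * (c + r j))"
    if c: "compose_mean_le p \<phi> (\<lambda>s. D i s - D j s) c" for i j c
  proof -
    define d where "d = min (x i) (x j) / 2"
    have d: "d > 0" "d < x i" "d < x j"
      using x[of i] x[of j] by (auto simp: d_def)
    let ?F = "\<lambda>j t. F j (vline d t)" and ?Q = "\<lambda>j t. Q j (\<i> * of_real t)"
    have 1: "mean_le (\<lambda>t. norm (?F i t - ?F j t) powr p) c"
      using c d(1) unfolding compose_mean_le_def F_def by blast
    have 2: "mean_le (\<lambda>t. norm (?F j t - ?Q j t) powr p) (r j)"
      using Qm[OF d(1,3)] by (simp add: norm_minus_commute)
    have 3: "mean_le (\<lambda>t. norm ((?F i t - ?F j t) + (?F j t - ?Q j t)) powr p) (2 powr p * (c + r j))"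
      by (rule mean_le_quasi_triangle[OF p _ _ 1 2]) (intro continuous_intros cF cQ d)+
    have "mean_le (\<lambda>t. norm ((?Q i t - ?F i t) + ((?F i t - ?F j t) + (?F j t - ?Q j t))) powr p) (2 powr p * (r i + 2 powr p * (c + r j)))"
      by (rule mean_le_quasi_triangle[OF p _ _ Qm[OF d(1,2)] 3]) (intro continuous_intros cF cQ d)+
    then have "mean_le (\<lambda>t. norm (?Q i t - ?Q j t) powr p) (2 powr p * (r i + 2 powr p * (c + r j)))"
      by simp
    then show ?thesis
      by (rule polynomial_norm_le[OF dirichlet_polynomial_diff[OF Q Q] p])
  qed
  have norm_Q: "polynomial_norm p (Q j) powr p \<le> 2 powr p * (r j + c)"
    if c: "compose_mean_le p \<phi> (D j) c" for j c
  proof -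
    define d where "d = x j / 2"
    have d: "d > 0" "d < x j"
      using x[of j] by (auto simp: d_def)
    let ?F = "\<lambda>j t. F j (vline d t)" and ?Q = "\<lambda>j t. Q j (\<i> * of_real t)"
    have 1: "mean_le (\<lambda>t. norm (?F j t) powr p) c"
      using c d(1) unfolding compose_mean_le_def F_def by blast
    have "mean_le (\<lambda>t. norm ((?Q j t - ?F j t) + ?F j t) powr p) (2 powr p * (r j + c))"
      by (rule mean_le_quasi_triangle[OF p _ _ Qm[OF d] 1]) (intro continuous_intros cF cQ d)+
    then have "mean_le (\<lambda>t. norm (?Q j t) powr p) (2 powr p * (r j + c))"
      by simp
    then show ?thesis
      by (rule polynomial_norm_le[OF Q p])
  qed
  have rep: "represents p Q (\<lambda>s. f (\<phi> s))"
    unfolding represents_def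
  proof (intro conjI allI impI ballI Q)
    fix \<epsilon> :: real assume e: "\<epsilon> > 0"
    define K where "K = (2::real) powr p"
    have K: "K \<ge> 1" using p by (simp add: K_def ge_one_powr_ge_zero)
    define c where "c = (\<epsilon> / 2) powr p / (3 * K * K)"
    have c: "c > 0" using e K by (simp add: c_def)
    obtain N1 where N1: "\<And>i j. i \<ge> N1 \<Longrightarrow> j \<ge> N1 \<Longrightarrow> compose_mean_le p \<phi> (\<lambda>s. D i s - D j s) c"
      using Cauchy[OF c] by blast
    obtain N2 where N2: "\<And>j. j \<ge> N2 \<Longrightarrow> r j < c"
      using one_over_Suc_less[OF c] unfolding r_def by blast
    have "polynomial_norm p (\<lambda>s. Q i s - Q j s) < \<epsilon>" if i: "i \<ge> max N1 N2" and j: "j \<ge> max N1 N2" for i j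
    proof -
      have "polynomial_norm p (\<lambda>s. Q i s - Q j s) powr p \<le> K * (r i + K * (c + r j))"
        unfolding K_def using i j by (intro norm_diff N1) auto
      also have "\<dots> \<le> K * (K * c + K * (c + c))"
      proof -
        have "r i \<le> K * c"
        proof -
          have "r i < c" using N2[of i] i by simp
          also have "c \<le> K * c" using mult_right_mono[OF K, of c] c by simp
          finally show ?thesis by simp
        qed
        then show ?thesis
          using N2[of j] j K by (intro mult_left_mono add_mono) auto
      qed
      also have "\<dots> = (\<epsilon> / 2) powr p"
        using K by (simp add: c_def field_simps)
      finally have "polynomial_norm p (\<lambda>s. Q i s - Q j s) \<le> ((\<epsilon> / 2) powr p) powr (1/p)"
        by (rule powr_le_imp_le[OF p polynomial_norm_nonneg])
      also have "\<dots> = \<epsilon> / 2"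
        using p e by (simp add: powr_powr)
      also have "\<dots> < \<epsilon>" using e by simp
      finally show ?thesis .
    qed
    then show "\<exists>N. \<forall>i\<ge>N. \<forall>j\<ge>N. polynomial_norm p (\<lambda>s. Q i s - Q j s) < \<epsilon>" by blast
  next
    fix s assume "s \<in> right_half_plane (1/2)"
    then have s: "Re s > 1/2" by (simp add: right_half_plane_def)
    then have "(\<lambda>j. F j s) \<longlonglongrightarrow> f (\<phi> s)"
      unfolding F_def by (intro lim phi_img) simp
    moreover have "(\<lambda>j. Q j s - F j s) \<longlonglongrightarrow> 0"
    proof (rule Lim_null_comparison)
      show "eventually (\<lambda>j. norm (Q j s - F j s) \<le> r j) sequentially"
        by (intro always_eventually allI QF s)
      show "r \<longlonglongrightarrow> 0"
        unfolding r_def by real_asymp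
    qed
    ultimately have "(\<lambda>j. (Q j s - F j s) + F j s) \<longlonglongrightarrow> 0 + f (\<phi> s)"
      by (intro tendsto_add)
    then show "(\<lambda>j. Q j s) \<longlonglongrightarrow> f (\<phi> s)" by simp
  qed
  then show "(\<lambda>s. f (\<phi> s)) \<in> hardy_space p"
    by (auto simp: hardy_space_def)
  fix L :: real assume L: "L > 0" "eventually (\<lambda>j. compose_mean_le p \<phi> (D j) L) sequentially"
  show "hardy_norm p (\<lambda>s. f (\<phi> s)) \<le> (2 powr p * (2 * L)) powr (1/p)"
  proof (rule hardy_norm_le[OF rep])
    have "eventually (\<lambda>j. r j < L) sequentially"
      unfolding eventually_sequentially using one_over_Suc_less[OF L(1)] by (simp only: r_def)
    with L(2) show "eventually (\<lambda>j. polynomial_norm p (Q j) \<le> (2 powr p * (2 * L)) powr (1/p)) sequentially"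
    proof eventually_elim
      case (elim j)
      have "polynomial_norm p (Q j) powr p \<le> 2 powr p * (r j + L)"
        by (rule norm_Q[OF elim(1)])
      also have "\<dots> \<le> 2 powr p * (2 * L)"
        using elim(2) by (intro mult_left_mono) auto
      finally show ?case
        by (rule powr_le_imp_le[OF p polynomial_norm_nonneg])
    qed
  qed
qed

lemma represents_compose_Cauchy:
  assumes p: "p > 0" and C: "C > 0"
    and est: "\<And>D. dirichlet_polynomial D \<Longrightarrow> compose_mean_le p \<phi> D (C * polynomial_norm p D powr p)"
    and D: "represents p D f" and e: "e > 0"
  shows "\<exists>N. \<forall>i\<ge>N. \<forall>j\<ge>N. compose_mean_le p \<phi> (\<lambda>s. D i s - D j s) e"
proof -
  have "(e / C) powr (1/p) > 0" using e C by simp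
  then obtain N where N: "\<And>i j. i \<ge> N \<Longrightarrow> j \<ge> N \<Longrightarrow> polynomial_norm p (\<lambda>s. D i s - D j s) < (e / C) powr (1/p)"
    using D unfolding represents_def by metis
  have "compose_mean_le p \<phi> (\<lambda>s. D i s - D j s) e" if "i \<ge> N" "j \<ge> N" for i j
  proof (rule compose_mean_le_mono[OF est])
    show "dirichlet_polynomial (\<lambda>s. D i s - D j s)"
      using D by (intro dirichlet_polynomial_diff) (auto simp: represents_def)
    have "polynomial_norm p (\<lambda>s. D i s - D j s) powr p \<le> ((e / C) powr (1/p)) powr p"
      using N[OF that] p by (intro powr_mono2) (auto simp: polynomial_norm_nonneg)
    also have "\<dots> = e / C"
      using e C p by (simp add: powr_powr)
    finally show "C * polynomial_norm p (\<lambda>s. D i s - D j s) powr p \<le> e"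
      using C by (simp add: field_simps)
  qed
  then show ?thesis by blast
qed

theorem bounded_on_hardy_from_polynomials:
  assumes phi: "\<phi> \<in> symbol_class_G0" and p: "p > 0" and C: "C > 0"
    and est: "\<And>D. dirichlet_polynomial D \<Longrightarrow> compose_mean_le p \<phi> D (C * polynomial_norm p D powr p)"
  shows "bounded_on_hardy p (composition_operator \<phi>)"
proof -
  have comp: "composition_operator \<phi> f = (\<lambda>s. f (\<phi> s))" for f
    by (simp add: composition_operator_def o_def)
  have Cauchy: "\<exists>N. \<forall>i\<ge>N. \<forall>j\<ge>N. compose_mean_le p \<phi> (\<lambda>s. D i s - D j s) e"
    if "represents p D f" "e > 0" for D f e
    by (rule represents_compose_Cauchy[OF p C est that])
  have repD: "dirichlet_polynomial (D j)" "Re s > 1/2 \<Longrightarrow> (\<lambda>j. D j s) \<longlonglongrightarrow> f s"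
    if "represents p D f" for D f j s
    using that unfolding represents_def right_half_plane_def by auto
  have inH: "composition_operator \<phi> f \<in> hardy_space p" if f: "f \<in> hardy_space p" for f
  proof -
    obtain D where D: "represents p D f"
      using f by (auto simp: hardy_space_def)
    show ?thesis
      unfolding comp by (rule compose_represents(1)[OF phi p repD(1)[OF D] repD(2)[OF D] Cauchy[OF D]])
  qed
  define K where "K = (2 powr p * (2 * C)) powr (1/p)"
  have K: "K > 0" using C by (simp add: K_def)
  have bound: "hardy_norm p (composition_operator \<phi> f) \<le> K * L"
    if D: "represents p D f" and L: "(\<lambda>j. polynomial_norm p (D j)) \<longlonglongrightarrow> L" for f D L
  proof -
    have L0: "L \<ge> 0"
      using L by (rule LIMSEQ_le_const) (auto intro: polynomial_norm_nonneg)
    have "hardy_norm p (composition_operator \<phi> f) \<le> K * (L + e)" if e: "e > 0" for e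
    proof -
      have "hardy_norm p (\<lambda>s. f (\<phi> s)) \<le> (2 powr p * (2 * (C * (L + e) powr p))) powr (1/p)"
      proof (rule compose_represents(2)[OF phi p repD(1)[OF D] repD(2)[OF D] Cauchy[OF D]])
        show "0 < C * (L + e) powr p" using C L0 e by simp
        have "eventually (\<lambda>j. polynomial_norm p (D j) < L + e) sequentially"
          using L e by (intro order_tendstoD(2)) auto
        then show "eventually (\<lambda>j. compose_mean_le p \<phi> (D j) (C * (L + e) powr p)) sequentially"
        proof eventually_elim
          case (elim j)
          show ?case
            by (rule compose_mean_le_mono[OF est[OF repD(1)[OF D]]])
              (use elim p C in \<open>auto intro!: mult_left_mono powr_mono2 simp: polynomial_norm_nonneg\<close>)
        qed
      qed
      also have "(2 powr p * (2 * (C * (L + e) powr p))) powr (1/p) = K * (L + e)"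
      proof -
        have "2 powr p * (2 * (C * (L + e) powr p)) = (2 powr p * (2 * C)) * (L + e) powr p"
          by simp
        then have "(2 powr p * (2 * (C * (L + e) powr p))) powr (1/p) = K * ((L + e) powr p) powr (1/p)"
          unfolding K_def by (simp only: powr_mult)
        then show ?thesis
          using p L0 e by (simp add: powr_powr)
      qed
      finally show ?thesis by (simp add: comp)
    qed
    then have "hardy_norm p (composition_operator \<phi> f) \<le> K * L + e" if "e > 0" for e
      using that K by (metis distrib_left divide_pos_pos nonzero_mult_div_cancel_left times_divide_eq_right less_irrefl)
    then show ?thesis
      by (rule field_le_epsilon)
  qed
  have "hardy_norm p (composition_operator \<phi> f) \<le> K * hardy_norm p f" if f: "f \<in> hardy_space p" for f
  proof -
    have "hardy_norm p (composition_operator \<phi> f) / K \<le> hardy_norm p f"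
      unfolding hardy_norm_def[of p f]
    proof (rule cInf_greatest)
      show "{L. \<exists>P. represents p P f \<and> (\<lambda>j. polynomial_norm p (P j)) \<longlonglongrightarrow> L} \<noteq> {}"
        using hardy_norm_attained[OF f p] by blast
      fix L assume "L \<in> {L. \<exists>P. represents p P f \<and> (\<lambda>j. polynomial_norm p (P j)) \<longlonglongrightarrow> L}"
      then obtain P where "represents p P f" "(\<lambda>j. polynomial_norm p (P j)) \<longlonglongrightarrow> L" by blast
      from bound[OF this] show "hardy_norm p (composition_operator \<phi> f) / K \<le> L"
        using K by (simp add: field_simps)
    qed
    then show ?thesis
      using K by (simp add: field_simps)
  qed
  with inH show ?thesis
    unfolding bounded_on_hardy_def by blast
qed

section \<open>An analytic majorant for even exponents\<close>

lemma powr_increment_lower: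
  assumes x: "0 < x" "x \<le> 1"
  shows "x * real (Suc N) powr (x - 1) \<le> real (Suc N) powr x - real N powr x"
proof (cases "N = 0")
  case True
  then show ?thesis using x by simp
next
  case False
  have "\<exists>z>real N. z < real (Suc N) \<and> real (Suc N) powr x - real N powr x = (real (Suc N) - real N) * (x * z powr (x - 1))"
    by (rule MVT2) (use False in \<open>auto intro!: derivative_eq_intros\<close>)
  then obtain z where z: "z > real N" "z < real (Suc N)" "real (Suc N) powr x - real N powr x = x * z powr (x - 1)"
    by auto
  have "real (Suc N) powr (x - 1) \<le> z powr (x - 1)"
    using z False x by (intro powr_mono2') auto
  then show ?thesis
    unfolding z(3) using x by (intro mult_left_mono) auto
qed

lemma powr_decrement_lower:
  assumes x: "0 < x" and N: "N \<ge> 1"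
  shows "x * real (Suc N) powr (- x - 1) \<le> real N powr (- x) - real (Suc N) powr (- x)"
proof -
  have "\<exists>z>real N. z < real (Suc N) \<and> real (Suc N) powr (- x) - real N powr (- x) = (real (Suc N) - real N) * (- x * z powr (- x - 1))"
    by (rule MVT2) (use N in \<open>auto intro!: derivative_eq_intros\<close>)
  then obtain z where z: "z > real N" "z < real (Suc N)" "real N powr (- x) - real (Suc N) powr (- x) = x * z powr (- x - 1)"
    by auto
  have "real (Suc N) powr (- x - 1) \<le> z powr (- x - 1)"
    using z N x by (intro powr_mono2') auto
  then show ?thesis
    unfolding z(3) using x by (intro mult_left_mono) auto
qed

text \<open>The kernel \<open>(min n m / max n m) powr x / sqrt (n m)\<close> is homogeneous of degree \<open>-1\<close>; these are
the row sums of Schur's test with weights \<open>sqrt n\<close>. They are compared with a telescoping sum on either side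
of \<open>m = n\<close>.\<close>

lemma schur_row_sum:
  assumes x: "0 < x" "x \<le> 1" and n: "n \<ge> 1"
  shows "(\<Sum>m=1..N. (real (min n m) / real (max n m)) powr x / real m) \<le> 2 / x"
proof -
  define G where "G N = (if N \<le> n then (real N / real n) powr x else 2 - (real n / real N) powr x)" for N
  have step: "x * ((real (min n (Suc N)) / real (max n (Suc N))) powr x / real (Suc N)) \<le> G (Suc N) - G N" for N
  proof (cases "Suc N \<le> n")
    case True
    then have eq: "G (Suc N) - G N = (real (Suc N) powr x - real N powr x) / real n powr x"
      by (simp add: G_def powr_divide diff_divide_distrib)
    have "x * ((real (min n (Suc N)) / real (max n (Suc N))) powr x / real (Suc N)) =
        x * real (Suc N) powr (x - 1) / real n powr x"
      using True by (simp add: min_def max_def powr_divide powr_diff del: of_nat_Suc)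
    also have "\<dots> \<le> (real (Suc N) powr x - real N powr x) / real n powr x"
      by (intro divide_right_mono powr_increment_lower x) simp
    finally show ?thesis unfolding eq .
  next
    case False
    then have N: "n \<le> N" by simp
    then have N1: "N \<ge> 1" using n by simp
    have GN: "G N = 2 - (real n / real N) powr x"
      using N N1 by (auto simp: G_def)
    have quot: "(real n / real k) powr x = real n powr x * real k powr (- x)" if "k \<ge> 1" for k
      using that by (simp add: powr_divide powr_minus_divide)
    have eq: "G (Suc N) - G N = real n powr x * (real N powr (- x) - real (Suc N) powr (- x))"
      unfolding GN using False N1 quot by (simp add: G_def algebra_simps del: of_nat_Suc)
    have "x * ((real (min n (Suc N)) / real (max n (Suc N))) powr x / real (Suc N)) =
        real n powr x * (x * real (Suc N) powr (- x - 1))"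
    proof -
      have "min n (Suc N) = n" "max n (Suc N) = Suc N" using False by auto
      moreover have "real (Suc N) powr (- x - 1) = real (Suc N) powr (- x) / real (Suc N)"
        by (simp add: powr_diff del: of_nat_Suc)
      ultimately show ?thesis
        using quot[of "Suc N"] by (simp only:) simp
    qed
    also have "\<dots> \<le> real n powr x * (real N powr (- x) - real (Suc N) powr (- x))"
      by (intro mult_left_mono powr_decrement_lower x N1) simp
    finally show ?thesis unfolding eq .
  qed
  have "x * (\<Sum>m=1..N. (real (min n m) / real (max n m)) powr x / real m) \<le> G N" for N
  proof (induction N)
    case 0
    then show ?case by (simp add: G_def)
  next
    case (Suc N)
    then show ?case
      using step[of N] by (simp add: distrib_left del: of_nat_Suc)
  qed
  moreover have "G N \<le> 2"
  proof (cases "N \<le> n")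
    case True
    then have "(real N / real n) powr x \<le> 1 powr x"
      using x n by (intro powr_mono2) auto
    then show ?thesis using True by (simp add: G_def)
  qed (simp add: G_def)
  ultimately have "x * (\<Sum>m=1..N. (real (min n m) / real (max n m)) powr x / real m) \<le> 2"
    by (meson order_trans)
  then show ?thesis
    using x by (simp add: field_simps)
qed

text \<open>Abel summation: \<open>min n m\<close> to the power \<open>X\<close> is the sum of the increments up to both \<open>n\<close> and \<open>m\<close>,
which exhibits the form as a sum of squares.\<close>

lemma min_kernel_sum:
  fixes c :: "nat \<Rightarrow> complex"
  assumes X: "X > 0"
  shows "(\<Sum>n=1..N. \<Sum>m=1..N. c n * cnj (c m) * of_real (real (min n m) powr X)) =
     of_real (\<Sum>l=1..N. (real l powr X - real (l - 1) powr X) * (norm (\<Sum>n=1..N. if l \<le> n then c n else 0))\<^sup>2)"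
proof -
  define \<delta> where "\<delta> l = real l powr X - real (l - 1) powr X" for l
  have tele: "(\<Sum>l=1..k. \<delta> l) = real k powr X" for k
    using X by (induction k) (simp_all add: \<delta>_def)
  have minX: "of_real (real (min n m) powr X) = (\<Sum>l=1..N. (if l \<le> n then 1 else 0) * (if l \<le> m then 1 else 0) * complex_of_real (\<delta> l))"
    if "n \<in> {1..N}" "m \<in> {1..N}" for n m
  proof -
    have "complex_of_real (real (min n m) powr X) = (\<Sum>l=1..min n m. of_real (\<delta> l))"
      unfolding tele[symmetric] by simp
    also have "\<dots> = (\<Sum>l=1..N. (if l \<le> n then 1 else 0) * (if l \<le> m then 1 else 0) * complex_of_real (\<delta> l))"
      using that by (intro sum.mono_neutral_cong_left) auto
    finally show ?thesis .
  qed
  have "(\<Sum>n=1..N. \<Sum>m=1..N. c n * cnj (c m) * of_real (real (min n m) powr X)) =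
    (\<Sum>n=1..N. \<Sum>m=1..N. \<Sum>l=1..N. of_real (\<delta> l) * ((if l \<le> n then c n else 0) * cnj (if l \<le> m then c m else 0)))"
    by (intro sum.cong refl, subst minX) (auto simp: sum_distrib_left intro!: sum.cong)
  also have "\<dots> = (\<Sum>n=1..N. \<Sum>l=1..N. \<Sum>m=1..N. of_real (\<delta> l) * ((if l \<le> n then c n else 0) * cnj (if l \<le> m then c m else 0)))"
    by (intro sum.cong refl sum.swap)
  also have "\<dots> = (\<Sum>l=1..N. \<Sum>n=1..N. \<Sum>m=1..N. of_real (\<delta> l) * ((if l \<le> n then c n else 0) * cnj (if l \<le> m then c m else 0)))"
    by (rule sum.swap)
  also have "\<dots> = (\<Sum>l=1..N. of_real (\<delta> l) * ((\<Sum>n=1..N. if l \<le> n then c n else 0) * cnj (\<Sum>n=1..N. if l \<le> n then c n else 0)))"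
    unfolding cnj_sum sum_product by (simp only: sum_distrib_left)
  also have "\<dots> = of_real (\<Sum>l=1..N. \<delta> l * (norm (\<Sum>n=1..N. if l \<le> n then c n else 0))\<^sup>2)"
    by (simp only: complex_norm_square[symmetric] of_real_mult[symmetric] of_real_sum[symmetric])
  finally show ?thesis
    by (simp only: \<delta>_def)
qed

text \<open>Let \<open>P s = \<Sum> a\<^sub>n n powr (- s)\<close>. On the line \<open>Re s = 1/2\<close> one has \<open>cnj s = 1 - s\<close>, so that
\<open>\<bar>P s\<bar>\<^sup>2 = \<Sum> a\<^sub>n cnj a\<^sub>m m\<^sup>-\<^sup>1 (m / n) powr s\<close>.
The terms with \<open>n < m\<close> grow in the half-plane; they are replaced by the conjugates of those with \<open>n > m\<close>,
which have the same real part on the line.\<close>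

definition analytic_majorant :: "(nat \<Rightarrow> complex) \<Rightarrow> nat \<Rightarrow> complex \<Rightarrow> complex" where
  "analytic_majorant a N s = (\<Sum>n=1..N. \<Sum>m=1..N. (if m < n then 2 else if m = n then 1 else 0) *
     (a n * cnj (a m) / of_nat m * exp (- (s * of_real (ln (real n) - ln (real m))))))"

text \<open>Pairing \<open>(n, m)\<close> with \<open>(m, n)\<close> turns the triangular sum into a symmetric one.\<close>

lemma Re_analytic_majorant:
  assumes s: "X = 2 * Re s - 1"
  shows "Re (analytic_majorant a N s) = Re (\<Sum>n=1..N. \<Sum>m=1..N. (a n * npow n s) *
      cnj (a m * npow m s) * of_real (real (min n m) powr X))"
proof -
  define c where "c n = a n * npow n s" for n
  define t where "t n m = c n * cnj (c m) * of_real (real (min n m) powr X)" for n m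
  define u where "u n m = (if m < n then 2 else if m = n then 1 else 0) *
     (a n * cnj (a m) / of_nat m * exp (- (s * of_real (ln (real n) - ln (real m)))))" for n m
  have tu: "t n m = a n * cnj (a m) / of_nat m * exp (- (s * of_real (ln (real n) - ln (real m))))"
    if "m \<le> n" "m \<ge> 1" for n m
  proof -
    let ?L = "complex_of_real (ln (real n))" and ?K = "complex_of_real (ln (real m))"
    have m: "real m powr X = exp ((2 * Re s - 1) * ln (real m))"
      using that s by (simp add: powr_def)
    have ss: "complex_of_real (2 * Re s - 1) = s + cnj s - 1"
      by (simp add: complex_add_cnj)
    have inv: "exp (- ?K) = 1 / of_nat m"
      using that by (simp add: exp_minus exp_of_real inverse_eq_divide)
    have "t n m = a n * cnj (a m) * (exp (- (s * ?L)) * cnj (exp (- (s * ?K))) * exp ((s + cnj s - 1) * ?K))"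
      using that unfolding t_def c_def ss[symmetric] of_real_mult[symmetric]
      by (simp add: m exp_of_real[symmetric] min_absorb2 mult_ac del: of_real_mult)
    also have "exp (- (s * ?L)) * cnj (exp (- (s * ?K))) * exp ((s + cnj s - 1) * ?K) = exp (- (s * (?L - ?K))) * exp (- ?K)"
      unfolding exp_cnj exp_add[symmetric] by (simp add: algebra_simps)
    finally show ?thesis
      unfolding inv by simp
  qed
  have sym: "Re (t n m) = Re (t m n)" for n m
    by (simp add: t_def min.commute algebra_simps)
  have pair: "Re (u n m) + Re (u m n) = 2 * Re (t n m)" if "n \<in> {1..N}" "m \<in> {1..N}" for n m
  proof (cases n m rule: linorder_cases)
    case less
    then have "u n m = 0" "u m n = 2 * t m n"
      using that tu[of n m] by (auto simp: u_def)
    then show ?thesis using sym[of n m] by simp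
  next
    case equal
    then have "u n m = t n m" "u m n = t n m"
      using that tu[of n m] by (auto simp: u_def)
    then show ?thesis by simp
  next
    case greater
    then have "u m n = 0" "u n m = 2 * t n m"
      using that tu[of m n] by (auto simp: u_def)
    then show ?thesis by simp
  qed
  have "2 * (\<Sum>n=1..N. \<Sum>m=1..N. Re (u n m)) = (\<Sum>n=1..N. \<Sum>m=1..N. Re (u n m)) + (\<Sum>n=1..N. \<Sum>m=1..N. Re (u m n))"
    using sum.swap[of "\<lambda>n m. Re (u n m)" "{1..N}" "{1..N}"] by simp
  also have "\<dots> = (\<Sum>n=1..N. \<Sum>m=1..N. 2 * Re (t n m))"
    unfolding sum.distrib[symmetric] by (intro sum.cong refl pair)
  finally have "(\<Sum>n=1..N. \<Sum>m=1..N. Re (u n m)) = (\<Sum>n=1..N. \<Sum>m=1..N. Re (t n m))"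
    by (simp add: sum_distrib_left[symmetric])
  then show ?thesis
    unfolding analytic_majorant_def u_def[symmetric] c_def[symmetric] t_def[symmetric] by (simp add: Re_sum)
qed

text \<open>By \<open>min_kernel_sum\<close> the right-hand side is a sum of squares with nonnegative weights, and the square
for \<open>l = 1\<close>, whose weight is \<open>1\<close>, is the left-hand side.\<close>

lemma analytic_majorant_ge_square:
  assumes s: "Re s > 1/2"
  shows "(norm (\<Sum>n=1..N. a n * npow n s))\<^sup>2 \<le> Re (analytic_majorant a N s)"
proof -
  define X where "X = 2 * Re s - 1"
  have X: "X > 0" using s by (simp add: X_def)
  define c where "c n = a n * npow n s" for n
  let ?f = "\<lambda>l. (real l powr X - real (l - 1) powr X) * (norm (\<Sum>n=1..N. if l \<le> n then c n else 0))\<^sup>2"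
  have eq: "Re (analytic_majorant a N s) = (\<Sum>l=1..N. ?f l)"
    unfolding Re_analytic_majorant[OF X_def] c_def[symmetric] min_kernel_sum[OF X] by simp
  show ?thesis
  proof (cases "N = 0")
    case True
    then show ?thesis by (simp add: analytic_majorant_def)
  next
    case False
    have "(norm (\<Sum>n=1..N. c n))\<^sup>2 = ?f 1"
      using X by (auto intro!: arg_cong[where f = "\<lambda>z. (norm z)\<^sup>2"] sum.cong)
    also have "\<dots> \<le> (\<Sum>l=1..N. ?f l)"
      using False X by (intro member_le_sum) (auto intro!: mult_nonneg_nonneg powr_mono2)
    finally show ?thesis
      unfolding eq c_def .
  qed
qed

lemma powr_min_max_identity:
  fixes a b \<sigma> :: real
  assumes "a > 0" "b > 0"
  shows "a powr (- \<sigma>) * b powr (- \<sigma>) * a powr (2 * \<sigma> - 1) = (a / b) powr (\<sigma> - 1/2) * (a powr (-1/2) * b powr (-1/2))"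
proof -
  have "- \<sigma> * ln a + - \<sigma> * ln b + (2 * \<sigma> - 1) * ln a = (\<sigma> - 1/2) * ln (a / b) + (-1/2 * ln a + -1/2 * ln b)"
    using assms by (simp add: ln_div field_simps)
  then have "exp (- \<sigma> * ln a + - \<sigma> * ln b + (2 * \<sigma> - 1) * ln a) = exp ((\<sigma> - 1/2) * ln (a / b) + (-1/2 * ln a + -1/2 * ln b))"
    by (rule arg_cong)
  then show ?thesis
    using assms unfolding exp_add powr_def by simp
qed

lemma Re_analytic_majorant_le:
  assumes s: "Re s > 1/2"
  shows "Re (analytic_majorant a N s) \<le> 2 / min 1 (Re s - 1/2) * (\<Sum>n=1..N. (norm (a n))\<^sup>2)"
proof -
  define x where "x = min 1 (Re s - 1/2)"
  have x: "0 < x" "x \<le> 1" "x \<le> Re s - 1/2" using s by (auto simp: x_def)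
  define X where "X = 2 * Re s - 1"
  define \<kappa> where "\<kappa> n m = (real (min n m) / real (max n m)) powr x" for n m
  have k_sym: "\<kappa> n m = \<kappa> m n" for n m by (simp add: \<kappa>_def min.commute max.commute)
  define A where "A n = norm (a n)" for n
  let ?t = "\<lambda>n m. (a n * npow n s) *
      cnj (a m * npow m s) * of_real (real (min n m) powr X)"
  have t_le: "Re (?t n m) \<le> (A n)\<^sup>2 * (\<kappa> n m / real m) / 2 + (A m)\<^sup>2 * (\<kappa> m n / real n) / 2"
    if "n \<in> {1..N}" "m \<in> {1..N}" for n m
  proof -
    have nm: "real n > 0" "real m > 0" using that by auto
    define r where "r = real (min n m) / real (max n m)"
    have r: "0 < r" "r \<le> 1" using that by (auto simp: r_def)
    have "norm (?t n m) = A n * A m * (real n powr (- Re s) * real m powr (- Re s) * real (min n m) powr X)"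
      using nm by (simp add: norm_mult norm_exp_eq_Re A_def powr_def)
    also have "real n powr (- Re s) * real m powr (- Re s) = real (min n m) powr (- Re s) * real (max n m) powr (- Re s)"
      by (simp add: min_def max_def)
    also have "\<dots> * real (min n m) powr X = r powr (Re s - 1/2) * (real (min n m) powr (-1/2) * real (max n m) powr (-1/2))"
      unfolding r_def X_def by (rule powr_min_max_identity) (use that in auto)
    also have "real (min n m) powr (-1/2) * real (max n m) powr (-1/2) = real n powr (-1/2) * real m powr (-1/2)"
      by (simp add: min_def max_def)
    finally have n1: "norm (?t n m) = A n * A m * (r powr (Re s - 1/2) * (real n powr (-1/2) * real m powr (-1/2)))" .
    have "r powr (Re s - 1/2) \<le> \<kappa> n m"
      unfolding \<kappa>_def r_def[symmetric] using r x by (intro powr_mono') auto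
    then have "norm (?t n m) \<le> A n * A m * (\<kappa> n m * (real n powr (-1/2) * real m powr (-1/2)))"
      unfolding n1 by (intro mult_left_mono mult_right_mono) (auto simp: A_def)
    also have "\<dots> = \<kappa> n m * ((A n * real m powr (-1/2)) * (A m * real n powr (-1/2)))"
      by (simp only: mult_ac)
    also have "\<dots> \<le> \<kappa> n m * (((A n * real m powr (-1/2))\<^sup>2 + (A m * real n powr (-1/2))\<^sup>2) / 2)"
      using sum_squares_bound[of "A n * real m powr (-1/2)" "A m * real n powr (-1/2)"]
      by (intro mult_left_mono) (auto simp: \<kappa>_def)
    also have "\<dots> = (A n)\<^sup>2 * (\<kappa> n m / real m) / 2 + (A m)\<^sup>2 * (\<kappa> m n / real n) / 2"
    proof -
      have "(real k powr (-1/2))\<^sup>2 = 1 / real k" if "real k > 0" for k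
        using that by (simp add: power2_eq_square powr_add[symmetric] powr_minus_divide)
      note sq = this
      show ?thesis
        unfolding power_mult_distrib sq[OF nm(1)] sq[OF nm(2)] k_sym[of m n]
        using nm by (simp add: field_simps)
    qed
    finally show ?thesis
      using complex_Re_le_cmod[of "?t n m"] by linarith
  qed
  have "Re (analytic_majorant a N s) = (\<Sum>n=1..N. \<Sum>m=1..N. Re (?t n m))"
    unfolding Re_analytic_majorant[OF X_def] by (simp only: Re_sum)
  also have "\<dots> \<le> (\<Sum>n=1..N. \<Sum>m=1..N. (A n)\<^sup>2 * (\<kappa> n m / real m) / 2 + (A m)\<^sup>2 * (\<kappa> m n / real n) / 2)"
    by (intro sum_mono t_le)
  also have "\<dots> = (\<Sum>n=1..N. \<Sum>m=1..N. (A n)\<^sup>2 * (\<kappa> n m / real m) / 2) + (\<Sum>n=1..N. \<Sum>m=1..N. (A n)\<^sup>2 * (\<kappa> n m / real m) / 2)"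
    unfolding sum.distrib using sum.swap[of "\<lambda>n m. (A n)\<^sup>2 * (\<kappa> n m / real m) / 2" "{1..N}" "{1..N}"] by simp
  also have "\<dots> = (\<Sum>n=1..N. (A n)\<^sup>2 * (\<Sum>m=1..N. \<kappa> n m / real m))"
    by (simp add: sum_divide_distrib[symmetric] sum_distrib_left)
  also have "\<dots> \<le> (\<Sum>n=1..N. (A n)\<^sup>2 * (2 / x))"
    unfolding \<kappa>_def by (intro sum_mono mult_left_mono schur_row_sum x) auto
  also have "\<dots> = 2 / x * (\<Sum>n=1..N. (A n)\<^sup>2)"
    by (simp add: sum_distrib_left mult.commute)
  finally show ?thesis
    by (simp add: x_def A_def)
qed

lemma analytic_majorant_holomorphic: "analytic_majorant a N holomorphic_on S"
  unfolding analytic_majorant_def by (intro holomorphic_intros) auto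

lemma analytic_majorant_bounded:
  assumes "Re s > 0"
  shows "norm (analytic_majorant a N s) \<le> (\<Sum>n=1..N. \<Sum>m=1..N. 2 * (norm (a n) * norm (a m)))"
  unfolding analytic_majorant_def
proof (intro sum_norm_le)
  fix n m assume n: "n \<in> {1..N}" and m: "m \<in> {1..N}"
  show "norm ((if m < n then 2 else if m = n then 1 else 0) *
     (a n * cnj (a m) / of_nat m * exp (- (s * of_real (ln (real n) - ln (real m)))))) \<le> 2 * (norm (a n) * norm (a m))"
  proof (cases "m \<le> n")
    case True
    have "norm (exp (- (s * of_real (ln (real n) - ln (real m))))) \<le> 1"
      using True m assms by (simp add: norm_exp_eq_Re)
    then have "norm (a n * cnj (a m) / of_nat m * exp (- (s * of_real (ln (real n) - ln (real m))))) \<le> norm (a n) * norm (a m) / 1 * 1"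
      unfolding norm_mult norm_divide using m by (intro mult_mono divide_left_mono frac_le) auto
    moreover have "norm (if m < n then 2 else if m = n then 1 else 0 :: complex) \<le> 2" by simp
    ultimately show ?thesis
      unfolding norm_mult[of "if m < n then 2 else if m = n then 1 else 0"] by (intro mult_mono) auto
  qed simp
qed

lemma dirichlet_polynomial_parseval:
  assumes P: "\<And>s. P s = (\<Sum>n = 1..N. a n * npow n s)"
  shows "polynomial_norm 2 P powr 2 = (\<Sum>n=1..N. (norm (a n))\<^sup>2)"
proof -
  have Pd: "dirichlet_polynomial P"
    by (rule dirichlet_polynomial_exp_formI[OF P])
  have "has_mean (\<lambda>t. P (vline 0 t) * cnj (P (vline 0 t)))
      (of_real (\<Sum>n=1..N. (norm (a n))\<^sup>2 * exp (- ((0 + 0) * ln (real n)))))"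
    by (rule dirichlet_inner_mean[OF P])
  from has_mean_Re[OF _ this]
  have "has_mean (\<lambda>t. Re (P (vline 0 t) * cnj (P (vline 0 t)))) (\<Sum>n=1..N. (norm (a n))\<^sup>2)"
    by (simp add: dirichlet_polynomial_continuous[OF Pd] continuous_intros)
  moreover have "(\<lambda>t. Re (P (vline 0 t) * cnj (P (vline 0 t)))) = (\<lambda>t. norm (P (\<i> * of_real t)) powr 2)"
    by (simp add: complex_norm_square[symmetric] del: complex_cnj_mult)
  ultimately show ?thesis
    using has_mean_unique[OF dirichlet_polynomial_has_mean[OF Pd]] by fastforce
qed

lemma compose_mean_le_L2:
  assumes phi: "\<phi> \<in> symbol_class_G0" and P: "dirichlet_polynomial P"
  shows "compose_mean_le 2 \<phi> P (2 / min 1 (Re (symbol_limit \<phi>) - 1/2) * polynomial_norm 2 P powr 2)"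
  unfolding compose_mean_le_def
proof (intro allI impI)
  fix d :: real assume d: "d > 0"
  let ?c = "symbol_limit \<phi>"
  note phi_img = symbol_Re_gt[OF phi]
  obtain a N where Na: "\<And>s. P s = (\<Sum>n = 1..N. a n * npow n s)"
    by (rule dirichlet_polynomial_exp_form[OF P]) (rule that)
  have bd: "norm (analytic_majorant a N w) \<le> (\<Sum>n=1..N. \<Sum>m=1..N. 2 * (norm (a n) * norm (a m)))" if "Re w > 1/2" for w
    by (rule analytic_majorant_bounded) (use that in simp)
  note comp = bounded_dirichlet_compose[OF phi open_UNIV subset_UNIV UNIV_I analytic_majorant_holomorphic bd]
  have cont: "continuous_on UNIV (\<lambda>t. analytic_majorant a N (\<phi> (vline d t)))"
    by (rule bounded_dirichlet_continuous[OF comp(1) d])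
  have "has_mean (\<lambda>t. Re (analytic_majorant a N (\<phi> (vline d t)))) (Re (analytic_majorant a N ?c))"
    by (rule has_mean_Re[OF cont bounded_dirichlet_mean[OF comp d]])
  then have "mean_le (\<lambda>t. Re (analytic_majorant a N (\<phi> (vline d t)))) (2 / min 1 (Re ?c - 1/2) * polynomial_norm 2 P powr 2)"
    unfolding dirichlet_polynomial_parseval[OF Na]
    by (rule has_mean_imp_mean_le[OF _ Re_analytic_majorant_le[OF symbol_limit_in_half_plane[OF phi]]])
  then show "mean_le (\<lambda>t. norm (P (\<phi> (vline d t))) powr 2) (2 / min 1 (Re ?c - 1/2) * polynomial_norm 2 P powr 2)"
  proof (rule mean_le_mono)
    show "continuous_on UNIV (\<lambda>t. norm (P (\<phi> (vline d t))) powr 2)"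
      by (intro continuous_on_norm_powr compose_continuous[OF phi P d]) simp
    show "continuous_on UNIV (\<lambda>t. Re (analytic_majorant a N (\<phi> (vline d t))))"
      by (intro continuous_intros cont)
    show "norm (P (\<phi> (vline d t))) powr 2 \<le> Re (analytic_majorant a N (\<phi> (vline d t)))" for t
      using analytic_majorant_ge_square[of "\<phi> (vline d t)" a N] phi_img[of "vline d t"] d
      by (simp add: Na)
  qed simp
qed

text \<open>The \<open>k\<close>-th power of a Dirichlet polynomial is a Dirichlet polynomial, and its mean square is the mean
of order \<open>2k\<close>.\<close>

theorem compose_mean_le_even:
  assumes phi: "\<phi> \<in> symbol_class_G0" and k: "k \<ge> 1" and D: "dirichlet_polynomial D"
  shows "compose_mean_le (2 * real k) \<phi> D (2 / min 1 (Re (symbol_limit \<phi>) - 1/2) * polynomial_norm (2 * real k) D powr (2 * real k))"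
proof -
  have pw: "norm (z ^ k) powr 2 = norm z powr (2 * real k)" for z :: complex
  proof (cases "z = 0")
    case False
    then show ?thesis
      by (simp add: norm_power powr_realpow[symmetric] powr_powr mult.commute)
  qed (use k in simp)
  have Dk: "dirichlet_polynomial (\<lambda>s. D s ^ k)"
    by (rule dirichlet_polynomial_power[OF D])
  have "polynomial_norm 2 (\<lambda>s. D s ^ k) powr 2 = polynomial_norm (2 * real k) D powr (2 * real k)"
    by (rule has_mean_unique[OF dirichlet_polynomial_has_mean[OF Dk]])
      (use dirichlet_polynomial_has_mean[OF D, of "2 * real k"] k in \<open>simp_all add: pw\<close>)
  then show ?thesis
    using compose_mean_le_L2[OF phi Dk] by (simp add: compose_mean_le_def pw)
qed

section \<open>Sectors of opening less than a half-plane\<close>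

text \<open>The inequality \<open>Re z \<ge> cos \<alpha> * \<bar>z\<bar>\<close> describes the closed sector without reference to the argument;
in this form stability under sums and inverses is immediate.\<close>

lemma cone_Re_ge:
  assumes "\<bar>Arg z\<bar> < \<alpha>" "\<alpha> < pi"
  shows "Re z \<ge> cos \<alpha> * norm z"
proof (cases "z = 0")
  case False
  have "cos \<alpha> \<le> cos \<bar>Arg z\<bar>"
    by (rule cos_monotone_0_pi_le) (use assms in auto)
  then have "cos \<alpha> * norm z \<le> cos (Arg z) * norm z"
    by (intro mult_right_mono) auto
  also have "\<dots> = Re z"
    using False by (simp add: cos_Arg)
  finally show ?thesis .
qed simp

lemma cone_Arg_le:
  assumes "z \<noteq> 0" "Re z \<ge> cos \<alpha> * norm z" "0 \<le> \<alpha>" "\<alpha> \<le> pi"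
  shows "\<bar>Arg z\<bar> \<le> \<alpha>"
proof -
  have "cos \<bar>Arg z\<bar> \<ge> cos \<alpha>"
    using assms by (simp add: cos_Arg field_simps)
  then show ?thesis
    using Arg_bounded[of z] assms by (subst (asm) cos_mono_le_eq) auto
qed

lemma cone_add_real:
  assumes "Re z \<ge> c * norm z" "0 \<le> c" "c \<le> 1" "\<delta> \<ge> 0"
  shows "Re (z + of_real \<delta>) \<ge> c * norm (z + of_real \<delta>)"
proof -
  have "c * norm (z + of_real \<delta>) \<le> c * (norm z + \<delta>)"
    using norm_triangle_ineq[of z "of_real \<delta>"] assms by (intro mult_left_mono) auto
  also have "\<dots> \<le> Re z + \<delta>"
    using assms mult_left_le_one_le[of \<delta> c] by (simp add: distrib_left)
  finally show ?thesis by simp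
qed

lemma cone_inverse:
  assumes "Re z \<ge> c * norm z"
  shows "Re (inverse z) \<ge> c * norm (inverse z)"
proof (cases "z = 0")
  case False
  have "Re (inverse z) = Re z / (norm z)\<^sup>2"
    by (simp add: cmod_power2)
  also have "\<dots> \<ge> (c * norm z) / (norm z)\<^sup>2"
    using assms by (intro divide_right_mono) auto
  also have "(c * norm z) / (norm z)\<^sup>2 = c * norm (inverse z)"
    using False by (simp add: norm_inverse power2_eq_square divide_inverse)
  finally show ?thesis .
qed simp

text \<open>Multiplying the argument by \<open>\<beta>\<close> keeps it below \<open>\<beta>\<alpha>\<close>, so the power again stays in a sector.\<close>

lemma cone_powr:
  assumes z: "z \<noteq> 0" "Re z \<ge> cos \<alpha> * norm z" and \<alpha>: "0 \<le> \<alpha>" "\<alpha> \<le> pi" and \<beta>: "\<beta> \<ge> 0" "\<beta> * \<alpha> \<le> pi"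
  shows "Re (z powr (- of_real \<beta>)) \<ge> cos (\<beta> * \<alpha>) * norm z powr (- \<beta>)"
proof -
  have "Re (z powr (- of_real \<beta>)) = norm z powr (- \<beta>) * cos (\<beta> * Arg z)"
    using z(1) by (simp add: powr_def Re_exp Arg_eq_Im_Ln)
  moreover have "cos (\<beta> * \<alpha>) \<le> cos \<bar>\<beta> * Arg z\<bar>"
  proof (rule cos_monotone_0_pi_le)
    show "\<bar>\<beta> * Arg z\<bar> \<le> \<beta> * \<alpha>"
      using cone_Arg_le[OF z \<alpha>] \<beta>(1) by (simp add: abs_mult mult_left_mono)
  qed (use \<beta> in auto)
  ultimately show ?thesis
    by (simp add: mult.commute[of "norm z powr (- \<beta>)"] mult_right_mono)
qed

lemma point_bound_on_compact:
  assumes L: "compact L" "L \<subseteq> right_half_plane (1/2)" and q: "q > 0"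
  obtains K where "K > 0" "\<And>D s. dirichlet_polynomial D \<Longrightarrow> s \<in> L \<Longrightarrow> norm (D s) powr q \<le> K * polynomial_norm q D powr q"
proof -
  have "\<exists>x>0. \<forall>s\<in>L. Re s \<ge> 1/2 + x"
  proof (cases "L = {}")
    case False
    obtain s0 where s0: "s0 \<in> L" "\<And>s. s \<in> L \<Longrightarrow> Re s0 \<le> Re s"
      using continuous_attains_inf[OF L(1) False continuous_on_Re[OF continuous_on_id]] by auto
    then show ?thesis
      using L(2) by (intro exI[of _ "Re s0 - 1/2"]) (auto simp: right_half_plane_def)
  qed (auto intro: exI[of _ 1])
  then obtain x where x: "x > 0" "\<And>s. s \<in> L \<Longrightarrow> Re s \<ge> 1/2 + x" by blast
  show thesis
  proof (rule that[of "1 + 1 / (2 * x)"])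
    show "1 + 1 / (2 * x) > 0" using x by (simp add: add_pos_pos)
    fix D s assume D: "dirichlet_polynomial D" and s: "s \<in> L"
    have "norm (D s) powr q \<le> (1 + 1 / (2 * Re s - 1)) * polynomial_norm q D powr q"
      by (rule dirichlet_polynomial_point_estimate[OF D q]) (use x(2)[OF s] x(1) in simp)
    also have "\<dots> \<le> (1 + 1 / (2 * x)) * polynomial_norm q D powr q"
      using x(2)[OF s] x(1) by (intro mult_right_mono add_left_mono divide_left_mono) auto
    finally show "norm (D s) powr q \<le> (1 + 1 / (2 * x)) * polynomial_norm q D powr q" .
  qed
qed

lemma norm_add_real_ge:
  assumes "Re z \<ge> 0" "\<delta> \<ge> 0"
  shows "norm (z + of_real \<delta>) \<ge> norm z"
  by (rule power2_le_imp_le) (use assms in \<open>auto simp: cmod_power2 intro: power_mono\<close>)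

text \<open>The means of \<open>\<bar>w\<bar> powr (- \<beta>)\<close> and \<open>\<bar>w\<bar>\<close> for \<open>w = \<phi> - 1/2\<close> are not accessible directly, since these
functions are unbounded. The shift by \<open>\<delta>\<close> makes the first one bounded, and \<open>\<bar>w\<bar>\<close> is truncated to
\<open>1 / (1/w + 1/R)\<close>, which is holomorphic, stays in the sector, is bounded by \<open>R\<close>, and has modulus at
least \<open>R/2\<close> when \<open>\<bar>w\<bar> \<ge> R\<close>. The bound does not depend on \<open>\<delta>\<close>.\<close>

lemma shifted_mean_bound:
  assumes phi: "\<phi> \<in> symbol_class_G0" and q: "q > 0"
    and \<alpha>: "0 < \<alpha>" "\<alpha> < pi / 2" and \<beta>: "\<beta> > 1" "\<beta> * \<alpha> < pi / 2"
    and cone: "\<And>s. Re s > 0 \<Longrightarrow> Re (\<phi> s - 1/2) \<ge> cos \<alpha> * norm (\<phi> s - 1/2)"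
    and D: "dirichlet_polynomial D" and S: "S \<ge> 0" and \<delta>: "0 < \<delta>" "\<delta> \<le> 1"
    and \<rho>: "0 < \<rho>" "\<rho> \<le> 1" and R: "R \<ge> 1" and d: "d > 0"
    and SL: "\<And>s. Re (s - 1/2) \<ge> cos \<alpha> * norm (s - 1/2) \<Longrightarrow> \<rho> \<le> norm (s - 1/2) \<Longrightarrow> norm (s - 1/2) \<le> R \<Longrightarrow> norm (D s) powr q \<le> S"
  defines "w0 \<equiv> symbol_limit \<phi> - 1/2"
  shows "mean_le (\<lambda>t. norm (D (\<phi> (vline d t) + of_real \<delta>)) powr q)
     (S + (1 + 1 / (2 * cos \<alpha>)) * (\<rho> powr (\<beta> - 1) * (norm w0 powr (- \<beta>) / cos (\<beta> * \<alpha>)) + 2 / R * ((norm w0 + 1) / cos \<alpha>)) * polynomial_norm q D powr q)"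
proof -
  define c where "c = cos \<alpha>"
  define b where "b = cos (\<beta> * \<alpha>)"
  have c: "0 < c" "c \<le> 1"
    using \<alpha> by (auto simp: c_def intro!: cos_gt_zero_pi)
  have b: "0 < b"
  proof -
    have "0 < \<beta> * \<alpha>" using \<alpha> \<beta> by simp
    then show ?thesis
      unfolding b_def using \<beta>(2) pi_gt_zero by (intro cos_gt_zero_pi) linarith+
  qed
  define m where "m = polynomial_norm q D powr q"
  have m: "m \<ge> 0" by (simp add: m_def)
  define K where "K = 1 + 1 / (2 * c)"
  have K: "K \<ge> 1" using c by (simp add: K_def)
  have w0: "Re w0 > 0"
    using symbol_limit_in_half_plane[OF phi] by (simp add: w0_def)
  note phi_img = symbol_Re_gt[OF phi]
  define z where "z w = w - 1/2 + complex_of_real \<delta>" for w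
  have Rez: "Re (z w) > \<delta>" if "Re w > 1/2" for w
    using that by (simp add: z_def)
  define H1 where "H1 w = z w powr (- of_real \<beta>)" for w
  define H2 where "H2 w = inverse (inverse (z w) + of_real (1 / R))" for w
  have Re_inv: "Re (inverse w) > 0" if "Re w > 0" for w
    using that by (auto intro!: divide_pos_pos simp: sum_power2_gt_zero_iff)
  have hol1: "H1 holomorphic_on right_half_plane (1/2)"
    unfolding H1_def z_def
    by (intro holomorphic_intros) (use \<delta> in \<open>auto simp: right_half_plane_def complex_nonpos_Reals_iff\<close>)
  have ne: "z w \<noteq> 0" "inverse (z w) + of_real (1 / R) \<noteq> 0" if "Re w > 1/2" for w
  proof -
    have "Re (z w) > 0" using Rez[OF that] \<delta> by simp
    then show "z w \<noteq> 0" by auto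
    have "Re (inverse (z w) + of_real (1 / R)) > 0"
      using Re_inv[OF \<open>Re (z w) > 0\<close>] R by (simp add: add_pos_pos del: inverse_complex.sel)
    then show "inverse (z w) + of_real (1 / R) \<noteq> 0" by (metis less_irrefl zero_complex.sel(1))
  qed
  have hol2: "H2 holomorphic_on right_half_plane (1/2)"
    unfolding H2_def
  proof (intro holomorphic_intros)
    show "z holomorphic_on right_half_plane (1/2)"
      unfolding z_def by (intro holomorphic_intros)
  qed (use ne in \<open>auto simp: right_half_plane_def\<close>)
  have nH1: "norm (H1 w) = norm (z w) powr (- \<beta>)" for w
    unfolding H1_def by (subst norm_powr_real_powr') auto
  have b1: "norm (H1 w) \<le> \<delta> powr (- \<beta>)" if "Re w > 1/2" for w
    unfolding nH1 using Rez[OF that] \<delta> \<beta> complex_Re_le_cmod[of "z w"] by (intro powr_mono2') auto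
  have b2: "norm (H2 w) \<le> R" if "Re w > 1/2" for w
  proof -
    have "Re (inverse (z w)) > 0" using Rez[OF that] \<delta> by (intro Re_inv) simp
    then have "1 / R \<le> norm (inverse (z w) + of_real (1 / R))"
      using complex_Re_le_cmod[of "inverse (z w) + of_real (1 / R)"] by (simp del: inverse_complex.sel)
    then have "inverse (norm (inverse (z w) + of_real (1 / R))) \<le> inverse (1 / R)"
      using R by (intro le_imp_inverse_le) auto
    then show ?thesis
      by (simp add: H2_def norm_inverse)
  qed
  have c1: "symbol_limit \<phi> \<in> right_half_plane (1/2)"
    using symbol_limit_in_half_plane[OF phi] by (simp add: right_half_plane_def)
  note comp1 = bounded_dirichlet_compose[OF phi open_right_half_plane subset_refl c1 hol1 b1]
  note comp2 = bounded_dirichlet_compose[OF phi open_right_half_plane subset_refl c1 hol2 b2]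
  let ?s = "\<lambda>t. vline d t"
  have cont1: "continuous_on UNIV (\<lambda>t. H1 (\<phi> (?s t)))"
    by (rule bounded_dirichlet_continuous[OF comp1(1) d])
  have cont2: "continuous_on UNIV (\<lambda>t. H2 (\<phi> (?s t)))"
    by (rule bounded_dirichlet_continuous[OF comp2(1) d])
  have zw0: "z (symbol_limit \<phi>) = w0 + of_real \<delta>"
    by (simp add: z_def w0_def)
  have nw0: "norm w0 \<le> norm (w0 + of_real \<delta>)" "norm (w0 + of_real \<delta>) \<le> norm w0 + 1"
  proof -
    show "norm w0 \<le> norm (w0 + of_real \<delta>)"
      by (rule norm_add_real_ge) (use w0 \<delta> in auto)
    show "norm (w0 + of_real \<delta>) \<le> norm w0 + 1"
      using norm_triangle_ineq[of w0 "of_real \<delta>"] \<delta> by simp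
  qed
  have w0n: "norm w0 > 0" using w0 by auto
  have m1: "mean_le (\<lambda>t. Re (H1 (\<phi> (?s t)))) (norm w0 powr (- \<beta>))"
  proof (rule has_mean_imp_mean_le[OF has_mean_Re[OF cont1 bounded_dirichlet_mean[OF comp1 d]]])
    have "Re (H1 (symbol_limit \<phi>)) \<le> norm (w0 + of_real \<delta>) powr (- \<beta>)"
      using complex_Re_le_cmod[of "H1 (symbol_limit \<phi>)"] by (simp add: nH1 zw0)
    also have "\<dots> \<le> norm w0 powr (- \<beta>)"
      using nw0 w0n \<beta> by (intro powr_mono2') auto
    finally show "Re (H1 (symbol_limit \<phi>)) \<le> norm w0 powr (- \<beta>)" .
  qed
  have m2: "mean_le (\<lambda>t. Re (H2 (\<phi> (?s t)))) (norm w0 + 1)"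
  proof (rule has_mean_imp_mean_le[OF has_mean_Re[OF cont2 bounded_dirichlet_mean[OF comp2 d]]])
    have "norm (inverse (w0 + of_real \<delta>)) \<le> norm (inverse (w0 + of_real \<delta>) + of_real (1 / R))"
      by (rule norm_add_real_ge) (use w0 \<delta> R Re_inv[of "w0 + of_real \<delta>"] in \<open>auto simp del: inverse_complex.sel\<close>)
    then have "inverse (norm (inverse (w0 + of_real \<delta>) + of_real (1 / R))) \<le> inverse (norm (inverse (w0 + of_real \<delta>)))"
      using nw0 w0n by (intro le_imp_inverse_le) auto
    then have "norm (H2 (symbol_limit \<phi>)) \<le> norm (w0 + of_real \<delta>)"
      by (simp add: H2_def zw0 norm_inverse)
    then show "Re (H2 (symbol_limit \<phi>)) \<le> norm w0 + 1"
      using complex_Re_le_cmod[of "H2 (symbol_limit \<phi>)"] nw0(2) by linarith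
  qed
  \<comment> \<open>The coefficients with which \<open>Re H1\<close> and \<open>Re H2\<close> dominate the point estimate near the vertex and near infinity.\<close>
  define A where "A = K * m * (\<rho> powr (\<beta> - 1) / b)"
  define B where "B = K * m * (2 / R / c)"
  have AB: "A \<ge> 0" "B \<ge> 0"
    using K m b c R by (auto simp: A_def B_def)
  have pw: "norm (D (\<phi> s + of_real \<delta>)) powr q \<le> S + (A * Re (H1 (\<phi> s)) + B * Re (H2 (\<phi> s)))"
    if s: "Re s > 0" for s
  proof -
    define w where "w = z (\<phi> s)"
    have w: "Re w \<ge> c * norm w"
      using cone_add_real[of c "\<phi> s - 1/2" \<delta>] cone[OF s] c \<delta> by (simp add: w_def z_def c_def)
    have Rew: "Re w > 0" using Rez[OF phi_img[OF s]] \<delta> by (simp add: w_def)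
    have wn: "norm w > 0" using Rew by auto
    have arg: "\<phi> s + of_real \<delta> = w + 1/2" by (simp add: w_def z_def)
    have h1: "b * norm w powr (- \<beta>) \<le> Re (H1 (\<phi> s))"
      unfolding H1_def w_def[symmetric] b_def
      by (rule cone_powr) (use wn w \<alpha> \<beta> in \<open>auto simp: c_def\<close>)
    have h2: "c * norm (H2 (\<phi> s)) \<le> Re (H2 (\<phi> s))"
      unfolding H2_def w_def[symmetric]
      by (intro cone_inverse cone_add_real w) (use c R in auto)
    have h1': "norm w powr (- \<beta>) \<le> Re (H1 (\<phi> s)) / b"
      using h1 b by (simp add: field_simps)
    have h2': "norm (H2 (\<phi> s)) \<le> Re (H2 (\<phi> s)) / c"
      using h2 c by (simp add: field_simps)
    have pos1: "A * Re (H1 (\<phi> s)) \<ge> 0"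
      using h1 b AB by (intro mult_nonneg_nonneg) (auto intro: order_trans[rotated])
    have pos2: "B * Re (H2 (\<phi> s)) \<ge> 0"
      using h2 c AB by (intro mult_nonneg_nonneg) (auto intro: order_trans[rotated])
    have pe: "norm (D (w + 1/2)) powr q \<le> (1 + 1 / (2 * c * norm w)) * m"
    proof -
      have "norm (D (w + 1/2)) powr q \<le> (1 + 1 / (2 * Re (w + 1/2) - 1)) * m"
        unfolding m_def by (rule dirichlet_polynomial_point_estimate[OF D q]) (use Rew in simp)
      also have "\<dots> = (1 + 1 / (2 * Re w)) * m" by simp
      also have "\<dots> \<le> (1 + 1 / (2 * c * norm w)) * m"
        using w Rew wn c m by (intro mult_right_mono add_left_mono divide_left_mono) auto
      finally show ?thesis .
    qed
    consider "norm w < \<rho>" | "norm w > R" | "\<rho> \<le> norm w" "norm w \<le> R" by linarith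
    then show ?thesis
    proof cases
      case 1
      have "1 + 1 / (2 * c * norm w) \<le> K / norm w"
        using 1 \<rho> wn c by (simp add: K_def field_simps)
      then have "norm (D (w + 1/2)) powr q \<le> K / norm w * m"
        using pe m by (meson mult_right_mono order_trans)
      also have "K / norm w * m = K * m * (norm w powr (\<beta> - 1) * norm w powr (- \<beta>))"
      proof -
        have "norm w powr (\<beta> - 1) * norm w powr (- \<beta>) = norm w powr (- 1)"
          unfolding powr_add[symmetric] by simp
        also have "\<dots> = 1 / norm w"
          using wn by (simp add: powr_minus_divide)
        finally show ?thesis by simp
      qed
      also have "\<dots> \<le> K * m * (\<rho> powr (\<beta> - 1) * (Re (H1 (\<phi> s)) / b))"
        using 1 wn \<beta> K m h1' by (intro mult_left_mono mult_mono powr_mono2) auto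
      also have "\<dots> = A * Re (H1 (\<phi> s))" by (simp add: A_def)
      finally show ?thesis using pos2 S unfolding arg by linarith
    next
      case 2
      have "1 + 1 / (2 * c * norm w) \<le> K"
        unfolding K_def using 2 R c wn by (intro add_left_mono divide_left_mono) (auto intro!: mult_pos_pos)
      then have "norm (D (w + 1/2)) powr q \<le> K * m"
        using pe m by (meson mult_right_mono order_trans)
      also have "\<dots> \<le> K * m * (2 / R * (Re (H2 (\<phi> s)) / c))"
      proof -
        have "norm (inverse w + of_real (1 / R)) \<le> inverse (norm w) + 1 / R"
          using norm_triangle_ineq[of "inverse w" "of_real (1 / R)"] R by (simp add: norm_inverse norm_divide)
        also have "\<dots> \<le> 2 / R"
          using le_imp_inverse_le[of R "norm w"] 2 R by (simp add: inverse_eq_divide)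
        finally have "inverse (2 / R) \<le> inverse (norm (inverse w + of_real (1 / R)))"
          using ne(2)[OF phi_img[OF s]] by (intro le_imp_inverse_le) (auto simp: w_def)
        then have "R / 2 \<le> norm (H2 (\<phi> s))"
          by (simp add: H2_def w_def norm_inverse)
        with h2' have "R / 2 \<le> Re (H2 (\<phi> s)) / c" by (rule order_trans[rotated])
        then have "1 \<le> 2 / R * (Re (H2 (\<phi> s)) / c)"
          using R mult_left_mono[of "R/2" "Re (H2 (\<phi> s)) / c" "2 / R"] by simp
        then show ?thesis
          using K m mult_left_mono[of 1 "2 / R * (Re (H2 (\<phi> s)) / c)" "K * m"] by simp
      qed
      also have "\<dots> = B * Re (H2 (\<phi> s))" by (simp add: B_def)
      finally show ?thesis using pos1 S unfolding arg by linarith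
    next
      case 3
      have "norm (D (w + 1/2)) powr q \<le> S"
        by (rule SL) (use w 3 in \<open>auto simp: c_def\<close>)
      then show ?thesis using pos1 pos2 unfolding arg by linarith
    qed
  qed
  have "mean_le (\<lambda>t. S + (A * Re (H1 (\<phi> (?s t))) + B * Re (H2 (\<phi> (?s t)))))
      (S + (A * (norm w0 powr (- \<beta>)) + B * (norm w0 + 1)))"
    by (intro mean_le_add mean_le_cmult mean_le_const m1 m2 AB continuous_intros cont1 cont2 order_refl)
  then have "mean_le (\<lambda>t. norm (D (\<phi> (?s t) + of_real \<delta>)) powr q) (S + (A * (norm w0 powr (- \<beta>)) + B * (norm w0 + 1)))"
  proof (rule mean_le_mono)
    show "continuous_on UNIV (\<lambda>t. norm (D (\<phi> (?s t) + of_real \<delta>)) powr q)"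
      by (rule continuous_on_norm_powr[OF q compose_continuous[OF phi dirichlet_polynomial_shift[OF D] d]])
    show "norm (D (\<phi> (?s t) + of_real \<delta>)) powr q \<le> S + (A * Re (H1 (\<phi> (?s t))) + B * Re (H2 (\<phi> (?s t))))" for t
      by (rule pw) (use d in simp)
  qed (intro continuous_intros cont1 cont2 | simp)+
  also have "S + (A * (norm w0 powr (- \<beta>)) + B * (norm w0 + 1)) =
      S + (1 + 1 / (2 * cos \<alpha>)) * (\<rho> powr (\<beta> - 1) * (norm w0 powr (- \<beta>) / cos (\<beta> * \<alpha>)) + 2 / R * ((norm w0 + 1) / cos \<alpha>)) * polynomial_norm q D powr q"
  proof -
    have "S + (K * m * (r / b) * x + K * m * (2 / R / c) * y) = S + K * (r * (x / b) + 2 / R * (y / c)) * m"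
      for K m r x y :: real
      by (simp add: divide_inverse algebra_simps)
    then show ?thesis
      unfolding A_def B_def K_def c_def[symmetric] b_def[symmetric] m_def[symmetric] .
  qed
  finally show ?thesis .
qed

text \<open>The compact set \<open>L\<close> depends on \<open>\<eta>\<close> but not on \<open>D\<close>: it is the part of the sector between two radii
\<open>\<rho>\<close> and \<open>R\<close>, chosen so that the contributions of the vertex and of infinity are at most \<open>\<eta>/2\<close>
each. The shift is removed by letting \<open>\<delta>\<close> tend to \<open>0\<close>.\<close>

theorem sector_mean_estimate:
  assumes phi: "\<phi> \<in> symbol_class_G0" and q: "q > 0" and \<alpha>: "0 < \<alpha>" "\<alpha> < pi / 2"
    and cone: "\<And>s. Re s > 0 \<Longrightarrow> Re (\<phi> s - 1/2) \<ge> cos \<alpha> * norm (\<phi> s - 1/2)" and \<eta>: "\<eta> > 0"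
  obtains L where "compact L" "L \<subseteq> right_half_plane (1/2)"
    "\<And>D S. dirichlet_polynomial D \<Longrightarrow> S \<ge> 0 \<Longrightarrow> (\<And>s. s \<in> L \<Longrightarrow> norm (D s) powr q \<le> S) \<Longrightarrow>
      compose_mean_le q \<phi> D (2 powr q * S + \<eta> * polynomial_norm q D powr q)"
proof -
  \<comment> \<open>The midpoint of \<open>1\<close> and \<open>\<pi> / (2\<alpha>)\<close>, so that \<open>\<beta> > 1\<close> and \<open>\<beta>\<alpha> < \<pi>/2\<close>.\<close>
  define \<beta> where "\<beta> = (1 + pi / (2 * \<alpha>)) / 2"
  have \<beta>: "\<beta> > 1" "\<beta> * \<alpha> < pi / 2"
    using \<alpha> by (auto simp: \<beta>_def field_simps)
  define c where "c = cos \<alpha>"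
  define b where "b = cos (\<beta> * \<alpha>)"
  define w0 where "w0 = symbol_limit \<phi> - 1/2"
  have c: "0 < c"
    using \<alpha> by (auto simp: c_def intro!: cos_gt_zero_pi)
  have b: "0 < b"
  proof -
    have "0 < \<beta> * \<alpha>" using \<alpha> \<beta> by simp
    then show ?thesis
      unfolding b_def using \<beta>(2) pi_gt_zero by (intro cos_gt_zero_pi) linarith+
  qed
  define T where "T = 2 powr q * (1 + 1 / (2 * c))"
  have T: "T > 0" using c by (simp add: T_def add_pos_pos)
  define X where "X = T * (norm w0 powr (- \<beta>) / b) + 1"
  define Y where "Y = T * (2 * ((norm w0 + 1) / c))"
  have X: "X > 0" and Y: "Y > 0"
    using T b c by (auto simp: X_def Y_def intro!: add_nonneg_pos mult_pos_pos divide_pos_pos add_nonneg_pos)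
  define \<rho> where "\<rho> = min 1 ((\<eta> / (2 * X)) powr (1 / (\<beta> - 1)))"
  have \<rho>: "0 < \<rho>" "\<rho> \<le> 1" using \<eta> X by (auto simp: \<rho>_def)
  define R where "R = max 1 (2 * Y / \<eta>)"
  have R: "R \<ge> 1" by (simp add: R_def)
  have \<rho>X: "\<rho> powr (\<beta> - 1) * X \<le> \<eta> / 2"
  proof -
    have "\<rho> powr (\<beta> - 1) \<le> ((\<eta> / (2 * X)) powr (1 / (\<beta> - 1))) powr (\<beta> - 1)"
      using \<rho> \<beta> by (intro powr_mono2) (auto simp: \<rho>_def)
    also have "\<dots> = \<eta> / (2 * X)"
      using \<beta> \<eta> X by (simp add: powr_powr)
    finally show ?thesis
      using X by (simp add: field_simps)
  qed
  have RY: "Y / R \<le> \<eta> / 2"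
  proof -
    have "2 * Y / \<eta> \<le> R" by (simp add: R_def)
    then show ?thesis using R \<eta> by (simp add: field_simps)
  qed
  define L where "L = {s. c * norm (s - 1/2) \<le> Re (s - 1/2) \<and> \<rho> \<le> norm (s - 1/2) \<and> norm (s - 1/2) \<le> R}"
  show thesis
  proof (rule that[of L])
    have "closed L"
      unfolding L_def by (intro closed_Collect_conj closed_Collect_le continuous_intros)
    moreover have "bounded L"
      by (rule bounded_subset[OF bounded_cball[of "1/2" R]]) (auto simp: L_def dist_norm norm_minus_commute)
    ultimately show "compact L"
      by (simp add: compact_eq_bounded_closed)
    show "L \<subseteq> right_half_plane (1/2)"
    proof
      fix s assume s: "s \<in> L"
      then have "0 < norm (s - 1/2)"
        using \<rho>(1) unfolding L_def by (smt (verit) mem_Collect_eq)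
      then have "0 < c * norm (s - 1/2)"
        using c by (rule mult_pos_pos[rotated])
      also have "\<dots> \<le> Re (s - 1/2)"
        using s by (simp add: L_def)
      finally show "s \<in> right_half_plane (1/2)"
        by (simp add: right_half_plane_def)
    qed
    fix D S assume D: "dirichlet_polynomial D" and S: "S \<ge> 0" and SL: "\<And>s. s \<in> L \<Longrightarrow> norm (D s) powr q \<le> S"
    define m where "m = polynomial_norm q D powr q"
    have m: "m \<ge> 0" by (simp add: m_def)
    obtain M where M: "M \<ge> 0" "\<And>s. Re s \<ge> 0 \<Longrightarrow> norm (D s) \<le> M"
      by (rule dirichlet_polynomial_bounded[OF D]) (rule that)
    note phi_img = symbol_Re_gt[OF phi]
    show "compose_mean_le q \<phi> D (2 powr q * S + \<eta> * polynomial_norm q D powr q)"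
      unfolding compose_mean_le_def m_def[symmetric]
    proof (intro allI impI, rule mean_le_closed)
      fix d e :: real assume d: "d > 0" and e: "e > 0"
      let ?s = "\<lambda>t. vline d t"
      define h where "h = (e / 2 powr q) powr (1/q)"
      have h: "h > 0" "h powr q = e / 2 powr q"
        using e q by (auto simp: h_def powr_powr)
      define \<delta> where "\<delta> = min 1 (h / (4 * M + 1))"
      have \<delta>: "0 < \<delta>" "\<delta> \<le> 1" using h M by (auto simp: \<delta>_def)
      have \<delta>M: "4 * M * \<delta> \<le> h"
      proof -
        have "4 * M * \<delta> \<le> (4 * M + 1) * \<delta>" using \<delta> by simp
        also have "\<dots> \<le> (4 * M + 1) * (h / (4 * M + 1))"
          unfolding \<delta>_def using M by (intro mult_left_mono) auto
        also have "\<dots> = h"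
        proof -
          have "x * (h / x) = h" if "x > 0" for x
            using that by simp
          from this[of "4 * M + 1"] show ?thesis using M(1) by linarith
        qed
        finally show ?thesis .
      qed
      have close: "norm (D (\<phi> (?s t)) - D (\<phi> (?s t) + of_real \<delta>)) \<le> h" for t
      proof -
        have "norm (D (\<phi> (?s t)) - D (\<phi> (?s t) + of_real \<delta>)) \<le> 2 * M / (1/2) * norm (\<phi> (?s t) - (\<phi> (?s t) + of_real \<delta>))"
          by (rule half_plane_lipschitz[where \<theta> = 0 and F = D])
            (use phi_img[of "?s t"] d \<delta> M(2) in \<open>auto simp: right_half_plane_def intro: dirichlet_polynomial_holomorphic[OF D]\<close>)
        also have "\<dots> \<le> h" using \<delta>M \<delta> by simp
        finally show ?thesis .
      qed
      let ?E = "(1 + 1 / (2 * cos \<alpha>)) * (\<rho> powr (\<beta> - 1) * (norm w0 powr (- \<beta>) / cos (\<beta> * \<alpha>)) + 2 / R * ((norm w0 + 1) / cos \<alpha>))"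
      have cD: "continuous_on UNIV (\<lambda>t. D (\<phi> (?s t)))"
        by (rule compose_continuous[OF phi D d])
      have cD': "continuous_on UNIV (\<lambda>t. D (\<phi> (?s t) + of_real \<delta>))"
        by (rule compose_continuous[OF phi dirichlet_polynomial_shift[OF D] d])
      have 1: "mean_le (\<lambda>t. norm (D (\<phi> (?s t) + of_real \<delta>)) powr q) (S + ?E * m)"
        unfolding m_def w0_def
        by (rule shifted_mean_bound[OF phi q \<alpha> \<beta> cone D S \<delta> \<rho> R d]) (auto intro!: SL simp: L_def c_def)
      have 2: "mean_le (\<lambda>t. norm (D (\<phi> (?s t)) - D (\<phi> (?s t) + of_real \<delta>)) powr q) (e / 2 powr q)"
      proof (rule mean_le_mono[OF mean_le_const[OF order_refl]])
        show "norm (D (\<phi> (?s t)) - D (\<phi> (?s t) + of_real \<delta>)) powr q \<le> e / 2 powr q" for t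
          unfolding h(2)[symmetric] using close q by (intro powr_mono2) auto
        show "continuous_on UNIV (\<lambda>t. norm (D (\<phi> (?s t)) - D (\<phi> (?s t) + of_real \<delta>)) powr q)"
          by (intro continuous_on_norm_powr q continuous_intros cD cD')
      qed auto
      have "mean_le (\<lambda>t. norm (D (\<phi> (?s t) + of_real \<delta>) + (D (\<phi> (?s t)) - D (\<phi> (?s t) + of_real \<delta>))) powr q)
          (2 powr q * ((S + ?E * m) + e / 2 powr q))"
        by (rule mean_le_quasi_triangle[OF q cD' _ 1 2]) (intro continuous_intros cD cD')
      then have 3: "mean_le (\<lambda>t. norm (D (\<phi> (?s t))) powr q) (2 powr q * ((S + ?E * m) + e / 2 powr q))"
        by simp
      have "2 powr q * ?E \<le> \<eta>"
      proof -
        have "2 powr q * ?E = \<rho> powr (\<beta> - 1) * (T * (norm w0 powr (- \<beta>) / b)) + Y / R"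
        proof -
          have "u * (v * (r * (x / b) + 2 / R * (y / c))) = r * (u * v * (x / b)) + u * v * (2 * (y / c)) / R"
            for u v r x y :: real
            by (simp add: divide_inverse algebra_simps)
          then show ?thesis
            unfolding T_def Y_def c_def[symmetric] b_def[symmetric] .
        qed
        also have "\<dots> \<le> \<rho> powr (\<beta> - 1) * X + Y / R"
          by (intro add_right_mono mult_left_mono) (auto simp: X_def)
        also have "\<dots> \<le> \<eta>"
          using \<rho>X RY by linarith
        finally show ?thesis .
      qed
      then have Em: "(2 powr q * ?E) * m \<le> \<eta> * m"
        using m by (rule mult_right_mono)
      have expand: "2 powr q * ((S + E * m) + e / 2 powr q) = 2 powr q * S + (2 powr q * E) * m + e" for E
        by (simp add: distrib_left mult.assoc)
      have le: "2 powr q * ((S + ?E * m) + e / 2 powr q) \<le> 2 powr q * S + \<eta> * m + e"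
        unfolding expand using Em by (intro add_right_mono add_left_mono)
      show "mean_le (\<lambda>t. norm (D (\<phi> (?s t))) powr q) (2 powr q * S + \<eta> * m + e)"
        by (rule mean_le_mono[OF 3 _ _ order_refl le]) (rule continuous_on_norm_powr[OF q cD])+
    qed
  qed
qed

section \<open>Boundedness and compactness\<close>

theorem sector_bounded_estimate:
  assumes phi: "\<phi> \<in> symbol_class_G0" and q: "q > 0" and \<alpha>: "0 < \<alpha>" "\<alpha> < pi / 2"
    and cone: "\<And>s. Re s > 0 \<Longrightarrow> Re (\<phi> s - 1/2) \<ge> cos \<alpha> * norm (\<phi> s - 1/2)"
  obtains C where "C > 0" "\<And>D. dirichlet_polynomial D \<Longrightarrow> compose_mean_le q \<phi> D (C * polynomial_norm q D powr q)"
proof -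
  obtain L where L: "compact L" "L \<subseteq> right_half_plane (1/2)"
    "\<And>D S. dirichlet_polynomial D \<Longrightarrow> S \<ge> 0 \<Longrightarrow> (\<And>s. s \<in> L \<Longrightarrow> norm (D s) powr q \<le> S) \<Longrightarrow>
      compose_mean_le q \<phi> D (2 powr q * S + 1 * polynomial_norm q D powr q)"
    by (rule sector_mean_estimate[OF phi q \<alpha> cone zero_less_one]) (auto intro: that)
  obtain K where K: "K > 0" "\<And>D s. dirichlet_polynomial D \<Longrightarrow> s \<in> L \<Longrightarrow> norm (D s) powr q \<le> K * polynomial_norm q D powr q"
    by (rule point_bound_on_compact[OF L(1,2) q]) (rule that)
  show thesis
  proof (rule that[of "2 powr q * K + 1"])
    show "2 powr q * K + 1 > 0" using K by (simp add: add_pos_pos)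
    fix D assume D: "dirichlet_polynomial D"
    have "compose_mean_le q \<phi> D (2 powr q * (K * polynomial_norm q D powr q) + 1 * polynomial_norm q D powr q)"
      by (rule L(3)[OF D _ K(2)[OF D]]) (use K in simp)
    then show "compose_mean_le q \<phi> D ((2 powr q * K + 1) * polynomial_norm q D powr q)"
      by (simp add: distrib_right mult.assoc)
  qed
qed

lemma hardy_polynomial_approx:
  assumes f: "f \<in> hardy_space q" and q: "q > 0" and B: "hardy_norm q f < B" and e: "e > 0"
  shows "\<exists>P J. represents q P f \<and> (\<forall>j\<ge>J. polynomial_norm q (\<lambda>s. P j s - P J s) < e) \<and> polynomial_norm q (P J) \<le> B"
proof -
  obtain L P where LP: "L < B" "represents q P f" "(\<lambda>j. polynomial_norm q (P j)) \<longlonglongrightarrow> L"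
    using cInf_lessD[OF _ B[unfolded hardy_norm_def]] hardy_norm_attained[OF f q] by blast
  have "eventually (\<lambda>j. polynomial_norm q (P j) < B) sequentially"
    by (rule order_tendstoD(2)[OF LP(3,1)])
  then obtain N1 where N1: "\<And>j. j \<ge> N1 \<Longrightarrow> polynomial_norm q (P j) < B"
    by (auto simp: eventually_sequentially)
  obtain N2 where N2: "\<And>i j. i \<ge> N2 \<Longrightarrow> j \<ge> N2 \<Longrightarrow> polynomial_norm q (\<lambda>s. P i s - P j s) < e"
    using LP(2) e unfolding represents_def by blast
  show ?thesis
    by (intro exI[of _ P] exI[of _ "max N1 N2"] conjI allI impI LP(2) N2 less_imp_le[OF N1]) auto
qed

lemma polynomial_montel:
  assumes P: "\<And>n. dirichlet_polynomial (P n)" and q: "q > 0" and b: "\<And>n. polynomial_norm q (P n) \<le> B"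
  obtains g r where "strict_mono (r :: nat \<Rightarrow> nat)"
    "\<And>s. Re s > 1/2 \<Longrightarrow> (\<lambda>n. P (r n) s) \<longlonglongrightarrow> g s"
    "\<And>K. compact K \<Longrightarrow> K \<subseteq> right_half_plane (1/2) \<Longrightarrow> uniform_limit K (\<lambda>n. P (r n)) g sequentially"
proof -
  obtain g r where gr: "g holomorphic_on right_half_plane (1/2)" "strict_mono (r :: nat \<Rightarrow> nat)"
    "\<And>x. x \<in> right_half_plane (1/2) \<Longrightarrow> ((\<lambda>n. P (r n) x) \<longlongrightarrow> g x) sequentially"
    "\<And>K. \<lbrakk>compact K; K \<subseteq> right_half_plane (1/2)\<rbrakk> \<Longrightarrow> uniform_limit K (P \<circ> r) g sequentially"
  proof (rule Montel[OF open_right_half_plane, of "range P" "1/2" P])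
    show "h holomorphic_on right_half_plane (1/2)" if "h \<in> range P" for h
      using that dirichlet_polynomial_holomorphic[OF P] by blast
    fix K :: "complex set" assume K: "compact K" "K \<subseteq> right_half_plane (1/2)"
    obtain M where M: "M > 0" "\<And>D s. dirichlet_polynomial D \<Longrightarrow> s \<in> K \<Longrightarrow> norm (D s) powr q \<le> M * polynomial_norm q D powr q"
      by (rule point_bound_on_compact[OF K q]) (rule that)
    have "norm (P n z) \<le> (M * B powr q) powr (1/q)" if "z \<in> K" for n z
    proof (rule powr_le_imp_le[OF q norm_ge_zero])
      have "norm (P n z) powr q \<le> M * polynomial_norm q (P n) powr q"
        by (rule M(2)[OF P that])
      also have "\<dots> \<le> M * B powr q"
        using M(1) q b[of n] by (intro mult_left_mono powr_mono2) (auto simp: polynomial_norm_nonneg)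
      finally show "norm (P n z) powr q \<le> M * B powr q" .
    qed
    then show "\<exists>B. \<forall>h\<in>range P. \<forall>z\<in>K. norm (h z) \<le> B" by blast
  qed auto
  show thesis
    by (rule that[OF gr(2)]) (use gr(3,4) in \<open>auto simp: right_half_plane_def o_def\<close>)
qed

text \<open>Each \<open>f n\<close> is replaced by a Dirichlet polynomial \<open>p n\<close> at distance at most \<open>1 / (n + 1)\<close>. Montel's
theorem gives a subsequence that converges uniformly on compact sets, and the sector estimate turns
this into a Cauchy sequence of images. The limit function composed with the symbol is the
limit of the images of the \<open>f (r n)\<close>.\<close>

theorem compact_on_hardy_from_sector:
  assumes phi: "\<phi> \<in> symbol_class_G0" and q: "q > 0" and \<alpha>: "0 < \<alpha>" "\<alpha> < pi / 2"
    and cone: "\<And>s. Re s > 0 \<Longrightarrow> Re (\<phi> s - 1/2) \<ge> cos \<alpha> * norm (\<phi> s - 1/2)"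
  shows "compact_on_hardy q (composition_operator \<phi>)"
proof -
  obtain C where C: "C > 0" "\<And>D. dirichlet_polynomial D \<Longrightarrow> compose_mean_le q \<phi> D (C * polynomial_norm q D powr q)"
    by (rule sector_bounded_estimate[OF phi q \<alpha> cone]) (auto intro: that)
  have inH: "\<And>f. f \<in> hardy_space q \<Longrightarrow> composition_operator \<phi> f \<in> hardy_space q"
    using bounded_on_hardy_from_polynomials[OF phi q C] unfolding bounded_on_hardy_def by blast
  have seq: "\<exists>r g. strict_mono r \<and> g \<in> hardy_space q \<and>
      (\<lambda>n. hardy_norm q (\<lambda>s. composition_operator \<phi> (f (r n)) s - g s)) \<longlonglongrightarrow> 0"
    if f: "\<And>n. f n \<in> hardy_space q" and B: "\<And>n. hardy_norm q (f n) \<le> B" for f :: "nat \<Rightarrow> complex \<Rightarrow> complex" and B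
  proof -
    have Bp: "hardy_norm q (f n) < B + 1" for n
      using B[of n] by simp
    have "\<exists>P J. represents q P (f n) \<and> (\<forall>j\<ge>J. polynomial_norm q (\<lambda>s. P j s - P J s) < 1 / real (Suc n)) \<and> polynomial_norm q (P J) \<le> B + 1" for n
      by (rule hardy_polynomial_approx[OF f q Bp]) simp
    then obtain P J where PJ: "\<And>n. represents q (P n) (f n)"
      "\<And>n j. j \<ge> J n \<Longrightarrow> polynomial_norm q (\<lambda>s. P n j s - P n (J n) s) < 1 / real (Suc n)"
      "\<And>n. polynomial_norm q (P n (J n)) \<le> B + 1"
      by metis
    have Pd: "dirichlet_polynomial (P n j)" for n j
      using PJ(1)[of n] by (simp add: represents_def)
    define p where "p n = P n (J n)" for n
    have p: "dirichlet_polynomial (p n)" for n by (simp add: p_def Pd)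
    obtain g r where gr: "strict_mono (r :: nat \<Rightarrow> nat)"
      "\<And>s. Re s > 1/2 \<Longrightarrow> (\<lambda>n. p (r n) s) \<longlonglongrightarrow> g s"
      "\<And>K. compact K \<Longrightarrow> K \<subseteq> right_half_plane (1/2) \<Longrightarrow> uniform_limit K (\<lambda>n. p (r n)) g sequentially"
      by (rule polynomial_montel[of p, OF p q, of "B + 1"]) (use PJ(3) in \<open>auto simp: p_def intro: that\<close>)
    define k where "k = (2::real) powr q"
    have k: "k > 0" by (simp add: k_def)
    have dneg: "polynomial_norm q (\<lambda>s. 0 - p n s) powr q = polynomial_norm q (p n) powr q" for n
      by (simp add: polynomial_norm_def)
    define A where "A = k * ((B + 1) powr q + (B + 1) powr q)"
    have mA: "polynomial_norm q (\<lambda>s. p i s - p j s) powr q \<le> A" for i j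
    proof -
      have "polynomial_norm q (\<lambda>s. p i s + (0 - p j s)) powr q \<le> k * (polynomial_norm q (p i) powr q + polynomial_norm q (\<lambda>s. 0 - p j s) powr q)"
        unfolding k_def by (rule polynomial_norm_add[OF q p dirichlet_polynomial_diff[OF dirichlet_polynomial_const p]])
      also have "\<dots> \<le> A"
        unfolding A_def dneg using PJ(3) q k
        by (intro mult_left_mono add_mono powr_mono2) (auto simp: p_def polynomial_norm_nonneg)
      finally show ?thesis by simp
    qed
    have A0: "A \<ge> 0"
      using mA[of 0 0] by (rule order_trans[rotated]) simp
    \<comment> \<open>The sector estimate with \<open>\<eta>\<close> small compared with the bound \<open>A\<close> of all differences.\<close>
    have cau: "\<exists>N. \<forall>i\<ge>N. \<forall>j\<ge>N. compose_mean_le q \<phi> (\<lambda>s. p (r i) s - p (r j) s) e" if e: "e > 0" for e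
    proof -
      define \<eta> where "\<eta> = e / (2 * (A + 1))"
      have \<eta>: "\<eta> > 0" using e A0 by (simp add: \<eta>_def)
      obtain L where L: "compact L" "L \<subseteq> right_half_plane (1/2)"
        "\<And>D S. dirichlet_polynomial D \<Longrightarrow> S \<ge> 0 \<Longrightarrow> (\<And>s. s \<in> L \<Longrightarrow> norm (D s) powr q \<le> S) \<Longrightarrow>
          compose_mean_le q \<phi> D (2 powr q * S + \<eta> * polynomial_norm q D powr q)"
        by (rule sector_mean_estimate[OF phi q \<alpha> cone \<eta>]) (auto intro: that)
      define S where "S = e / (2 * k)"
      have S: "S > 0" using e k by (simp add: S_def)
      define u where "u = S powr (1/q) / 2"
      have u: "u > 0" using S by (simp add: u_def)
      obtain N where N: "\<And>n s. n \<ge> N \<Longrightarrow> s \<in> L \<Longrightarrow> dist (p (r n) s) (g s) < u"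
        using uniform_limitD[OF gr(3)[OF L(1,2)] u] unfolding eventually_sequentially by blast
      have "compose_mean_le q \<phi> (\<lambda>s. p (r i) s - p (r j) s) e" if i: "i \<ge> N" and j: "j \<ge> N" for i j
      proof (rule compose_mean_le_mono)
        show "compose_mean_le q \<phi> (\<lambda>s. p (r i) s - p (r j) s) (2 powr q * S + \<eta> * polynomial_norm q (\<lambda>s. p (r i) s - p (r j) s) powr q)"
        proof (rule L(3)[OF dirichlet_polynomial_diff[OF p p] less_imp_le[OF S]])
          fix s assume s: "s \<in> L"
          have "norm (p (r i) s - p (r j) s) \<le> u + u"
            using dist_triangle2[of "p (r i) s" "p (r j) s" "g s"] N[OF i s] N[OF j s] by (simp add: dist_norm)
          then have "norm (p (r i) s - p (r j) s) powr q \<le> (S powr (1/q)) powr q"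
            using q by (intro powr_mono2) (auto simp: u_def)
          then show "norm (p (r i) s - p (r j) s) powr q \<le> S"
            using q S by (simp add: powr_powr)
        qed
        have "\<eta> * polynomial_norm q (\<lambda>s. p (r i) s - p (r j) s) powr q \<le> \<eta> * (A + 1)"
          using mA[of "r i" "r j"] \<eta> by (intro mult_left_mono) auto
        also have "\<dots> = e / 2"
        proof -
          have "e / (2 * x) * x = e / 2" if "x > 0" for x
            using that by simp
          from this[of "A + 1"] show ?thesis using A0 unfolding \<eta>_def by linarith
        qed
        finally show "2 powr q * S + \<eta> * polynomial_norm q (\<lambda>s. p (r i) s - p (r j) s) powr q \<le> e"
          using k by (simp add: S_def k_def)
      qed
      then show ?thesis by blast
    qed
    have gH: "(\<lambda>s. g (\<phi> s)) \<in> hardy_space q"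
      by (rule compose_represents(1)[OF phi q, of "\<lambda>j. p (r j)"]) (use p gr(2) cau in auto)
    have cauP: "\<exists>N. \<forall>i\<ge>N. \<forall>j\<ge>N. compose_mean_le q \<phi> (\<lambda>s. P n i s - P n j s) e" if "e > 0" for n e
      by (rule represents_compose_Cauchy[OF q C PJ(1) that])
    \<comment> \<open>The difference is represented by \<open>P (r n) j - p (r j)\<close> as \<open>j\<close> grows. For large \<open>j\<close> the first term is close to
\<open>p (r n)\<close>, which is close in mean to \<open>p (r j)\<close>.\<close>
    have small: "hardy_norm q (\<lambda>s. f (r n) (\<phi> s) - g (\<phi> s)) \<le> (k * (2 * (k * (C * (1 / real (Suc (r n))) powr q + e)))) powr (1/q)"
      "(\<lambda>s. f (r n) (\<phi> s) - g (\<phi> s)) \<in> hardy_space q"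
      if e: "e > 0" and N: "\<And>i j. i \<ge> N \<Longrightarrow> j \<ge> N \<Longrightarrow> compose_mean_le q \<phi> (\<lambda>s. p (r i) s - p (r j) s) e" and n: "n \<ge> N"
      for n N e
    proof -
      define D where "D j s = P (r n) j s - p (r j) s" for j s
      have D: "dirichlet_polynomial (D j)" for j
        unfolding D_def by (intro dirichlet_polynomial_diff Pd p)
      have Dlim: "(\<lambda>j. D j s) \<longlonglongrightarrow> f (r n) s - g s" if "Re s > 1/2" for s
        unfolding D_def using PJ(1)[of "r n"] that gr(2)[OF that]
        by (intro tendsto_diff) (auto simp: represents_def right_half_plane_def)
      have Dcau: "\<exists>N. \<forall>i\<ge>N. \<forall>j\<ge>N. compose_mean_le q \<phi> (\<lambda>s. D i s - D j s) e'" if e': "e' > 0" for e'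
      proof -
        have "e' / (2 * k) > 0" using e' k by simp
        obtain N1 where N1: "\<And>i j. i \<ge> N1 \<Longrightarrow> j \<ge> N1 \<Longrightarrow> compose_mean_le q \<phi> (\<lambda>s. P (r n) i s - P (r n) j s) (e' / (2 * k))"
          using cauP[OF \<open>e' / (2 * k) > 0\<close>] by blast
        obtain N2 where N2: "\<And>i j. i \<ge> N2 \<Longrightarrow> j \<ge> N2 \<Longrightarrow> compose_mean_le q \<phi> (\<lambda>s. p (r i) s - p (r j) s) (e' / (2 * k))"
          using cau[OF \<open>e' / (2 * k) > 0\<close>] by blast
        have "compose_mean_le q \<phi> (\<lambda>s. D i s - D j s) e'" if i: "i \<ge> max N1 N2" and j: "j \<ge> max N1 N2" for i j
        proof -
          have "compose_mean_le q \<phi> (\<lambda>s. (P (r n) i s - P (r n) j s) + (p (r j) s - p (r i) s)) (2 powr q * (e' / (2 * k) + e' / (2 * k)))"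
            by (rule compose_mean_le_add[OF phi q dirichlet_polynomial_diff[OF Pd Pd] dirichlet_polynomial_diff[OF p p] N1 N2])
              (use i j in auto)
          moreover have "2 powr q * (e' / (2 * k) + e' / (2 * k)) = e'"
            using k unfolding k_def[symmetric] by (simp add: field_simps)
          moreover have "(\<lambda>s. (P (r n) i s - P (r n) j s) + (p (r j) s - p (r i) s)) = (\<lambda>s. D i s - D j s)"
            by (simp add: D_def algebra_simps)
          ultimately show ?thesis by simp
        qed
        then show ?thesis by blast
      qed
      show "(\<lambda>s. f (r n) (\<phi> s) - g (\<phi> s)) \<in> hardy_space q"
        by (rule compose_represents(1)[OF phi q D Dlim Dcau])
      let ?L = "k * (C * (1 / real (Suc (r n))) powr q + e)"
      have L: "?L > 0"
        using k C e by (simp add: add_nonneg_pos)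
      have "eventually (\<lambda>j. compose_mean_le q \<phi> (D j) ?L) sequentially"
        unfolding eventually_sequentially
      proof (intro exI[of _ "max N (J (r n))"] allI impI)
        fix j assume j: "j \<ge> max N (J (r n))"
        have 1: "compose_mean_le q \<phi> (\<lambda>s. P (r n) j s - p (r n) s) (C * (1 / real (Suc (r n))) powr q)"
        proof (rule compose_mean_le_mono[OF C(2)[OF dirichlet_polynomial_diff[OF Pd p]]])
          have "polynomial_norm q (\<lambda>s. P (r n) j s - p (r n) s) \<le> 1 / real (Suc (r n))"
            unfolding p_def by (rule less_imp_le[OF PJ(2)]) (use j in simp)
          then show "C * polynomial_norm q (\<lambda>s. P (r n) j s - p (r n) s) powr q \<le> C * (1 / real (Suc (r n))) powr q"
            using C(1) q by (intro mult_left_mono powr_mono2) (auto simp: polynomial_norm_nonneg)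
        qed
        have 2: "compose_mean_le q \<phi> (\<lambda>s. p (r n) s - p (r j) s) e"
          by (rule N) (use n j in auto)
        have "compose_mean_le q \<phi> (\<lambda>s. (P (r n) j s - p (r n) s) + (p (r n) s - p (r j) s)) (2 powr q * (C * (1 / real (Suc (r n))) powr q + e))"
          by (rule compose_mean_le_add[OF phi q dirichlet_polynomial_diff[OF Pd p] dirichlet_polynomial_diff[OF p p] 1 2])
        moreover have "(\<lambda>s. (P (r n) j s - p (r n) s) + (p (r n) s - p (r j) s)) = D j"
          by (simp add: D_def fun_eq_iff)
        ultimately show "compose_mean_le q \<phi> (D j) ?L"
          by (simp add: k_def)
      qed
      from compose_represents(2)[OF phi q D Dlim Dcau L this]
      show "hardy_norm q (\<lambda>s. f (r n) (\<phi> s) - g (\<phi> s)) \<le> (k * (2 * ?L)) powr (1/q)"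
        unfolding k_def .
    qed
    have "(\<lambda>n. hardy_norm q (\<lambda>s. f (r n) (\<phi> s) - g (\<phi> s))) \<longlonglongrightarrow> 0"
    proof (rule LIMSEQ_I)
      fix x :: real assume x: "x > 0"
      define e where "e = (x / 2) powr q / (4 * k * k)"
      have e: "e > 0" using x k by (simp add: e_def)
      obtain N where N: "\<And>i j. i \<ge> N \<Longrightarrow> j \<ge> N \<Longrightarrow> compose_mean_le q \<phi> (\<lambda>s. p (r i) s - p (r j) s) e"
        using cau[OF e] by blast
      have "(e / C) powr (1/q) > 0" using e C by simp
      from one_over_Suc_less[OF this] obtain N' where N': "\<And>n. n \<ge> N' \<Longrightarrow> 1 / real (Suc n) < (e / C) powr (1/q)" by blast
      have "norm (hardy_norm q (\<lambda>s. f (r n) (\<phi> s) - g (\<phi> s)) - 0) < x" if n: "n \<ge> max N N'" for n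
      proof -
        have nN: "n \<ge> N" using n by simp
        have "r n \<ge> N'" using seq_suble[OF gr(1), of n] n by simp
        then have "(1 / real (Suc (r n))) powr q \<le> ((e / C) powr (1/q)) powr q"
          using q less_imp_le[OF N'] by (intro powr_mono2) auto
        also have "\<dots> = e / C" using e C q by (simp add: powr_powr)
        finally have "C * (1 / real (Suc (r n))) powr q \<le> e"
          using C by (simp add: field_simps)
        then have "k * (2 * (k * (C * (1 / real (Suc (r n))) powr q + e))) \<le> k * (2 * (k * (e + e)))"
          using k by (intro mult_left_mono add_right_mono) auto
        also have "\<dots> = (x / 2) powr q"
          using k by (simp add: e_def)
        finally have "(k * (2 * (k * (C * (1 / real (Suc (r n))) powr q + e)))) powr (1/q) \<le> ((x / 2) powr q) powr (1/q)"
          using k C e q by (intro powr_mono2) (auto intro!: mult_nonneg_nonneg add_nonneg_nonneg)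
        also have "\<dots> = x / 2"
          using q x by (simp add: powr_powr)
        finally have "hardy_norm q (\<lambda>s. f (r n) (\<phi> s) - g (\<phi> s)) \<le> x / 2"
          using small(1)[OF e N nN] by linarith
        moreover have "hardy_norm q (\<lambda>s. f (r n) (\<phi> s) - g (\<phi> s)) \<ge> 0"
          by (rule hardy_norm_nonneg[OF small(2)[OF e N nN] q])
        ultimately show ?thesis using x by simp
      qed
      then show "\<exists>no. \<forall>n\<ge>no. norm (hardy_norm q (\<lambda>s. f (r n) (\<phi> s) - g (\<phi> s)) - 0) < x" by blast
    qed
    then show ?thesis
      using gr(1) gH by (intro exI[of _ r] exI[of _ "\<lambda>s. g (\<phi> s)"]) (simp add: composition_operator_def)
  qed
  show ?thesis
    unfolding compact_on_hardy_def using inH seq by blast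
qed

theorem theorem1p4:
  fixes k :: nat and p :: real and \<phi> :: "complex \<Rightarrow> complex"
  assumes "k \<ge> 1"
    and "0 < p" and "p \<le> 2 * real k"
    and "\<phi> \<in> symbol_class_G0"
    and "\<phi> ` right_half_plane 0 \<subseteq> angular_sector (p * pi / (4 * real k))"
  shows "bounded_on_hardy p (composition_operator \<phi>) \<and>
    (\<forall>q::real. max 1 p < q \<and> q \<le> 2 * real k \<longrightarrow>
       compact_on_hardy q (composition_operator \<phi>))"
proof -
  note phi = assms(4)
  define \<alpha> where "\<alpha> = p * pi / (4 * real k)"
  have k: "real k \<ge> 1" using assms(1) by simp
  have cone: "Re (\<phi> s - 1/2) \<ge> cos \<alpha> * norm (\<phi> s - 1/2)" if "\<alpha> < pi / 2" "Re s > 0" for s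
  proof -
    have "\<phi> s \<in> angular_sector \<alpha>"
      using assms(5) that(2) unfolding \<alpha>_def right_half_plane_def by blast
    then have "\<bar>Arg (\<phi> s - 1/2)\<bar> < \<alpha>"
      by (simp add: angular_sector_def)
    then show ?thesis
      by (rule cone_Re_ge) (use that(1) pi_gt_zero in linarith)
  qed
  have \<alpha>0: "\<alpha> > 0" using assms(2) k by (simp add: \<alpha>_def)
  have \<alpha>1: "\<alpha> < pi / 2" if "p < 2 * real k"
    using that k by (simp add: \<alpha>_def field_simps)
  have "bounded_on_hardy p (composition_operator \<phi>)"
  proof (cases "p = 2 * real k")
    case True
    have "2 / min 1 (Re (symbol_limit \<phi>) - 1/2) > 0"
      using symbol_limit_in_half_plane[OF phi] by simp
    then show ?thesis
      by (rule bounded_on_hardy_from_polynomials[OF phi assms(2)])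
        (unfold True, rule compose_mean_le_even[OF phi assms(1)])
  next
    case False
    then have \<alpha>: "\<alpha> < pi / 2" using assms(3) by (intro \<alpha>1) simp
    obtain C where "C > 0" "\<And>D. dirichlet_polynomial D \<Longrightarrow> compose_mean_le p \<phi> D (C * polynomial_norm p D powr p)"
      by (rule sector_bounded_estimate[OF phi assms(2) \<alpha>0 \<alpha> cone[OF \<alpha>]]) (auto intro: that)
    then show ?thesis
      by (rule bounded_on_hardy_from_polynomials[OF phi assms(2)])
  qed
  moreover have "compact_on_hardy q (composition_operator \<phi>)" if q: "max 1 p < q \<and> q \<le> 2 * real k" for q
  proof -
    have \<alpha>: "\<alpha> < pi / 2" using q by (intro \<alpha>1) simp
    show ?thesis
      by (rule compact_on_hardy_from_sector[OF phi _ \<alpha>0 \<alpha> cone[OF \<alpha>]]) (use q in simp)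
  qed
  ultimately show ?thesis by blast
qed

end
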